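(* Let $E=K(n,\mathcal D)$ and $F=K(n',\mathcal D')$ be totally disconnected fractal cubes, where $\mathcal D$ has cardinality $N\ge 2$ and $\mathcal D'$ has cardinality $N'\ge 2$. Then $E$ and $F$ are strictly Hölder equivalent if and only if $$\frac{\log N}{\log N'}\in\mathbb Q .$$
   Context: Fractal cubes: let $n\ge 2$ and $d\ge 1$ be integers and let $\mathcal D=\{d_1,\dots,d_N\}\subset\{0,1,\dots,n-1\}^d$ be a set of $N$ distinct digits. The fractal cube $K(n,\mathcal D)\subset\mathbb R^d$ is the unique nonempty compact set $K$ with $K=\bigcup_{j=1}^N\varphi_j(K)$, where $\varphi_j(x)=(x+d_j)/n$ for $x\in\mathbb R^d$. It carries the Euclidean metric. (The ambient dimensions of $E$ and $F$ need not be equal.) Strict Hölder equivalence: metric spaces $(X,d_X)$ and $(Y,d_Y)$ are strictly Hölder equivalent if there are a bijection $f:X\to Y$ and constants $s,C>0$ such that $$C^{-1}d_X(x_1,x_2)^s\le d_Y(f(x_1),f(x_2))\le C\,d_X(x_1,x_2)^s\quad\text{for all }x_1,x_2\in X.$$ *)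

theory Defs
  imports "HOL-Analysis.Analysis"
begin

definition digit_set :: "nat \<Rightarrow> (nat ^ 'd) set \<Rightarrow> bool" where
  "digit_set n D \<longleftrightarrow> (\<forall>d\<in>D. \<forall>i. d $ i < n)"

definition cube_map :: "nat \<Rightarrow> nat ^ 'd \<Rightarrow> real ^ 'd \<Rightarrow> real ^ 'd" where
  "cube_map n d x = (x + (\<chi> i. real (d $ i))) /\<^sub>R real n"

definition is_attractor :: "nat \<Rightarrow> (nat ^ 'd) set \<Rightarrow> (real ^ 'd) set \<Rightarrow> bool" where
  "is_attractor n D K \<longleftrightarrow> K \<noteq> {} \<and> compact K \<and> K = (\<Union>d\<in>D. cube_map n d ` K)"

text \<open>The description below is proper when \<open>n \<ge> 2\<close> and \<open>D\<close> is a nonempty digit set: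
  see \<open>ex1_is_attractor\<close>.\<close>

definition fractal_cube :: "nat \<Rightarrow> (nat ^ 'd) set \<Rightarrow> (real ^ 'd) set" where
  "fractal_cube n D = (THE K. is_attractor n D K)"

definition totally_disconnected :: "'a::topological_space set \<Rightarrow> bool" where
  "totally_disconnected S \<longleftrightarrow> (\<forall>x\<in>S. connected_component_set S x = {x})"

text \<open>For \<open>s > 0\<close> we have \<open>0 powr s = 0\<close>, so the case \<open>x = y\<close> is harmless.\<close>

definition strictly_Hoelder_equivalent ::
  "'a::metric_space set \<Rightarrow> 'b::metric_space set \<Rightarrow> bool" where
  "strictly_Hoelder_equivalent X Y \<longleftrightarrow>
    (\<exists>f s C. bij_betw f X Y \<and> s > 0 \<and> C > 0 \<and>
      (\<forall>x\<in>X. \<forall>y\<in>X. inverse C * dist x y powr s \<le> dist (f x) (f y) \<and>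
                     dist (f x) (f y) \<le> C * dist x y powr s))"


subsection \<open>Existence and uniqueness of the attractor\<close>

lemma dist_cube_map: "dist (cube_map n d x) (cube_map n d y) = dist x y / real n"
proof -
  have "cube_map n d x - cube_map n d y = (x - y) /\<^sub>R real n"
    by (simp add: cube_map_def flip: scaleR_diff_right)
  then show ?thesis by (simp add: dist_norm divide_inverse mult.commute)
qed

lemma inj_cube_map: "n > 0 \<Longrightarrow> inj (cube_map n d)"
  by (rule injI) (simp add: cube_map_def)

lemma continuous_on_cube_map: "continuous_on S (cube_map n d)"
  unfolding cube_map_def by (intro continuous_intros)

lemma finite_digit_set: "digit_set n D \<Longrightarrow> finite D"
proof -
  assume "digit_set n D"
  then have "vec_nth ` D \<subseteq> UNIV \<rightarrow>\<^sub>E {..<n}" by (auto simp: digit_set_def)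
  moreover have "finite (UNIV \<rightarrow>\<^sub>E {..<n} :: ('d::finite \<Rightarrow> nat) set)"
    by (intro finite_PiE) auto
  ultimately have "finite (vec_nth ` D)" by (rule finite_subset)
  then show ?thesis by (rule finite_imageD) (simp add: inj_on_def vec_nth_inject)
qed

lemma is_attractorD:
  assumes "is_attractor n D K"
  shows "compact K" "K \<noteq> {}" "(\<Union>d\<in>D. cube_map n d ` K) = K"
proof -
  have *: "K \<noteq> {} \<and> compact K \<and> K = (\<Union>d\<in>D. cube_map n d ` K)"
    using assms unfolding is_attractor_def .
  show "compact K" by (rule *[THEN conjunct2, THEN conjunct1])
  show "K \<noteq> {}" by (rule *[THEN conjunct1])
  show "(\<Union>d\<in>D. cube_map n d ` K) = K" by (rule *[THEN conjunct2, THEN conjunct2, symmetric])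
qed

lemma is_attractor_subset:
  assumes n: "n \<ge> 2" and A: "is_attractor n D A" and B: "is_attractor n D B"
  shows "A \<subseteq> B"
proof -
  have cmpA: "compact A" "A \<noteq> {}" and eqA: "(\<Union>d\<in>D. cube_map n d ` A) = A"
    using is_attractorD[OF A] .
  have cmpB: "compact B" "B \<noteq> {}" and eqB: "(\<Union>d\<in>D. cube_map n d ` B) = B"
    using is_attractorD[OF B] .
  have "continuous_on A (\<lambda>x. infdist x B)" by (intro continuous_intros)
  then obtain a where a: "a \<in> A" and max: "\<And>x. x \<in> A \<Longrightarrow> infdist x B \<le> infdist a B"
    using continuous_attains_sup[of A] cmpA by blast
  have "a \<in> (\<Union>d\<in>D. cube_map n d ` A)" unfolding eqA by (rule a)
  then obtain d a' where d: "d \<in> D" and a': "a' \<in> A" "a = cube_map n d a'" by blast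
  have clB: "closed B" "B \<noteq> {}" using cmpB by (simp_all add: compact_imp_closed)
  obtain b where b: "b \<in> B" "infdist a' B = dist a' b"
    using infdist_attains_inf[OF clB] by blast
  have "cube_map n d b \<in> (\<Union>d\<in>D. cube_map n d ` B)" using b d by blast
  then have "cube_map n d b \<in> B" unfolding eqB .
  then have "infdist a B \<le> dist a' b / real n"
    using infdist_le[of "cube_map n d b" B a] a'(2) by (simp add: dist_cube_map)
  also have "\<dots> \<le> infdist a B / real n"
    using max[OF a'(1)] b by (simp add: divide_right_mono)
  also have "\<dots> \<le> infdist a B / 2"
    using n by (intro divide_left_mono) (auto simp: infdist_nonneg)
  finally have "infdist a B \<le> 0" by simp
  show ?thesis
  proof
    fix x assume "x \<in> A"
    with max have "infdist x B \<le> 0" using \<open>infdist a B \<le> 0\<close> by force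
    with infdist_nonneg[of x B] have "infdist x B = 0" by linarith
    then show "x \<in> B" using clB by (simp add: in_closed_iff_infdist_zero)
  qed
qed

lemma ex_is_attractor:
  fixes D :: "(nat ^ 'd) set"
  assumes n: "n \<ge> 2" and D: "digit_set n D" "D \<noteq> {}"
  shows "\<exists>K. is_attractor n D K"
proof -
  define T where "T X = (\<Union>d\<in>D. cube_map n d ` X)" for X
  define A where "A k = (T ^^ k) (cbox 0 1)" for k
  have fin: "finite D" using D finite_digit_set by blast
  have A0: "A 0 = cbox 0 1" and AS: "A (Suc k) = T (A k)" for k by (simp_all add: A_def)
  have mono: "X \<subseteq> Y \<Longrightarrow> T X \<subseteq> T Y" for X Y unfolding T_def by blast
  have "cube_map n d x \<in> cbox 0 1" if "d \<in> D" "x \<in> cbox 0 1" for d and x :: "real ^ 'd"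
  proof -
    have "0 \<le> cube_map n d x $ i \<and> cube_map n d x $ i \<le> 1" for i
    proof -
      have x: "0 \<le> x $ i" "x $ i \<le> 1" using that by (auto simp: mem_box_cart)
      have "Suc (d $ i) \<le> n" using D that by (auto simp: digit_set_def Suc_le_eq)
      then have "real (d $ i) + 1 \<le> real n" by linarith
      then have "x $ i + real (d $ i) \<le> real n" using x by linarith
      with x n show ?thesis by (simp add: cube_map_def field_simps)
    qed
    then show ?thesis by (simp add: mem_box_cart)
  qed
  then have "A (Suc 0) \<subseteq> A 0" unfolding AS A0 T_def by blast
  then have dec1: "A (Suc k) \<subseteq> A k" for k
    by (induction k) (auto simp only: AS dest: mono)
  have dec: "A l \<subseteq> A k" if "k \<le> l" for k l
    by (rule lift_Suc_antimono_le[of A]) (use dec1 that in auto)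
  have ne: "A k \<noteq> {}" for k
  proof (induction k)
    case 0
    have "(0 :: real ^ 'd) \<in> cbox 0 1" by (simp add: mem_box_cart)
    then show ?case unfolding A0 by blast
  next
    case (Suc k)
    then show ?case using D by (simp add: AS T_def)
  qed
  have cmp: "compact (A k)" for k
    by (induction k)
      (auto simp: A0 AS T_def fin intro!: compact_UN compact_continuous_image continuous_on_cube_map)
  define K where "K = (\<Inter>k. A k)"
  have "K \<noteq> {}" unfolding K_def by (rule compact_nest) (use cmp ne dec in auto)
  moreover have "compact K" unfolding K_def using cmp by (intro compact_Inter) auto
  moreover have "T K \<subseteq> K"
  proof -
    have "T K \<subseteq> A k" for k
      using mono[of K "A k"] dec1[of k] AS[of k] unfolding K_def by blast
    then show ?thesis unfolding K_def by blast
  qed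
  moreover have "K \<subseteq> T K"
  proof
    fix x assume x: "x \<in> K"
    have "\<exists>d\<in>D. \<forall>k. x \<in> cube_map n d ` A k"
    proof (rule ccontr)
      assume "\<not> ?thesis"
      then obtain k where k: "\<And>d. d \<in> D \<Longrightarrow> x \<notin> cube_map n d ` A (k d)" by metis
      define m where "m = Max (k ` D)"
      have "k d \<le> m" if "d \<in> D" for d unfolding m_def using fin that by simp
      then have "x \<notin> cube_map n d ` A m" if "d \<in> D" for d using k dec that by blast
      then have "x \<notin> A (Suc m)" unfolding AS T_def by blast
      then show False using x unfolding K_def by blast
    qed
    then obtain d where d: "d \<in> D" "\<And>k. x \<in> cube_map n d ` A k" by blast
    then obtain y where y: "x = cube_map n d y" by blast
    have "y \<in> A k" for k
      using d(2)[of k] inj_cube_map[of n d] n y by (auto simp: inj_def)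
    then show "x \<in> T K" unfolding T_def K_def using d y by blast
  qed
  ultimately have "is_attractor n D K"
    unfolding is_attractor_def T_def by (intro conjI equalityI)
  then show ?thesis ..
qed

lemma ex1_is_attractor:
  assumes "n \<ge> 2" "digit_set n D" "D \<noteq> {}"
  shows "\<exists>!K. is_attractor n D K"
proof (rule ex_ex1I[OF ex_is_attractor[OF assms]])
  fix K L assume "is_attractor n D K" "is_attractor n D L"
  then show "K = L" by (intro subset_antisym is_attractor_subset[OF assms(1)])
qed

lemma is_attractor_fractal_cube:
  assumes "n \<ge> 2" "digit_set n D" "D \<noteq> {}"
  shows "is_attractor n D (fractal_cube n D)"
  unfolding fractal_cube_def by (rule theI') (rule ex1_is_attractor[OF assms])

end

theory Submission
  imports Defs
begin

text \<open>A totally disconnected fractal cube \<open>E\<close> with \<open>N\<close> digits is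
    bi-Lipschitz equivalent to the space of
  sequences over an alphabet of \<open>N ^ L\<close> letters, where agreement in the first \<open>j\<close>
      letters corresponds to
  distance about \<open>n ^ (- L j)\<close>. Indeed the connected components of the cubes of level
      \<open>k\<close> are unions of
  boundedly many cubes; give a component the number of its cubes as mass. A component away from the faces of
  the unit cube recurs at all places and bounded scales. Below such a component all masses
  are multiples of their gcd \<open>g\<close>, and, for large \<open>L\<close>, items whose sizes have gcd
      1 can be packed exactly
  into bins of size \<open>N ^ L\<close>; hence it can be matched with finitely many cylinders, without
      distorting masses.
  The remaining components are so few that one letter for each of them suffices, and the discrepancy between the
  other letters and the mass of the good components is removed by Hilbert's hotel.

  If \<open>N ^ k = N' ^ l\<close>, both cubes are coded by the same sequence space. Conversely, a strict
  Hoelder equivalence induces a bijection between two sequence spaces. Counting the cylinders in the images of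
  cylinders, relative to their measures, gives a bounded quantity that does not decrease along a suitable
      path and whose
  successive quotients take finitely many values. So it is finally constant, which forces a relation
  \<open>N ^ k = N' ^ l\<close>.\<close>


section \<open>Nested equivalence relations and bijections that shift levels boundedly\<close>

section \<open>Back and forth between nested partitions\<close>

text \<open>A coding is only asked to shift levels by a bounded amount; mass need not be preserved,
  and this freedom absorbs masses that do not fit. What has to be watched instead is uniformity:
  infinitely many local matchings are glued, so their shifts must have one common bound. It comes
  from the bound on the cardinality of components. That bound is where total disconnectedness
  enters, and not directly: a chain of touching cubes may run through many small copies of the
  fractal, whereas the hypothesis speaks about one. Chains are therefore magnified and followed in a
  finite union of translates of \<open>E\<close>, by means of a property that survives such unions.

  The exponent \<open>L\<close> has two tasks, to make the packing exact and to make bad components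
  rarer than letters. Every large \<open>L\<close> will do, so two cubes with
  \<open>N ^ k = N' ^ l\<close> can be given the same alphabet; one suitable \<open>L\<close> for
  each cube would not guarantee this.\<close>

definition tower :: "'a set \<Rightarrow> (nat \<Rightarrow> 'a \<Rightarrow> 'a \<Rightarrow> bool)
    \<Rightarrow> bool" where
  "tower X R \<longleftrightarrow>
    (\<forall>k. \<forall>x\<in>X. R k x x) \<and>
    (\<forall>k. \<forall>x\<in>X. \<forall>y\<in>X. R k x y \<longrightarrow> R k y x) \<and>
    (\<forall>k. \<forall>x\<in>X. \<forall>y\<in>X. \<forall>z\<in>X. R k x y \<longrightarrow> R k y z
        \<longrightarrow> R k x z) \<and>
    (\<forall>k. \<forall>x\<in>X. \<forall>y\<in>X. R (Suc k) x y \<longrightarrow> R k x y) \<and>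
    (\<forall>x\<in>X. \<forall>y\<in>X. (\<forall>k. R k x y) \<longrightarrow> x = y) \<and>
    (\<forall>u. (\<forall>k. u k \<in> X) \<longrightarrow> (\<forall>k. R k (u k) (u (Suc k)))
        \<longrightarrow> (\<exists>x\<in>X. \<forall>k. R k x (u k)))"

text \<open>With levels read as logarithmic scales, this is a bi-Lipschitz condition, and
  \<open>c\<close> is the logarithm of its constant.\<close>

definition coarse_equiv ::
  "nat \<Rightarrow> (nat \<Rightarrow> 'a \<Rightarrow> 'a \<Rightarrow> bool) \<Rightarrow> (nat
      \<Rightarrow> 'b \<Rightarrow> 'b \<Rightarrow> bool) \<Rightarrow> 'a set \<Rightarrow> 'b set
      \<Rightarrow> ('a \<Rightarrow> 'b) \<Rightarrow> bool"
  where "coarse_equiv c R S X Y f \<longleftrightarrow> bij_betw f X Y \<and>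
    (\<forall>x\<in>X. \<forall>y\<in>X. \<forall>j. (R (j + c) x y \<longrightarrow> S j (f x) (f y))
        \<and> (S (j + c) (f x) (f y) \<longrightarrow> R j x y))"

lemma towerD:
  assumes "tower X R"
  shows tower_refl: "x \<in> X \<Longrightarrow> R k x x"
    and tower_sym: "\<lbrakk>R k x y; x \<in> X; y \<in> X\<rbrakk> \<Longrightarrow> R k y x"
    and tower_trans: "\<lbrakk>R k x y; R k y z; x \<in> X; y \<in> X; z \<in> X\<rbrakk> \<Longrightarrow>
        R k x z"
    and tower_Suc: "\<lbrakk>R (Suc k) x y; x \<in> X; y \<in> X\<rbrakk> \<Longrightarrow> R k x y"
    and tower_sep: "\<lbrakk>\<And>k. R k x y; x \<in> X; y \<in> X\<rbrakk> \<Longrightarrow> x = y"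
    and tower_complete: "\<lbrakk>\<And>k. u k \<in> X; \<And>k. R k (u k) (u (Suc k))\<rbrakk>
        \<Longrightarrow> \<exists>x\<in>X. \<forall>k. R k x (u k)"
  using assms unfolding tower_def by metis+

lemma tower_antimono:
  assumes "tower X R" "x \<in> X" "y \<in> X" "R l x y" "k \<le> l"
  shows "R k x y"
  using assms(5,4)
proof (induction rule: inc_induct)
  case (step n)
  then show ?case using towerD(4)[OF assms(1)] assms by blast
qed

lemma coarse_equiv_bij: "coarse_equiv c R S X Y f \<Longrightarrow> bij_betw f X Y"
  by (simp add: coarse_equiv_def)

lemma coarse_equiv_inv:
  assumes "coarse_equiv c R S X Y f"
  shows "coarse_equiv c S R Y X (inv_into X f)"
proof -
  have bij: "bij_betw f X Y" using assms by (simp add: coarse_equiv_def)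
  then have "f (inv_into X f y) = y" "inv_into X f y \<in> X" if "y \<in> Y" for y
    using that by (auto simp: bij_betw_inv_into_right bij_betw_def inv_into_into)
  then show ?thesis using assms bij_betw_inv_into[OF bij] unfolding coarse_equiv_def by metis
qed

lemma coarse_equiv_trans:
  assumes "coarse_equiv c R S X Y f" "coarse_equiv d S T Y Z g"
  shows "coarse_equiv (c + d) R T X Z (g \<circ> f)"
proof -
  have bij: "bij_betw f X Y" "bij_betw g Y Z" using assms by (auto simp: coarse_equiv_def)
  have "R (j + (c + d)) x y \<longrightarrow> T j (g (f x)) (g (f y))" if "x \<in> X" "y \<in> X" for x y j
    using assms that bij_betwE[OF bij(1)] unfolding coarse_equiv_def
    by (metis add.assoc add.commute)
  moreover have "T (j + (c + d)) (g (f x)) (g (f y)) \<longrightarrow> R j x y" if "x \<in> X" "y \<in> X"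
      for x y j
    using assms that bij_betwE[OF bij(1)] unfolding coarse_equiv_def
    by (metis add.assoc add.commute)
  ultimately show ?thesis using bij_betw_trans[OF bij] unfolding coarse_equiv_def by simp
qed

lemma coarse_equiv_mono:
  assumes "coarse_equiv c R S X Y f" "c \<le> d" "tower X R" "tower Y S"
  shows "coarse_equiv d R S X Y f"
proof -
  have bij: "bij_betw f X Y" using assms by (auto simp: coarse_equiv_def)
  have "R (j + c) x y" if "x \<in> X" "y \<in> X" "R (j + d) x y" for x y j
    using tower_antimono[OF assms(3) that] assms(2) by simp
  moreover have "S (j + c) x y" if "x \<in> Y" "y \<in> Y" "S (j + d) x y" for x y j
    using tower_antimono[OF assms(4) that] assms(2) by simp
  ultimately show ?thesis using assms(1) bij_betwE[OF bij] unfolding coarse_equiv_def by metis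
qed

definition branches :: "'i \<Rightarrow> (nat \<Rightarrow> 'i \<Rightarrow> 'i set) \<Rightarrow> (nat
    \<Rightarrow> 'i) set" where
  "branches r N = {q. q 0 = r \<and> (\<forall>k. q (Suc k) \<in> N k (q k))}"

text \<open>Completeness gives each branch a limit point. The sets \<open>W i\<close> are not
  assumed to be closed; that the limit stays in every \<open>W (q k)\<close> follows from the
  separation of siblings, which leaves it no other child to lie in.\<close>

lemma branch_points:
  fixes W :: "'i \<Rightarrow> 'a set"
  assumes tw: "tower X R"
    and root: "\<Phi> 0 r" "W r = X"
    and inv: "\<And>k i. \<Phi> k i \<Longrightarrow> W i \<subseteq> X \<and> W i \<noteq> {}"
    and small: "\<And>k i x y j. \<lbrakk>\<Phi> k i; x \<in> W i; y \<in> W i; j + c \<le> k\<rbrakk>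
        \<Longrightarrow> R j x y"
    and step: "\<And>k i. \<Phi> k i \<Longrightarrow> W i = \<Union>(W ` N k i) \<and> (\<forall>i'\<in>N
        k i. \<Phi> (Suc k) i')"
    and sep: "\<And>k i i' i'' x y. \<lbrakk>\<Phi> k i; i' \<in> N k i; i'' \<in> N k i; i' \<noteq> i'';
        x \<in> W i'; y \<in> W i''\<rbrakk>
                 \<Longrightarrow> \<not> R (k + c) x y"
  shows "\<exists>\<pi>. bij_betw \<pi> (branches r N) X \<and>
    (\<forall>q\<in>branches r N. \<forall>q'\<in>branches r N. \<forall>j.
       (R (j + c) (\<pi> q) (\<pi> q') \<longrightarrow> q (Suc j) = q' (Suc j)) \<and>
       (q (j + c) = q' (j + c) \<longrightarrow> R j (\<pi> q) (\<pi> q')))"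
proof -
  have \<Phi>: "\<Phi> k (q k)" if "q \<in> branches r N" for q k
    using that by (induction k) (use root step in \<open>auto simp: branches_def\<close>)
  have sub: "W (q (Suc k)) \<subseteq> W (q k)" if "q \<in> branches r N" for q k
    using step[OF \<Phi>[OF that, of k]] that unfolding branches_def by blast
  have dec: "W (q l) \<subseteq> W (q k)" if "q \<in> branches r N" "k \<le> l" for q k l
    using lift_Suc_antimono_le[of "\<lambda>k. W (q k)"] sub that by blast
  have eqs: "q (Suc j) = q' (Suc j)"
    if q: "q \<in> branches r N" "q' \<in> branches r N" and x: "\<And>k. x \<in> W (q k)" "\<And>k. y
        \<in> W (q' k)"
      and R: "R (j + c) x y" for q q' x y j
    using R
  proof (induction j)
    case 0
    show ?case
    proof (rule ccontr)
      assume "q (Suc 0) \<noteq> q' (Suc 0)"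
      then have "\<not> R (0 + c) x y"
        using q x \<Phi>[OF q(1), of 0]
        by (intro sep[of 0 r "q (Suc 0)" "q' (Suc 0)"]) (simp_all add: branches_def, (metis)+)
      then show False using 0 by simp
    qed
  next
    case (Suc j)
    have XX: "x \<in> X" "y \<in> X" using x inv[OF \<Phi>[OF q(1)]] inv[OF \<Phi>[OF q(2)]] by blast+
    have "R (j + c) x y" using towerD(4)[OF tw, of "j + c"] Suc.prems XX by simp
    then have e: "q (Suc j) = q' (Suc j)" by (rule Suc.IH)
    show ?case
    proof (rule ccontr)
      assume "q (Suc (Suc j)) \<noteq> q' (Suc (Suc j))"
      then have "\<not> R (Suc j + c) x y"
        using q x \<Phi>[OF q(1), of "Suc j"] e
        by (intro sep[of "Suc j" "q (Suc j)" "q (Suc (Suc j))" "q' (Suc (Suc j))"])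
          (simp_all add: branches_def, (metis)+)
      then show False using Suc by simp
    qed
  qed
  have ex: "\<exists>x\<in>X. \<forall>k. x \<in> W (q k)" if q: "q \<in> branches r N" for q
  proof -
    have "\<exists>x. x \<in> W (q k)" for k using inv[OF \<Phi>[OF q]] by blast
    then obtain x where x: "\<And>k. x k \<in> W (q k)" by metis
    have X: "x k \<in> X" for k using x inv[OF \<Phi>[OF q]] by blast
    \<comment> \<open>Smallness at level \<open>k + c\<close> only yields \<open>R k\<close>, so the
      coherent sequence is delayed by \<open>c\<close>.\<close>
    define u where "u k = x (k + c)" for k
    have "\<exists>z\<in>X. \<forall>k. R k z (u k)"
    proof (rule towerD(6)[OF tw])
      show "u k \<in> X" for k using X by (simp add: u_def)
      show "R k (u k) (u (Suc k))" for k
        unfolding u_def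
        by (rule small[OF \<Phi>[OF q, of "k + c"]]) (use x sub[OF q, of "k + c"] in auto)
    qed
    then obtain z where z: "z \<in> X" "\<And>k. R k z (u k)" by blast
    have "z \<in> W (q k)" for k
    proof (induction k)
      case 0
      then show ?case using z root q by (simp add: branches_def)
    next
      case (Suc k)
      then obtain i where i: "i \<in> N k (q k)" "z \<in> W i" using step[OF \<Phi>[OF q]] by blast
      have "i = q (Suc k)"
      proof (rule ccontr)
        assume "i \<noteq> q (Suc k)"
        \<comment> \<open>A late term of the sequence lies in \<open>W (q (Suc k))\<close> and is
          related to \<open>z\<close> at level \<open>k + c\<close>, which forbids a different child
          containing \<open>z\<close>.\<close>
        moreover have "u (k + c + 1) \<in> W (q (Suc k))"
          using subsetD[OF dec[OF q, of "Suc k" "k + c + 1 + c"] x] by (simp add: u_def)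
        ultimately have "\<not> R (k + c) z (u (k + c + 1))"
          using sep[OF \<Phi>[OF q] i(1) _ _ i(2)] q unfolding branches_def by blast
        moreover have "R (k + c) z (u (k + c + 1))"
          using towerD(4)[OF tw, of "k + c" z "u (k + c + 1)"] z(1) z(2)[of "k + c + 1"] X
          by (simp add: u_def)
        ultimately show False by simp
      qed
      then show ?case using i by simp
    qed
    then show ?thesis using z by blast
  qed
  then obtain \<pi> where \<pi>: "\<And>q. q \<in> branches r N \<Longrightarrow> \<pi> q \<in> X" "\<And>q
      k. q \<in> branches r N \<Longrightarrow> \<pi> q \<in> W (q k)"
    by metis
  have near: "R j x y" if "q \<in> branches r N" "x \<in> W (q (j + c))" "y \<in> W (q (j + c))" for q j x y
    by (rule small[OF \<Phi>[OF that(1), of "j + c"]]) (use that in auto)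
  have surj: "\<exists>q\<in>branches r N. \<pi> q = x" if x: "x \<in> X" for x
  proof -
    have "\<exists>i'\<in>N k i. x \<in> W i'" if "\<Phi> k i" "x \<in> W i" for k i
      using step[OF that(1)] that(2) by blast
    then obtain nx where nx: "\<And>k i. \<lbrakk>\<Phi> k i; x \<in> W i\<rbrakk> \<Longrightarrow> nx k i
        \<in> N k i \<and> x \<in> W (nx k i)" by metis
    define q where "q = rec_nat r nx"
    have q0: "q 0 = r" and qS: "q (Suc k) = nx k (q k)" for k by (simp_all add: q_def)
    have q: "\<Phi> k (q k) \<and> x \<in> W (q k)" for k
    proof (induction k)
      case 0
      then show ?case using root x q0 by simp
    next
      case (Suc k)
      then show ?case using nx[of k "q k"] step[of k "q k"] unfolding qS by blast
    qed
    have "q (Suc k) \<in> N k (q k)" for k using nx q unfolding qS by blast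
    then have qb: "q \<in> branches r N" using q0 by (simp add: branches_def)
    have "\<pi> q = x"
    proof (rule towerD(5)[OF tw])
      show "R k (\<pi> q) x" for k by (rule near[OF qb]) (use q \<pi> qb in auto)
    qed (use \<pi> qb x in auto)
    then show ?thesis using qb by blast
  qed
  have inj: "q = q'" if "q \<in> branches r N" "q' \<in> branches r N" "\<pi> q = \<pi> q'" for q q'
  proof
    fix k
    show "q k = q' k"
    proof (cases k)
      case 0
      then show ?thesis using that by (simp add: branches_def)
    next
      case (Suc j)
      then show ?thesis using eqs[OF that(1,2), of "\<pi> q" "\<pi> q" j] that \<pi> towerD(1)[OF tw] by metis
    qed
  qed
  show ?thesis
  proof (intro exI[of _ \<pi>] conjI ballI allI impI)
    show "bij_betw \<pi> (branches r N) X"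
      unfolding bij_betw_def inj_on_def using inj surj \<pi>(1) by blast
  next
    fix q q' j assume "q \<in> branches r N" "q' \<in> branches r N" "R (j + c) (\<pi> q) (\<pi> q')"
    then show "q (Suc j) = q' (Suc j)" using eqs \<pi> by blast
  next
    fix q q' j assume "q \<in> branches r N" "q' \<in> branches r N" "q (j + c) = q' (j + c)"
    then show "R j (\<pi> q) (\<pi> q')" using near \<pi> by metis
  qed
qed

text \<open>Both spaces are identified with the branches of one tree of pairs, and the bijection is
  the composite. Reading off the branch and returning to points cost \<open>c\<close> levels each,
  hence \<open>2 * c\<close>.\<close>

theorem back_and_forth:
  assumes tX: "tower X R" and tY: "tower Y S"
    and root: "\<Phi> 0 X Y"
    and inv: "\<And>k U V. \<Phi> k U V \<Longrightarrow> U \<subseteq> X \<and> U \<noteq> {} \<and> V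
        \<subseteq> Y \<and> V \<noteq> {}"
    and smallX: "\<And>k U V x y j. \<lbrakk>\<Phi> k U V; x \<in> U; y \<in> U; j + c \<le> k\<rbrakk>
        \<Longrightarrow> R j x y"
    and smallY: "\<And>k U V x y j. \<lbrakk>\<Phi> k U V; x \<in> V; y \<in> V; j + c \<le> k\<rbrakk>
        \<Longrightarrow> S j x y"
    and step: "\<And>k U V. \<Phi> k U V \<Longrightarrow> \<exists>\<C>. U = \<Union>(fst ` \<C>) \<and> V
        = \<Union>(snd ` \<C>) \<and>
        (\<forall>p\<in>\<C>. \<Phi> (Suc k) (fst p) (snd p)) \<and>
        (\<forall>p\<in>\<C>. \<forall>p'\<in>\<C>. p \<noteq> p' \<longrightarrow>
           (\<forall>x\<in>fst p. \<forall>y\<in>fst p'. \<not> R (k + c) x y) \<and> (\<forall>x\<in>snd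
               p. \<forall>y\<in>snd p'. \<not> S (k + c) x y))"
  shows "\<exists>f. coarse_equiv (2 * c) R S X Y f"
proof -
  define good where "good k p \<C> \<longleftrightarrow> fst p = \<Union>(fst ` \<C>) \<and> snd p =
      \<Union>(snd ` \<C>) \<and>
        (\<forall>p\<in>\<C>. \<Phi> (Suc k) (fst p) (snd p)) \<and>
        (\<forall>p\<in>\<C>. \<forall>p'\<in>\<C>. p \<noteq> p' \<longrightarrow>
           (\<forall>x\<in>fst p. \<forall>y\<in>fst p'. \<not> R (k + c) x y) \<and> (\<forall>x\<in>snd
               p. \<forall>y\<in>snd p'. \<not> S (k + c) x y))"
    for k and p :: "'a set \<times> 'b set" and \<C>
  define N where "N k p = (SOME \<C>. good k p \<C>)" for k p
  have N: "good k p (N k p)" if "\<Phi> k (fst p) (snd p)" for k p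
    unfolding N_def by (rule someI_ex) (use step[OF that] in \<open>simp add: good_def\<close>)
  let ?\<Phi> = "\<lambda>k p. \<Phi> k (fst p) (snd p)" and ?B = "branches (X, Y) N"
  have "\<exists>\<pi>. bij_betw \<pi> ?B X \<and>
    (\<forall>q\<in>?B. \<forall>q'\<in>?B. \<forall>j.
       (R (j + c) (\<pi> q) (\<pi> q') \<longrightarrow> q (Suc j) = q' (Suc j)) \<and>
       (q (j + c) = q' (j + c) \<longrightarrow> R j (\<pi> q) (\<pi> q')))"
    apply (rule branch_points[OF tX, where \<Phi> = ?\<Phi> and W = fst])
    subgoal using root by simp
    subgoal by simp
    subgoal using inv by blast
    subgoal using smallX by blast
    subgoal for k p using N[of k p] by (simp add: good_def)
    subgoal for k p using N[of k p] unfolding good_def by blast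
    done
  then obtain \<pi> where \<pi>: "bij_betw \<pi> ?B X"
    "\<And>q q' j. \<lbrakk>q \<in> ?B; q' \<in> ?B; R (j + c) (\<pi> q) (\<pi> q')\<rbrakk>
        \<Longrightarrow> q (Suc j) = q' (Suc j)"
    "\<And>q q' j. \<lbrakk>q \<in> ?B; q' \<in> ?B; q (j + c) = q' (j + c)\<rbrakk> \<Longrightarrow> R j
        (\<pi> q) (\<pi> q')" by blast
  have "\<exists>\<pi>. bij_betw \<pi> ?B Y \<and>
    (\<forall>q\<in>?B. \<forall>q'\<in>?B. \<forall>j.
       (S (j + c) (\<pi> q) (\<pi> q') \<longrightarrow> q (Suc j) = q' (Suc j)) \<and>
       (q (j + c) = q' (j + c) \<longrightarrow> S j (\<pi> q) (\<pi> q')))"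
    apply (rule branch_points[OF tY, where \<Phi> = ?\<Phi> and W = snd])
    subgoal using root by simp
    subgoal by simp
    subgoal using inv by blast
    subgoal using smallY by blast
    subgoal for k p using N[of k p] by (simp add: good_def)
    subgoal for k p using N[of k p] unfolding good_def by blast
    done
  then obtain \<rho> where \<rho>: "bij_betw \<rho> ?B Y"
    "\<And>q q' j. \<lbrakk>q \<in> ?B; q' \<in> ?B; S (j + c) (\<rho> q) (\<rho> q')\<rbrakk>
        \<Longrightarrow> q (Suc j) = q' (Suc j)"
    "\<And>q q' j. \<lbrakk>q \<in> ?B; q' \<in> ?B; q (j + c) = q' (j + c)\<rbrakk> \<Longrightarrow> S j
        (\<rho> q) (\<rho> q')" by blast
  define f where "f = \<rho> \<circ> inv_into ?B \<pi>"
  have \<pi>i: "inv_into ?B \<pi> x \<in> ?B" "\<pi> (inv_into ?B \<pi> x) = x" if "x \<in> X" for x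
    using \<pi>(1) that by (auto simp: bij_betw_inv_into_right bij_betw_def inv_into_into)
  have eq0: "q 0 = q' 0" if "q \<in> ?B" "q' \<in> ?B" for q q' :: "nat \<Rightarrow> 'a set \<times> 'b set"
    using that by (simp add: branches_def)
  \<comment> \<open>Separation recovers the branch up to index \<open>j + c\<close>, which is what
    smallness on the other side needs for level \<open>j\<close>. Index 0 is the common
    root.\<close>
  have A: "q (j + c) = q' (j + c)"
    if "q \<in> ?B" "q' \<in> ?B" "R (j + 2 * c) (\<pi> q) (\<pi> q')" for q q' j
  proof (cases "j + c")
    case 0
    then show ?thesis using eq0[OF that(1,2)] by simp
  next
    case (Suc i)
    have "\<pi> q \<in> X" "\<pi> q' \<in> X" using \<pi>(1) that by (auto dest: bij_betwE)
    then have "R (i + c) (\<pi> q) (\<pi> q')"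
      by (rule tower_antimono[OF tX _ _ that(3)]) (use Suc in auto)
    then show ?thesis using \<pi>(2)[OF that(1,2), of i] Suc by simp
  qed
  have B: "q (j + c) = q' (j + c)"
    if "q \<in> ?B" "q' \<in> ?B" "S (j + 2 * c) (\<rho> q) (\<rho> q')" for q q' j
  proof (cases "j + c")
    case 0
    then show ?thesis using eq0[OF that(1,2)] by simp
  next
    case (Suc i)
    have "\<rho> q \<in> Y" "\<rho> q' \<in> Y" using \<rho>(1) that by (auto dest: bij_betwE)
    then have "S (i + c) (\<rho> q) (\<rho> q')"
      by (rule tower_antimono[OF tY _ _ that(3)]) (use Suc in auto)
    then show ?thesis using \<rho>(2)[OF that(1,2), of i] Suc by simp
  qed
  have "coarse_equiv (2 * c) R S X Y f"
    unfolding coarse_equiv_def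
  proof (intro conjI ballI allI impI)
    show "bij_betw f X Y" unfolding f_def by (rule bij_betw_trans[OF bij_betw_inv_into[OF \<pi>(1)] \<rho>(1)])
  next
    fix x y j assume "x \<in> X" "y \<in> X" "R (j + 2 * c) x y"
    then show "S j (f x) (f y)" unfolding f_def comp_apply by (intro \<rho>(3) A) (simp_all add: \<pi>i)
  next
    fix x y j assume "x \<in> X" "y \<in> X" "S (j + 2 * c) (f x) (f y)"
    then show "R j x y" using \<pi>(3)[OF \<pi>i(1)[of x] \<pi>i(1)[of y] B[OF \<pi>i(1)[of x] \<pi>i(1)[of
        y]], of j] by (simp add: \<pi>i f_def)
  qed
  then show ?thesis by blast
qed


section \<open>Stopping the recursion at pairs that are already matched\<close>

lemma coarse_equiv_subset:
  assumes "coarse_equiv c R S X Y f" "U \<subseteq> X"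
  shows "coarse_equiv c R S U (f ` U) f"
  using assms unfolding coarse_equiv_def bij_betw_def by (auto intro: inj_on_subset)

text \<open>The recursion may stop here, since a map with the uniform constant \<open>c\<close> is
  known. Smallness is demanded of \<open>V\<close> only; the map carries it to \<open>U\<close> at a
  cost of \<open>c\<close> levels.\<close>

definition leaf ::
  "nat \<Rightarrow> (nat \<Rightarrow> 'a \<Rightarrow> 'a \<Rightarrow> bool) \<Rightarrow> (nat
      \<Rightarrow> 'b \<Rightarrow> 'b \<Rightarrow> bool) \<Rightarrow> 'a set \<Rightarrow> 'b set
      \<Rightarrow> nat \<Rightarrow> 'a set \<Rightarrow> 'b set \<Rightarrow> bool"
  where "leaf c R S X Y k U V \<longleftrightarrow> U \<subseteq> X \<and> V \<subseteq> Y \<and> U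
      \<noteq> {} \<and>
    (\<forall>x\<in>V. \<forall>y\<in>V. \<forall>j<k. S j x y) \<and> (\<exists>h. coarse_equiv c R S U V h)"

text \<open>Cutting \<open>V\<close> into its \<open>S k\<close>-classes and \<open>U\<close> along
  the map refines a leaf forever, so that leaves fit into the scheme of
  \<open>back_and_forth\<close> like ordinary pairs.\<close>

lemma leaf_step:
  assumes tX: "tower X R" and tY: "tower Y S" and leaf: "leaf c R S X Y k U V"
  shows "\<exists>\<C>. U = \<Union>(fst ` \<C>) \<and> V = \<Union>(snd ` \<C>) \<and>
        (\<forall>p\<in>\<C>. leaf c R S X Y (Suc k) (fst p) (snd p)) \<and>
        (\<forall>p\<in>\<C>. \<forall>p'\<in>\<C>. p \<noteq> p' \<longrightarrow>
           (\<forall>x\<in>fst p. \<forall>y\<in>fst p'. \<not> R (k + Suc c) x y) \<and>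
           (\<forall>x\<in>snd p. \<forall>y\<in>snd p'. \<not> S (k + Suc c) x y))"
proof -
  obtain h where U: "U \<subseteq> X" and V: "V \<subseteq> Y" and h: "coarse_equiv c R S U V h"
    using leaf unfolding leaf_def by blast
  have bij: "bij_betw h U V" using h by (rule coarse_equiv_bij)
  have hV: "h x \<in> V" if "x \<in> U" for x using bij that by (auto dest: bij_betwE)
  define P where "P v = ({x\<in>U. S k (h x) v}, {y\<in>V. S k y v})" for v
  have refl: "S k v v" if "v \<in> V" for v using towerD(1)[OF tY] V that by blast
  have sym: "S k y x" if "S k x y" "x \<in> V" "y \<in> V" for x y
    using towerD(2)[OF tY that(1)] that V by blast
  have trans: "S k x z" if "S k x y" "S k y z" "x \<in> V" "y \<in> V" "z \<in> V" for x y z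
    using towerD(3)[OF tY that(1,2)] that V by blast
  have Peq: "P v = P v'" if v: "v \<in> V" "v' \<in> V" "S k v v'" for v v'
  proof -
    have "S k y v \<longleftrightarrow> S k y v'" if "y \<in> V" for y
      using trans[of y v v'] trans[of y v' v] sym v that by blast
    then show ?thesis unfolding P_def using hV by auto
  qed
  have PS: "S k v v'" if v: "v \<in> V" "v' \<in> V" "x \<in> snd (P v)" "y \<in> snd (P v')" "S k x y" for
      v v' x y
  proof -
    have "x \<in> V" "y \<in> V" "S k x v" "S k y v'" using v by (simp_all add: P_def)
    then show ?thesis using sym[of x v] trans[of v x y] trans[of v y v'] v by blast
  qed
  show ?thesis
  proof (intro exI[of _ "P ` V"] conjI ballI impI)
    show "U = \<Union>(fst ` P ` V)" using hV refl by (auto simp: P_def)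
    show "V = \<Union>(snd ` P ` V)" using refl by (auto simp: P_def)
  next
    fix p assume "p \<in> P ` V"
    then obtain v where v: "v \<in> V" "p = P v" by blast
    obtain u where u: "u \<in> U" "h u = v" using bij v by (auto simp: bij_betw_def)
    have im: "h ` fst (P v) = snd (P v)" using bij unfolding P_def bij_betw_def by auto
    have "coarse_equiv c R S (fst (P v)) (snd (P v)) h"
      using coarse_equiv_subset[OF h, of "fst (P v)"] im by (auto simp: P_def)
    moreover have "S j x y" if "x \<in> snd (P v)" "y \<in> snd (P v)" "j < Suc k" for x y j
    proof (rule tower_antimono[OF tY])
      have "x \<in> V" "y \<in> V" "S k x v" "S k y v" using that by (simp_all add: P_def)
      then show "S k x y" using sym[of y v] trans[of x v y] v by blast
    qed (use that V in \<open>auto simp: P_def\<close>)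
    moreover have "u \<in> fst (P v)" using u refl v by (simp add: P_def)
    moreover have "fst (P v) \<subseteq> X" "snd (P v) \<subseteq> Y" using U V by (auto simp: P_def)
    ultimately show "leaf c R S X Y (Suc k) (fst p) (snd p)"
      unfolding leaf_def v(2) by blast
  next
    fix p p' assume "p \<in> P ` V" "p' \<in> P ` V" "p \<noteq> p'"
    then obtain v v' where v: "v \<in> V" "p = P v" "v' \<in> V" "p' = P v'" "\<not> S k v v'" using Peq by
        blast
    have snd: "\<not> S (k + Suc c) x y" if "x \<in> snd p" "y \<in> snd p'" for x y
    proof
      assume S: "S (k + Suc c) x y"
      have "x \<in> Y" "y \<in> Y" using that v V by (auto simp: P_def)
      then have "S k x y" by (rule tower_antimono[OF tY _ _ S]) simp
      then show False using PS[OF v(1,3), of x y] that v by simp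
    qed
    then show "\<And>x y. \<lbrakk>x \<in> snd p; y \<in> snd p'\<rbrakk> \<Longrightarrow> \<not> S (k +
        Suc c) x y" .
    fix x y assume xy: "x \<in> fst p" "y \<in> fst p'"
    show "\<not> R (k + Suc c) x y"
    proof
      assume "R (k + Suc c) x y"
      then have R: "R (Suc k + c) x y" by simp
      have xy': "x \<in> U" "y \<in> U" "h x \<in> snd p" "h y \<in> snd p'"
        using xy v hV by (auto simp: P_def)
      then have "S (Suc k) (h x) (h y)" using h R unfolding coarse_equiv_def by blast
      then have "S k (h x) (h y)"
        using towerD(4)[OF tY] hV V xy' by blast
      then show False using PS[OF v(1,3), of "h x" "h y"] xy' v by simp
    qed
  qed
qed

text \<open>\<open>Suc c\<close> replaces \<open>c\<close> because a leaf of level \<open>k\<close>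
  is small on \<open>V\<close> only for levels strictly below \<open>k\<close>, and the passage to
  \<open>U\<close> costs another \<open>c\<close>.\<close>

theorem back_and_forth_leaves:
  assumes tX: "tower X R" and tY: "tower Y S"
    and root: "\<Phi> 0 X Y"
    and inv: "\<And>k U V. \<Phi> k U V \<Longrightarrow> U \<subseteq> X \<and> U \<noteq> {} \<and> V
        \<subseteq> Y \<and> V \<noteq> {}"
    and smallX: "\<And>k U V x y j. \<lbrakk>\<Phi> k U V; x \<in> U; y \<in> U; j + c \<le> k\<rbrakk>
        \<Longrightarrow> R j x y"
    and smallY: "\<And>k U V x y j. \<lbrakk>\<Phi> k U V; x \<in> V; y \<in> V; j + c \<le> k\<rbrakk>
        \<Longrightarrow> S j x y"
    and step: "\<And>k U V. \<Phi> k U V \<Longrightarrow> \<exists>\<C>. U = \<Union>(fst ` \<C>) \<and> V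
        = \<Union>(snd ` \<C>) \<and>
        (\<forall>p\<in>\<C>. \<Phi> (Suc k) (fst p) (snd p) \<or> leaf c R S X Y (Suc k) (fst p) (snd p))
            \<and>
        (\<forall>p\<in>\<C>. \<forall>p'\<in>\<C>. p \<noteq> p' \<longrightarrow>
           (\<forall>x\<in>fst p. \<forall>y\<in>fst p'. \<not> R (k + c) x y) \<and> (\<forall>x\<in>snd
               p. \<forall>y\<in>snd p'. \<not> S (k + c) x y))"
  shows "\<exists>f. coarse_equiv (2 * Suc c) R S X Y f"
proof (rule back_and_forth[OF tX tY, where \<Phi> = "\<lambda>k U V. \<Phi> k U V \<or> leaf c R S X Y k U V"])
  show "\<Phi> 0 X Y \<or> leaf c R S X Y 0 X Y" using root by simp
  show sub: "U \<subseteq> X \<and> U \<noteq> {} \<and> V \<subseteq> Y \<and> V \<noteq> {}" if "\<Phi> k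
      U V \<or> leaf c R S X Y k U V" for k U V
    using that
  proof
    assume "leaf c R S X Y k U V"
    then show ?thesis unfolding leaf_def coarse_equiv_def bij_betw_def by blast
  qed (rule inv)
  show "R j x y" if "\<Phi> k U V \<or> leaf c R S X Y k U V" "x \<in> U" "y \<in> U" "j + Suc c \<le> k"
      for k U V x y j
    using that(1)
  proof
    assume "leaf c R S X Y k U V"
    then obtain h where h: "coarse_equiv c R S U V h" "\<forall>x\<in>V. \<forall>y\<in>V. \<forall>j<k. S
        j x y"
      unfolding leaf_def by blast
    have "h x \<in> V" "h y \<in> V" using coarse_equiv_bij[OF h(1)] that(2,3) by (auto dest: bij_betwE)
    then have "S (j + c) (h x) (h y)" using h(2) that(4) by simp
    then show ?thesis using h(1) that unfolding coarse_equiv_def by blast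
  next
    assume "\<Phi> k U V"
    then show ?thesis by (rule smallX[OF _ that(2,3)]) (use that(4) in simp)
  qed
  show "S j x y" if "\<Phi> k U V \<or> leaf c R S X Y k U V" "x \<in> V" "y \<in> V" "j + Suc c \<le> k"
      for k U V x y j
    using that(1)
  proof
    assume "leaf c R S X Y k U V"
    then show ?thesis using that(2-4) unfolding leaf_def by simp
  next
    assume "\<Phi> k U V"
    then show ?thesis by (rule smallY[OF _ that(2,3)]) (use that(4) in simp)
  qed
next
  fix k U V assume *: "\<Phi> k U V \<or> leaf c R S X Y k U V"
  show "\<exists>\<C>. U = \<Union>(fst ` \<C>) \<and> V = \<Union>(snd ` \<C>) \<and>
        (\<forall>p\<in>\<C>. \<Phi> (Suc k) (fst p) (snd p) \<or> leaf c R S X Y (Suc k) (fst p) (snd p))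
            \<and>
        (\<forall>p\<in>\<C>. \<forall>p'\<in>\<C>. p \<noteq> p' \<longrightarrow>
           (\<forall>x\<in>fst p. \<forall>y\<in>fst p'. \<not> R (k + Suc c) x y) \<and>
           (\<forall>x\<in>snd p. \<forall>y\<in>snd p'. \<not> S (k + Suc c) x y))"
    using *
  proof
    assume "leaf c R S X Y k U V"
    from leaf_step[OF tX tY this] obtain \<C> where \<C>: "U = \<Union>(fst ` \<C>)" "V = \<Union>(snd ` \<C>)"
        "\<forall>p\<in>\<C>. leaf c R S X Y (Suc k) (fst p) (snd p)"
        "\<forall>p\<in>\<C>. \<forall>p'\<in>\<C>. p \<noteq> p' \<longrightarrow>
           (\<forall>x\<in>fst p. \<forall>y\<in>fst p'. \<not> R (k + Suc c) x y) \<and>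
           (\<forall>x\<in>snd p. \<forall>y\<in>snd p'. \<not> S (k + Suc c) x y)"
      by (elim exE conjE) (rule that)
    show ?thesis
      by (intro exI[of _ \<C>] conjI ballI disjI2 \<C>(1,2) \<C>(3)[rule_format] \<C>(4)) assumption
  next
    assume \<Phi>: "\<Phi> k U V"
    obtain \<C> where \<C>: "U = \<Union>(fst ` \<C>)" "V = \<Union>(snd ` \<C>)"
        "\<forall>p\<in>\<C>. \<Phi> (Suc k) (fst p) (snd p) \<or> leaf c R S X Y (Suc k) (fst p) (snd p)"
        "\<forall>p\<in>\<C>. \<forall>p'\<in>\<C>. p \<noteq> p' \<longrightarrow>
           (\<forall>x\<in>fst p. \<forall>y\<in>fst p'. \<not> R (k + c) x y) \<and> (\<forall>x\<in>snd
               p. \<forall>y\<in>snd p'. \<not> S (k + c) x y)"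
      using step[OF \<Phi>] by (elim exE conjE) (rule that)
    have XY: "U \<subseteq> X" "V \<subseteq> Y" using inv[OF \<Phi>] by auto
    have R: "R (k + c) x y" if "R (k + Suc c) x y" "x \<in> U" "y \<in> U" for x y
      using towerD(4)[OF tX, of "k + c" x y] that XY by auto
    have S: "S (k + c) x y" if "S (k + Suc c) x y" "x \<in> V" "y \<in> V" for x y
      using towerD(4)[OF tY, of "k + c" x y] that XY by auto
    have mem: "fst p \<subseteq> U" "snd p \<subseteq> V" if "p \<in> \<C>" for p using that \<C>(1,2) by auto
    show ?thesis
    proof (intro exI[of _ \<C>] conjI ballI impI)
      fix p p' assume p: "p \<in> \<C>" "p' \<in> \<C>" "p \<noteq> p'"
      show "\<not> R (k + Suc c) x y" if "x \<in> fst p" "y \<in> fst p'" for x y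
        using \<C>(4)[rule_format, OF p] that mem[OF p(1)] mem[OF p(2)] R[of x y] by blast
      show "\<not> S (k + Suc c) x y" if "x \<in> snd p" "y \<in> snd p'" for x y
        using \<C>(4)[rule_format, OF p] that mem[OF p(1)] mem[OF p(2)] S[of x y] by blast
    qed (use \<C>(3) in \<open>simp_all add: \<C>(1,2)\<close>)
  qed
qed

section \<open>Sequence spaces with a first letter of its own, and their equivalence\<close>

section \<open>Sequence spaces\<close>

definition agree :: "nat \<Rightarrow> (nat \<Rightarrow> 'a) \<Rightarrow> (nat \<Rightarrow> 'a)
    \<Rightarrow> bool" where
  "agree k x y \<longleftrightarrow> (\<forall>i<k. x i = y i)"

text \<open>The first letter has its own alphabet because the bundles of words to be matched begin
  with an arbitrary number of letters and branch uniformly only afterwards.\<close>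

definition seqs :: "nat \<Rightarrow> nat \<Rightarrow> (nat \<Rightarrow> nat) set" where
  "seqs p q = {x. x 0 < p \<and> (\<forall>i. x (Suc i) < q)}"

lemma agree_refl [simp]: "agree k x x"
  by (simp add: agree_def)

lemma agree_sym: "agree k x y \<Longrightarrow> agree k y x"
  by (simp add: agree_def)

lemma agree_trans: "agree k x y \<Longrightarrow> agree k y z \<Longrightarrow> agree k x z"
  by (simp add: agree_def)

lemma agree_antimono: "agree l x y \<Longrightarrow> k \<le> l \<Longrightarrow> agree k x y"
  by (simp add: agree_def)

lemma agree_0 [simp]: "agree 0 x y"
  by (simp add: agree_def)

lemma agree_Suc: "agree (Suc k) x y \<longleftrightarrow> agree k x y \<and> x k = y k"
  by (auto simp: agree_def less_Suc_eq)

lemma seqs_less: "x \<in> seqs p q \<Longrightarrow> x i < (if i = 0 then p else q)"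
  by (cases i) (auto simp: seqs_def)

lemma seqs_0: "x \<in> seqs p q \<Longrightarrow> x 0 < p"
  and seqs_pos: "x \<in> seqs p q \<Longrightarrow> 0 < i \<Longrightarrow> x i < q"
  using seqs_less[of x p q] by (metis, metis not_gr0)

lemma seqsI: "(\<And>i. x i < (if i = 0 then p else q)) \<Longrightarrow> x \<in> seqs p q"
  unfolding seqs_def by (auto, metis gr0I, metis nat.distinct(1))

lemma tower_seqs: "tower (seqs p q) agree"
proof -
  have complete: "\<exists>x\<in>seqs p q. \<forall>k. agree k x (u k)"
    if u: "\<And>k. u k \<in> seqs p q" "\<And>k. agree k (u k) (u (Suc k))" for u
  proof -
    define x where "x i = u (Suc i) i" for i
    have eq: "u k i = x i" if "i < k" for k i
      using that
    proof (induction k)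
      case (Suc k)
      show ?case
      proof (cases "i = k")
        case False
        then have "u (Suc k) i = u k i" using u(2)[of k] Suc.prems by (simp add: agree_def)
        then show ?thesis using Suc False by simp
      qed (simp add: x_def)
    qed simp
    have "x \<in> seqs p q" using seqs_less[OF u(1)] by (intro seqsI) (simp add: x_def)
    moreover have "agree k x (u k)" for k using eq by (simp add: agree_def)
    ultimately show ?thesis by blast
  qed
  have sep: "x = y" if "\<And>k. agree k x y" for x y :: "nat \<Rightarrow> nat"
    using that by (auto simp: agree_def)
  show ?thesis
    unfolding tower_def
    by (intro conjI ballI allI impI)
      (auto intro: agree_sym agree_trans agree_antimono sep complete)
qed

text \<open>Hilbert's hotel: in \<open>seqs (p + 1) q\<close>, the cylinder of the extra first letter
    \<open>p\<close> is mapped to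
  the cylinder of \<open>0 1\<close>; the cylinders of \<open>0\<^sup>j c\<close> make room by moving to
      \<open>0\<^sup>j (c + 1)\<close> or, for the
  last letter \<open>c\<close>, to \<open>0\<^sup>j 0 1\<close>.\<close>

context
  fixes p q :: nat
  assumes p: "p \<ge> 1" and q: "q \<ge> 2"
begin

private definition last_letter :: "nat \<Rightarrow> nat" where
  "last_letter k = (if k = 0 then p else q - 1)"

private abbreviation "X \<equiv> seqs (Suc p) q"
private abbreviation "Y \<equiv> seqs p q"
private abbreviation "zero \<equiv> (\<lambda>_. 0 :: nat)"

text \<open>The pair in transit at level \<open>Suc j\<close>: the cylinder of \<open>Suc j\<close>
  zeros, together with one cylinder that has no place yet, must fit into the cylinder of zeros
  alone. The homeless one ends in the extra letter at first and later in the letter displaced by the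
  previous shift.\<close>

private definition hotel :: "nat \<Rightarrow> (nat \<Rightarrow> nat) set \<Rightarrow> (nat \<Rightarrow>
    nat) set \<Rightarrow> bool" where
  "hotel k U V \<longleftrightarrow> (k = 0 \<and> U = X \<and> V = Y) \<or>
     (\<exists>j. k = Suc j \<and> U = {x\<in>X. agree j x zero \<and> (x j = 0 \<or> x j = last_letter j)}
         \<and>
          V = {y\<in>Y. agree (Suc j) y zero})"

private definition X_cyl :: "nat \<Rightarrow> nat \<Rightarrow> (nat \<Rightarrow> nat) set" where
  "X_cyl j c = {x\<in>X. agree j x zero \<and> x j = c}"

private definition Y_cyl :: "nat \<Rightarrow> nat \<Rightarrow> (nat \<Rightarrow> nat) set" where
  "Y_cyl j c = {y\<in>Y. agree j y zero \<and> y j = c}"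

lemma last_letter_pos: "last_letter k > 0" using p q by (simp add: last_letter_def)

text \<open>The prefix is exchanged for one that is longer by a single letter. This is the only
  distortion in the construction and the origin of the constant 1.\<close>

lemma hotel_leaf_shift:
  "leaf 1 agree agree X Y (Suc (Suc j)) (X_cyl j (last_letter j)) (Y_cyl (Suc j) 1)"
proof -
  define h where "h x = (\<lambda>i. if i \<le> j then 0 else if i = Suc j then 1 else x (i - 1))" for x ::
      "nat \<Rightarrow> nat"
  define g where "g y = (\<lambda>i. if i < j then 0 else if i = j then last_letter j else y (Suc i))" for
      y :: "nat \<Rightarrow> nat"
  have hY: "h x \<in> Y_cyl (Suc j) 1" if "x \<in> X_cyl j (last_letter j)" for x
  proof -
    have "x \<in> X" using that by (simp add: X_cyl_def)
    then have "h x \<in> Y" using p q seqs_pos[of x "Suc p" q] by (intro seqsI) (auto simp: h_def)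
    then show ?thesis by (simp add: Y_cyl_def agree_def h_def)
  qed
  have gX: "g y \<in> X_cyl j (last_letter j)" if "y \<in> Y_cyl (Suc j) 1" for y
  proof -
    have "y \<in> Y" using that by (simp add: Y_cyl_def)
    then have "g y \<in> X" using p q seqs_pos[of y p q]
      by (intro seqsI) (auto simp: g_def last_letter_def)
    then show ?thesis by (simp add: X_cyl_def agree_def g_def)
  qed
  have "bij_betw h (X_cyl j (last_letter j)) (Y_cyl (Suc j) 1)"
  proof (rule bij_betw_byWitness[where f' = g])
    show "\<forall>x\<in>X_cyl j (last_letter j). g (h x) = x"
      by (auto simp: X_cyl_def agree_def g_def h_def fun_eq_iff)
    show "\<forall>y\<in>Y_cyl (Suc j) 1. h (g y) = y"
      by (auto simp: Y_cyl_def agree_def g_def h_def fun_eq_iff less_Suc_eq_le)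
  qed (use hY gX in auto)
  moreover have "agree i (h x) (h y)" if "agree (i + 1) x y" for i x y
    using that by (auto simp: agree_def h_def)
  moreover have "agree i x y"
    if "x \<in> X_cyl j (last_letter j)" "y \<in> X_cyl j (last_letter j)" "agree (i + 1) (h x) (h y)" for i x y
    unfolding agree_def
  proof (intro allI impI)
    fix l assume l: "l < i"
    show "x l = y l"
    proof (cases "l \<le> j")
      case True
      then show ?thesis using that(1,2) by (cases "l = j") (auto simp: X_cyl_def agree_def)
    next
      case False
      then have "h x (Suc l) = x l" "h y (Suc l) = y l" by (auto simp: h_def)
      then show ?thesis using that(3) l unfolding agree_def by (metis Suc_eq_plus1 Suc_mono)
    qed
  qed
  ultimately have "coarse_equiv 1 agree agree (X_cyl j (last_letter j)) (Y_cyl (Suc j) 1) h"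
    unfolding coarse_equiv_def by blast
  moreover have "X_cyl j (last_letter j) \<noteq> {}"
  proof -
    have "(\<lambda>i. if i = j then last_letter j else 0) \<in> X_cyl j (last_letter j)"
      using p q by (auto simp: X_cyl_def agree_def last_letter_def intro!: seqsI)
    then show ?thesis by blast
  qed
  ultimately show ?thesis
    unfolding leaf_def by (auto simp: X_cyl_def Y_cyl_def agree_def less_Suc_eq)
qed

lemma hotel_leaf_move:
  assumes c: "0 < c" "c < last_letter j" and d: "0 < d" "d < (if j = 0 then p else q)"
  shows "leaf 1 agree agree X Y (Suc j) (X_cyl j c) (Y_cyl j d)"
proof -
  define h where "h e x = x (j := e)" for e and x :: "nat \<Rightarrow> nat"
  have hY: "h d x \<in> Y_cyl j d" if "x \<in> X_cyl j c" for x
  proof -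
    have "x \<in> X" using that by (simp add: X_cyl_def)
    then have "h d x \<in> Y" using d p seqs_pos[of x "Suc p" q] that
      by (intro seqsI) (auto simp: h_def X_cyl_def agree_def split: if_splits)
    then show ?thesis using that by (simp add: Y_cyl_def X_cyl_def agree_def h_def)
  qed
  have hX: "h c y \<in> X_cyl j c" if "y \<in> Y_cyl j d" for y
  proof -
    have "y \<in> Y" using that by (simp add: Y_cyl_def)
    then have "h c y \<in> X" using c seqs_0[of y p q] seqs_pos[of y p q] q
      by (intro seqsI) (auto simp: h_def last_letter_def less_Suc_eq split: if_splits)
    then show ?thesis using that by (simp add: X_cyl_def Y_cyl_def agree_def h_def)
  qed
  have "bij_betw (h d) (X_cyl j c) (Y_cyl j d)"
    by (rule bij_betw_byWitness[where f' = "h c"])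
      (use hX hY in \<open>auto simp: h_def X_cyl_def Y_cyl_def\<close>)
  moreover have "agree i (h d x) (h d y) \<longleftrightarrow> agree i x y"
    if "x \<in> X_cyl j c" "y \<in> X_cyl j c" for i x y
    using that by (auto simp: agree_def h_def X_cyl_def) metis
  ultimately have "coarse_equiv 1 agree agree (X_cyl j c) (Y_cyl j d) (h d)"
    unfolding coarse_equiv_def using agree_antimono[of "_ + 1"] by (metis le_add1)
  moreover have "X_cyl j c \<noteq> {}"
  proof -
    have "(\<lambda>i. if i = j then c else 0) \<in> X_cyl j c"
      using c p q by (auto simp: X_cyl_def agree_def last_letter_def intro!: seqsI split: if_splits)
    then show ?thesis by blast
  qed
  ultimately show ?thesis
    unfolding leaf_def by (auto simp: X_cyl_def Y_cyl_def agree_def less_Suc_eq)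
qed


lemma hotel_step:
  assumes "hotel k U V"
  shows "\<exists>\<C>. U = \<Union>(fst ` \<C>) \<and> V = \<Union>(snd ` \<C>) \<and>
        (\<forall>p\<in>\<C>. hotel (Suc k) (fst p) (snd p) \<or> leaf 1 agree agree X Y (Suc k) (fst p)
            (snd p)) \<and>
        (\<forall>p\<in>\<C>. \<forall>p'\<in>\<C>. p \<noteq> p' \<longrightarrow>
           (\<forall>x\<in>fst p. \<forall>y\<in>fst p'. \<not> agree (k + 1) x y) \<and>
           (\<forall>x\<in>snd p. \<forall>y\<in>snd p'. \<not> agree (k + 1) x y))"
proof -
  define H where "H j = ({x\<in>X. agree j x zero \<and> (x j = 0 \<or> x j = last_letter j)},
      {y\<in>Y. agree (Suc j) y zero})" for j
  have hotel_H: "hotel (Suc j) (fst (H j)) (snd (H j))" for j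
    unfolding hotel_def H_def by auto
  show ?thesis
  proof (cases k)
    case 0
    define \<C> where "\<C> = insert (H 0) ((\<lambda>c. (X_cyl 0 c, Y_cyl 0 c)) ` {0<..<p})"
    have UV: "U = X" "V = Y" using assms 0 by (auto simp: hotel_def)
    have x0: "x 0 = 0 \<or> x 0 = p \<or> x 0 \<in> {0<..<p}" if "x \<in> X" for x
      using seqs_0[OF that] by auto
    have y0: "x 0 = 0 \<or> x 0 \<in> {0<..<p}" if "x \<in> Y" for x
      using seqs_0[OF that] by auto
    show ?thesis
    proof (intro exI[of _ \<C>] conjI ballI impI)
      show "U = \<Union>(fst ` \<C>)"
        unfolding UV by (auto simp: \<C>_def H_def X_cyl_def last_letter_def dest: x0)
      show "V = \<Union>(snd ` \<C>)"
        unfolding UV by (auto simp: \<C>_def H_def Y_cyl_def agree_Suc dest: y0)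
    next
      fix pc assume "pc \<in> \<C>"
      then show "hotel (Suc k) (fst pc) (snd pc) \<or> leaf 1 agree agree X Y (Suc k) (fst pc) (snd pc)"
        using hotel_H[of 0] hotel_leaf_move[of _ 0] 0 by (auto simp: \<C>_def last_letter_def)
    next
      fix pc pc' assume "pc \<in> \<C>" "pc' \<in> \<C>" "pc \<noteq> pc'"
      then show "\<not> agree (k + 1) x y" if "x \<in> fst pc" "y \<in> fst pc'" for x y
        using that 0 by (auto simp: \<C>_def H_def X_cyl_def last_letter_def agree_Suc)
      show "\<not> agree (k + 1) x y" if "x \<in> snd pc" "y \<in> snd pc'" for x y
        using that 0 \<open>pc \<in> \<C>\<close> \<open>pc' \<in> \<C>\<close> \<open>pc \<noteq> pc'\<close>
        by (auto simp: \<C>_def H_def Y_cyl_def agree_Suc)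
    qed
  next
    case (Suc j)
    define \<C> where "\<C> = insert (H k) (insert (X_cyl j (last_letter j), Y_cyl k 1)
        ((\<lambda>c. (X_cyl k c, Y_cyl k (Suc c))) ` {0<..<q - 1}))"
    have UV: "U = {x\<in>X. agree j x zero \<and> (x j = 0 \<or> x j = last_letter j)}"
        "V = {y\<in>Y. agree k y zero}"
      using assms Suc by (auto simp: hotel_def)
    have ll: "last_letter k = q - 1" using Suc by (simp add: last_letter_def)
    have xk: "x k = 0 \<or> x k = q - 1 \<or> x k \<in> {0<..<q - 1}" if "x \<in> X" for x
      using seqs_pos[OF that, of k] Suc by auto
    have yk: "x k = 0 \<or> x k = 1 \<or> (\<exists>c\<in>{0<..<q - 1}. x k = Suc c)" if "x \<in> Y" for x
      using seqs_pos[OF that, of k] Suc by (cases "x k") auto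
    show ?thesis
    proof (intro exI[of _ \<C>] conjI ballI impI)
      have "x \<in> \<Union>(fst ` \<C>)" if "x \<in> U" for x
      proof -
        have "x \<in> X" using that UV by simp
        from xk[OF this] show ?thesis
          using that ll unfolding UV \<C>_def H_def X_cyl_def Suc agree_Suc by auto
      qed
      moreover have "\<Union>(fst ` \<C>) \<subseteq> U"
        unfolding UV by (auto simp: \<C>_def H_def X_cyl_def Suc agree_Suc)
      ultimately show "U = \<Union>(fst ` \<C>)" by blast
      have "x \<in> \<Union>(snd ` \<C>)" if "x \<in> V" for x
      proof -
        have "x \<in> Y" using that UV by simp
        from yk[OF this] show ?thesis
          using that unfolding UV \<C>_def H_def Y_cyl_def agree_Suc by auto
      qed
      moreover have "\<Union>(snd ` \<C>) \<subseteq> V"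
        unfolding UV by (auto simp: \<C>_def H_def Y_cyl_def agree_Suc)
      ultimately show "V = \<Union>(snd ` \<C>)" by blast
    next
      fix pc assume "pc \<in> \<C>"
      then show "hotel (Suc k) (fst pc) (snd pc) \<or> leaf 1 agree agree X Y (Suc k) (fst pc) (snd pc)"
        using hotel_H[of k] hotel_leaf_move[of _ k] hotel_leaf_shift[of j] Suc ll
        by (auto simp: \<C>_def)
    next
      fix pc pc' assume pc: "pc \<in> \<C>" "pc' \<in> \<C>" "pc \<noteq> pc'"
      show "\<not> agree (k + 1) x y" if "x \<in> fst pc" "y \<in> fst pc'" for x y
        using that pc last_letter_pos[of j] last_letter_pos[of k] ll
        by (auto simp: \<C>_def H_def X_cyl_def Suc agree_Suc)
      show "\<not> agree (k + 1) x y" if "x \<in> snd pc" "y \<in> snd pc'" for x y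
        using that pc by (auto simp: \<C>_def H_def Y_cyl_def Suc agree_Suc)
    qed
  qed
qed

text \<open>The constant is \<open>2 * Suc 1\<close>, all leaves having constant 1.\<close>

lemma seqs_Suc_coarse_equiv: "\<exists>f. coarse_equiv 4 agree agree (seqs (Suc p) q) (seqs p q) f"
proof -
  have "\<exists>f. coarse_equiv (2 * Suc 1) agree agree X Y f"
  proof (rule back_and_forth_leaves[where \<Phi> = hotel, OF tower_seqs tower_seqs])
    show "hotel 0 X Y" by (simp add: hotel_def)
  next
    fix k U V assume *: "hotel k U V"
    have "zero \<in> X" "zero \<in> Y" using p q by (auto intro!: seqsI)
    then show "U \<subseteq> X \<and> U \<noteq> {} \<and> V \<subseteq> Y \<and> V \<noteq> {}"
      using * unfolding hotel_def by fastforce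
  next
    fix k U V x y j assume "hotel k U V" "x \<in> U" "y \<in> U" "j + 1 \<le> k"
    then show "agree j x y" by (auto simp: hotel_def agree_def)
  next
    fix k U V x y j assume "hotel k U V" "x \<in> V" "y \<in> V" "j + 1 \<le> k"
    then show "agree j x y" by (auto simp: hotel_def agree_def)
  next
    fix k U V assume "hotel k U V"
    from hotel_step[OF this]
    show "\<exists>\<C>. U = \<Union>(fst ` \<C>) \<and> V = \<Union>(snd ` \<C>) \<and>
        (\<forall>p\<in>\<C>. hotel (Suc k) (fst p) (snd p) \<or> leaf 1 agree agree X Y (Suc k) (fst p)
            (snd p)) \<and>
        (\<forall>p\<in>\<C>. \<forall>p'\<in>\<C>. p \<noteq> p' \<longrightarrow>
           (\<forall>x\<in>fst p. \<forall>y\<in>fst p'. \<not> agree (k + 1) x y) \<and>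
           (\<forall>x\<in>snd p. \<forall>y\<in>snd p'. \<not> agree (k + 1) x y))" .
  qed
  then show ?thesis by simp
qed

end

text \<open>The one-letter step is iterated as often as \<open>p\<close> and \<open>p'\<close>
  differ. The cruder constant is symmetric and serves both orders of \<open>p\<close> and
  \<open>p'\<close>.\<close>

lemma seqs_coarse_equiv:
  assumes "p \<ge> 1" "p' \<ge> 1" "q \<ge> 2"
  shows "\<exists>f. coarse_equiv (4 * (p + p')) agree agree (seqs p q) (seqs p' q) f"
proof -
  have *: "\<exists>f. coarse_equiv (4 * d) agree agree (seqs (d + p) q) (seqs p q) f" if p: "p \<ge> 1" for d p
  proof (induction d)
    case 0
    have "coarse_equiv 0 agree agree (seqs p q) (seqs p q) (\<lambda>x. x)"
      by (simp add: coarse_equiv_def bij_betw_def)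
    then show ?case by auto
  next
    case (Suc d)
    obtain f where "coarse_equiv (4 * d) agree agree (seqs (d + p) q) (seqs p q) f" using Suc by blast
    moreover obtain g where "coarse_equiv 4 agree agree (seqs (Suc (d + p)) q) (seqs (d + p) q) g"
      using seqs_Suc_coarse_equiv[OF trans_le_add2[OF p, of d] assms(3)] by blast
    ultimately show ?case using coarse_equiv_trans by fastforce
  qed
  have mono: "\<exists>f. coarse_equiv (4 * (p + p')) agree agree X Y f"
    if "coarse_equiv (4 * d) agree agree X Y f" "d \<le> p + p'" "X = seqs a q" "Y = seqs b q"
    for d X Y f a b
    by (rule exI, rule coarse_equiv_mono[OF that(1)]) (use that in \<open>simp_all add: tower_seqs\<close>)
  show ?thesis
  proof (cases "p \<le> p'")
    case True
    then obtain f where "coarse_equiv (4 * (p' - p)) agree agree (seqs p' q) (seqs p q) f"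
      using *[OF assms(1), of "p' - p"] by auto
    from mono[OF coarse_equiv_inv[OF this]] show ?thesis by simp
  next
    case False
    then obtain f where "coarse_equiv (4 * (p - p')) agree agree (seqs p q) (seqs p' q) f"
      using *[OF assms(2), of "p - p'"] by auto
    from mono[OF this] show ?thesis by simp
  qed
qed

section \<open>Bundles of words for good nodes, single letters for bad ones\<close>

section \<open>Coding a tree of masses\<close>

text \<open>Consecutive intervals of lengths \<open>s i\<close>. Letters are distributed among nodes
  in this way, in proportion to their masses.\<close>

lemma partition_lessThan:
  fixes s :: "'i \<Rightarrow> nat"
  assumes "finite I"
  shows "\<exists>T. (\<forall>i\<in>I. card (T i) = s i) \<and> disjoint_family_on T I \<and>
      (\<Union>i\<in>I. T i) = {..<sum s I}"
  using assms
proof (induction I rule: finite_induct)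
  case empty
  then show ?case by (auto simp: disjoint_family_on_def)
next
  case (insert i I)
  then obtain T where T: "\<forall>i\<in>I. card (T i) = s i" "disjoint_family_on T I" "(\<Union>i\<in>I. T
      i) = {..<sum s I}"
    by blast
  define T' where "T' = T(i := {sum s I..<sum s I + s i})"
  have [simp]: "T' l = T l" if "l \<in> I" for l using that insert by (auto simp: T'_def)
  have [simp]: "T' i = {sum s I..<sum s I + s i}" by (simp add: T'_def)
  have sub: "T l \<subseteq> {..<sum s I}" if "l \<in> I" for l using T(3) that by blast
  have "disjoint_family_on T' (insert i I)"
    unfolding disjoint_family_on_def
  proof (intro ballI impI)
    fix a b assume "a \<in> insert i I" "b \<in> insert i I" "a \<noteq> b"
    then consider "a \<in> I" "b \<in> I" | "a = i" "b \<in> I" | "a \<in> I" "b = i" by blast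
    then show "T' a \<inter> T' b = {}"
    proof cases
      case 1
      then show ?thesis using T(2) \<open>a \<noteq> b\<close> by (simp add: disjoint_family_on_def)
    next
      case 2
      then show ?thesis using sub[of b] by fastforce
    next
      case 3
      then show ?thesis using sub[of a] by fastforce
    qed
  qed
  moreover have "(\<Union>l\<in>insert i I. T' l) = {..<sum s (insert i I)}"
    using T(3) insert by (auto simp: add.commute)
  ultimately show ?case using T(1) insert by (intro exI[of _ T']) auto
qed

text \<open>\<open>U\<close> is a union of classes of level \<open>Suc k\<close>, so the limit of a
  coherent sequence in \<open>U\<close> cannot leave it.\<close>

lemma tower_shift:
  assumes tX: "tower X R" and U: "U \<subseteq> X" and closed: "\<And>x y. \<lbrakk>x \<in> U; y \<in> X; R
      (Suc k) x y\<rbrakk> \<Longrightarrow> y \<in> U"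
  shows "tower U (\<lambda>j. R (k + j))"
proof -
  have complete: "\<exists>x\<in>U. \<forall>j. R (k + j) x (u j)"
    if u: "\<And>j. u j \<in> U" "\<And>j. R (k + j) (u j) (u (Suc j))" for u
  proof -
    \<comment> \<open>Repeating the first term fills the levels below \<open>k\<close>, about which
      \<open>u\<close> says nothing.\<close>
    define v where "v i = u (i - k)" for i
    have v: "v i \<in> X" for i using u U by (auto simp: v_def)
    have "R i (v i) (v (Suc i))" for i
    proof (cases "k \<le> i")
      case True
      then show ?thesis using u(2)[of "i - k"] by (simp add: v_def Suc_diff_le)
    next
      case False
      then have "v (Suc i) = v i" by (simp add: v_def)
      then show ?thesis using tower_refl[OF tX v] by simp
    qed
    then obtain x where x: "x \<in> X" "\<And>i. R i x (v i)"
      using tower_complete[OF tX, of v] v by blast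
    have "R (Suc k) (u 1) x"
      using x(2)[of "Suc k"] tower_sym[OF tX] x(1) u(1)[of 1] U by (auto simp: v_def)
    then have "x \<in> U" using closed u(1) x(1) by blast
    moreover have "R (k + j) x (u j)" for j using x(2)[of "k + j"] by (simp add: v_def)
    ultimately show ?thesis by blast
  qed
  have sep: "x = y" if "x \<in> U" "y \<in> U" "\<And>j. R (k + j) x y" for x y
  proof (rule tower_sep[OF tX])
    show "R j x y" for j
      using tower_antimono[OF tX _ _ that(3), of j j] that U by auto
  qed (use that U in auto)
  show ?thesis
    unfolding tower_def
  proof (intro conjI allI ballI impI)
    fix j x assume "x \<in> U"
    then show "R (k + j) x x" using tower_refl[OF tX] U by auto
  next
    fix j x y assume "x \<in> U" "y \<in> U" "R (k + j) x y"
    then show "R (k + j) y x" using tower_sym[OF tX] U by auto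
  next
    fix j x y z assume "x \<in> U" "y \<in> U" "z \<in> U" "R (k + j) x y" "R (k + j) y z"
    then show "R (k + j) x z" using tower_trans[OF tX, of "k + j" x y z] U by auto
  next
    fix j x y assume "x \<in> U" "y \<in> U" "R (k + Suc j) x y"
    then show "R (k + j) x y" using tower_Suc[OF tX, of "k + j" x y] U by auto
  qed (use complete sep in auto)
qed

lemma agree_upd: "i \<le> k \<Longrightarrow> agree i (x(k := v)) y \<longleftrightarrow> agree i x y"
  by (auto simp: agree_def)

text \<open>A good node of level \<open>k\<close> will be matched with \<open>\<alpha>\<close> words of
    equal length, and likewise its descendants
  at all levels; a bad child is matched with a single letter.\<close>

locale mass_tree =
  fixes X :: "'a set" and Nd :: "nat \<Rightarrow> 'v set" and pt :: "nat \<Rightarrow> 'v \<Rightarrow> 'a set"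
    and ch :: "nat \<Rightarrow> 'v \<Rightarrow> 'v set" and good :: "nat \<Rightarrow> 'v \<Rightarrow>
        bool" and \<alpha> :: "nat \<Rightarrow> 'v \<Rightarrow> nat"
    and Q Rmax :: nat and root :: 'v
  fixes same :: "nat \<Rightarrow> 'a \<Rightarrow> 'a \<Rightarrow> bool"
  defines "same k x y \<equiv> \<exists>A\<in>Nd k. x \<in> pt k A \<and> y \<in> pt k A"
  assumes root: "root \<in> Nd 0" "pt 0 root = X"
    and ch: "A \<in> Nd k \<Longrightarrow> ch k A \<subseteq> Nd (Suc k) \<and> finite (ch k A) \<and> pt
        k A = \<Union>(pt (Suc k) ` ch k A)"
    and disj: "\<lbrakk>A \<in> Nd k; B \<in> Nd k; x \<in> pt k A; x \<in> pt k B\<rbrakk>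
        \<Longrightarrow> A = B"
    and pt: "A \<in> Nd k \<Longrightarrow> pt k A \<noteq> {} \<and> pt k A \<subseteq> X"
    and tower: "tower X same"
    and good_ch: "\<lbrakk>A \<in> Nd k; good k A; B \<in> ch k A\<rbrakk> \<Longrightarrow> good (Suc k) B"
    and \<alpha>_pos: "\<lbrakk>A \<in> Nd k; good k A\<rbrakk> \<Longrightarrow> 1 \<le> \<alpha> k A"
    and pack: "\<lbrakk>A \<in> Nd k; good k A\<rbrakk> \<Longrightarrow> \<exists>b. (\<forall>B\<in>ch k
        A. b B < \<alpha> k A) \<and>
           (\<forall>t<\<alpha> k A. (\<Sum>B | B \<in> ch k A \<and> b B = t. \<alpha> (Suc k) B) = Q)"
    and few_bad: "A \<in> Nd k \<Longrightarrow> card {B \<in> ch k A. \<not> good (Suc k) B} < Q"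
    and some_good: "A \<in> Nd k \<Longrightarrow> {B \<in> ch k A. good (Suc k) B} \<noteq> {}"
    and \<alpha>_bound: "A \<in> Nd k \<Longrightarrow> (\<Sum>B | B \<in> ch k A \<and> good (Suc k) B.
        \<alpha> (Suc k) B) \<le> Rmax"
    and Q: "Q \<ge> 2"
begin

lemma same_node: "\<lbrakk>A \<in> Nd k; x \<in> pt k A\<rbrakk> \<Longrightarrow> same k x y
    \<longleftrightarrow> y \<in> pt k A"
  using disj unfolding same_def by blast

lemma pt_child: "\<lbrakk>A \<in> Nd k; B \<in> ch k A\<rbrakk> \<Longrightarrow> pt (Suc k) B \<subseteq>
    pt k A"
  using ch by blast

text \<open>The invariant is that a node corresponds to \<alpha> words that differ in their last
  letter only. \<open>pack\<close> preserves it: each bin belongs to one of these words, and the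
  \<open>Q\<close> one-letter extensions of that word are shared out among the children in the bin,
  which again differ in the last letter only.\<close>

lemma good_children_coarse_equiv:
  assumes A: "A \<in> Nd k"
  defines "G \<equiv> {B \<in> ch k A. good (Suc k) B}"
  defines "r \<equiv> \<Sum>B\<in>G. \<alpha> (Suc k) B"
  shows "\<exists>f. coarse_equiv 2 (\<lambda>j. same (k + j)) agree (\<Union>(pt (Suc k) ` G)) (seqs r Q) f"
proof -
  define U0 where "U0 = \<Union>(pt (Suc k) ` G)"
  define Y where "Y = seqs r Q"
  have G: "G \<subseteq> Nd (Suc k)" "finite G" "G \<noteq> {}" using ch[OF A] some_good[OF A] by (auto
      simp: G_def)
  have r: "r \<ge> 1"
  proof -
    obtain B where B: "B \<in> G" using G by blast
    then have "1 \<le> \<alpha> (Suc k) B" using G \<alpha>_pos by (auto simp: G_def)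
    then show ?thesis using member_le_sum[OF B, of "\<alpha> (Suc k)"] G(2) unfolding r_def by simp
  qed
  have U0: "U0 \<subseteq> X" using G pt by (auto simp: U0_def)
  have tU: "tower U0 (\<lambda>j. same (k + j))"
    by (rule tower_shift[OF tower U0]) (use G same_node in \<open>auto simp: U0_def\<close>)
  have tY: "tower Y agree" unfolding Y_def by (rule tower_seqs)
  define V where "V i w T = {y\<in>Y. agree i y w \<and> y i \<in> T}" for i w T
  define lim where "lim i = (if i = 0 then r else Q)" for i :: nat
  have lim: "y i < lim i" if "y \<in> Y" for y i
    using seqs_less[of y r Q i] that by (simp add: Y_def lim_def)
  have upd: "w(i := t) \<in> Y" if "w \<in> Y" "t < lim i" for w i t
    unfolding Y_def
  proof (rule seqsI)
    show "(w(i := t)) l < (if l = 0 then r else Q)" for l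
      using lim[OF that(1), of l] that(2) by (auto simp: lim_def)
  qed
  define \<Phi> where "\<Phi> j U V' \<longleftrightarrow> (j = 0 \<and> U = U0 \<and> V' = Y) \<or>
     (\<exists>i B w T. j = Suc i \<and> B \<in> Nd (k + j) \<and> good (k + j) B \<and> U = pt (k + j) B
         \<and> U \<subseteq> U0 \<and>
        w \<in> Y \<and> T \<subseteq> {..<lim i} \<and> card T = \<alpha> (k + j) B \<and> V' = V i w T)"
            for j U V'
  have "\<exists>f. coarse_equiv (2 * 1) (\<lambda>j. same (k + j)) agree U0 Y f"
  proof (rule back_and_forth[where \<Phi> = \<Phi>, OF tU tY])
    show "\<Phi> 0 U0 Y" by (simp add: \<Phi>_def)
  next
    fix j U V' assume *: "\<Phi> j U V'"
    show "U \<subseteq> U0 \<and> U \<noteq> {} \<and> V' \<subseteq> Y \<and> V' \<noteq> {}"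
    proof (cases j)
      case 0
      have "(\<lambda>i. 0) \<in> Y" using r Q by (auto simp: Y_def intro!: seqsI)
      moreover have "U0 \<noteq> {}" using G pt unfolding U0_def by fastforce
      ultimately show ?thesis using * 0 by (auto simp: \<Phi>_def)
    next
      case (Suc i)
      then obtain B w T where B: "B \<in> Nd (k + j)" "good (k + j) B" "U = pt (k + j) B" "U \<subseteq> U0"
        "w \<in> Y" "T \<subseteq> {..<lim i}" "card T = \<alpha> (k + j) B" "V' = V i w T"
        using * unfolding \<Phi>_def by auto
      have "T \<noteq> {}" using \<alpha>_pos[OF B(1,2)] B(7) by auto
      then obtain t where "t \<in> T" by blast
      then have "w(i := t) \<in> V i w T" using upd[OF B(5)] B(6) by (auto simp: V_def agree_upd)
      then have "V' \<noteq> {}" "V' \<subseteq> Y" using B(8) by (auto simp: V_def)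
      moreover have "U \<noteq> {}" using pt[OF B(1)] B(3) by simp
      ultimately show ?thesis using B(4) by blast
    qed
  next
    fix j U V' x y l assume *: "\<Phi> j U V'" "x \<in> U" "y \<in> U" "l + 1 \<le> j"
    then obtain B where B: "B \<in> Nd (k + j)" "x \<in> pt (k + j) B" "y \<in> pt (k + j) B" "U \<subseteq> U0"
      by (auto simp: \<Phi>_def)
    then have "same (k + j) x y" unfolding same_def by blast
    then show "same (k + l) x y"
      by (rule tower_antimono[OF tower, rotated 2]) (use * B U0 in auto)
  next
    fix j U V' x y l assume *: "\<Phi> j U V'" "x \<in> V'" "y \<in> V'" "l + 1 \<le> j"
    then obtain i w T where "j = Suc i" "V' = V i w T" by (auto simp: \<Phi>_def)
    then have "agree i x y" using * by (auto simp: V_def intro: agree_trans agree_sym)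
    then show "agree l x y" by (rule agree_antimono) (use * \<open>j = Suc i\<close> in simp)
  next
    fix j U V' assume *: "\<Phi> j U V'"
    show "\<exists>\<C>. U = \<Union>(fst ` \<C>) \<and> V' = \<Union>(snd ` \<C>) \<and>
        (\<forall>p\<in>\<C>. \<Phi> (Suc j) (fst p) (snd p)) \<and>
        (\<forall>p\<in>\<C>. \<forall>p'\<in>\<C>. p \<noteq> p' \<longrightarrow>
           (\<forall>x\<in>fst p. \<forall>y\<in>fst p'. \<not> same (k + (j + 1)) x y) \<and>
           (\<forall>x\<in>snd p. \<forall>y\<in>snd p'. \<not> agree (j + 1) x y))"
    proof (cases j)
      case 0
      then have UV: "U = U0" "V' = Y" using * by (auto simp: \<Phi>_def)
      obtain T where T: "\<And>B. B \<in> G \<Longrightarrow> card (T B) = \<alpha> (Suc k) B"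
          "disjoint_family_on T G"
          "(\<Union>B\<in>G. T B) = {..<r}"
        using partition_lessThan[OF G(2), of "\<alpha> (Suc k)"] unfolding r_def by blast
      define w where "w = (\<lambda>i::nat. 0::nat)"
      have w: "w \<in> Y" using r Q by (auto simp: Y_def w_def intro!: seqsI)
      define \<C> where "\<C> = (\<lambda>B. (pt (Suc k) B, V 0 w (T B))) ` G"
      show ?thesis
      proof (intro exI[of _ \<C>] conjI ballI impI)
        show "U = \<Union>(fst ` \<C>)" by (auto simp: \<C>_def UV U0_def)
        have "y \<in> Y \<longleftrightarrow> (\<exists>B\<in>G. y \<in> V 0 w (T B))" for y
          using lim[of y 0] T(3) by (auto simp: V_def lim_def)
        then show "V' = \<Union>(snd ` \<C>)" by (auto simp: \<C>_def UV)
      next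
        fix p assume "p \<in> \<C>"
        then obtain B where B: "B \<in> G" "p = (pt (Suc k) B, V 0 w (T B))" by (auto simp: \<C>_def)
        have "T B \<subseteq> {..<lim 0}" using T(3) B by (auto simp: lim_def)
        moreover have "pt (Suc k) B \<subseteq> U0" using B by (auto simp: U0_def)
        moreover have "good (Suc k) B" "B \<in> Nd (Suc k)" using B G by (auto simp: G_def)
        ultimately show "\<Phi> (Suc j) (fst p) (snd p)"
          unfolding \<Phi>_def B(2) using T(1)[OF B(1)] w 0
          by (intro disjI2 exI[of _ 0] exI[of _ B] exI[of _ w] exI[of _ "T B"]) simp
      next
        fix p p' assume "p \<in> \<C>" "p' \<in> \<C>" "p \<noteq> p'"
        then obtain B B' where B: "B \<in> G" "p = (pt (Suc k) B, V 0 w (T B))"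
            "B' \<in> G" "p' = (pt (Suc k) B', V 0 w (T B'))" "B \<noteq> B'" by (auto simp: \<C>_def)
        have "B \<in> Nd (Suc k)" "B' \<in> Nd (Suc k)" using B G by auto
        then show "\<not> same (k + (j + 1)) x y" if "x \<in> fst p" "y \<in> fst p'" for x y
          using that B 0 same_node[of B "Suc k" x y] disj[of B "Suc k" B' y] by auto
        have "T B \<inter> T B' = {}" using T(2) B unfolding disjoint_family_on_def by blast
        then show "\<not> agree (j + 1) x y" if "x \<in> snd p" "y \<in> snd p'" for x y
          using that B 0 by (auto simp: V_def agree_Suc)
      qed
    next
      case (Suc i)
      then obtain B w T where B: "B \<in> Nd (k + j)" "good (k + j) B" "U = pt (k + j) B" "U \<subseteq> U0"
        "w \<in> Y" "T \<subseteq> {..<lim i}" "card T = \<alpha> (k + j) B" "V' = V i w T"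
        using * unfolding \<Phi>_def by auto
      let ?K = "k + j"
      let ?D = "ch ?K B"
      obtain b where b: "\<And>C. C \<in> ?D \<Longrightarrow> b C < \<alpha> ?K B"
          "\<And>t. t < \<alpha> ?K B \<Longrightarrow> (\<Sum>C | C \<in> ?D \<and> b C = t. \<alpha> (Suc
              ?K) C) = Q"
        using pack[OF B(1,2)] by blast
      have D: "?D \<subseteq> Nd (Suc ?K)" "finite ?D" "U = \<Union>(pt (Suc ?K) ` ?D)"
        using ch[OF B(1)] B(3) by auto
      have "finite T" using B(6) finite_subset by blast
      then obtain \<tau> where \<tau>: "bij_betw \<tau> {..<\<alpha> ?K B} T"
        using B(7) by (metis ex_bij_betw_nat_finite atLeast0LessThan)
      \<comment> \<open>\<open>P t\<close> hands out the \<open>Q\<close> possible next letters to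
        the children in bin \<open>t\<close>, to each as many as its \<alpha>.\<close>
      define fits where "fits t P \<longleftrightarrow> (\<forall>C\<in>{C\<in>?D. b C = t}. card (P C) =
          \<alpha> (Suc ?K) C) \<and>
          disjoint_family_on P {C\<in>?D. b C = t} \<and> (\<Union>C\<in>{C\<in>?D. b C = t}. P C) = {..<Q}"
        for t and P :: "'v \<Rightarrow> nat set"
      define P where "P t = (SOME P. fits t P)" for t
      have fits: "fits t (P t)" if "t < \<alpha> ?K B" for t
        unfolding P_def
      proof (rule someI_ex[of "fits t"])
        show "\<exists>P. fits t P"
          using partition_lessThan[of "{C\<in>?D. b C = t}" "\<alpha> (Suc ?K)"] D(2) b(2)[OF that]
          unfolding fits_def by simp
      qed
      have P1: "card (P t C) = \<alpha> (Suc ?K) C" if "t < \<alpha> ?K B" "C \<in> ?D" "b C = t" for t C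
        using fits[OF that(1)] that unfolding fits_def by blast
      have P2: "disjoint_family_on (P t) {C\<in>?D. b C = t}" if "t < \<alpha> ?K B" for t
        using fits[OF that] unfolding fits_def by blast
      have P3: "(\<Union>C\<in>{C\<in>?D. b C = t}. P t C) = {..<Q}" if "t < \<alpha> ?K B" for t
        using fits[OF that] unfolding fits_def by blast
      note P = P1 P2 P3
      define W where "W C = V j (w(i := \<tau> (b C))) (P (b C) C)" for C
      have \<tau>T: "\<tau> (b C) \<in> T" if "C \<in> ?D" for C using \<tau> b(1)[OF that] by (auto simp:
          bij_betw_def)
      have W: "y \<in> W C \<longleftrightarrow> y \<in> Y \<and> agree i y w \<and> y i = \<tau> (b C)
          \<and> y j \<in> P (b C) C" for y C
        unfolding W_def V_def Suc agree_Suc by (auto simp: agree_def)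
      define \<C> where "\<C> = (\<lambda>C. (pt (Suc ?K) C, W C)) ` ?D"
      show ?thesis
      proof (intro exI[of _ \<C>] conjI ballI impI)
        show "U = \<Union>(fst ` \<C>)" using D(3) by (auto simp: \<C>_def)
        have "\<exists>C\<in>?D. y \<in> W C" if y: "y \<in> V i w T" for y
        proof -
          have "y \<in> Y" "agree i y w" "y i \<in> T" using y by (auto simp: V_def)
          then obtain t where t: "t < \<alpha> ?K B" "y i = \<tau> t" using \<tau> by (auto simp: bij_betw_def)
          have "y j < Q" using lim[OF \<open>y \<in> Y\<close>, of j] Suc by (simp add: lim_def)
          then obtain C where "C \<in> ?D" "b C = t" "y j \<in> P t C" using P(3)[OF t(1)] by blast
          then show ?thesis using W t \<open>y \<in> Y\<close> \<open>agree i y w\<close> by auto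
        qed
        moreover have "W C \<subseteq> V i w T" if "C \<in> ?D" for C
          using W \<tau>T[OF that] by (auto simp: V_def)
        ultimately have "V i w T = \<Union>(W ` ?D)" by blast
        then show "V' = \<Union>(snd ` \<C>)" by (simp add: \<C>_def B(8) image_image)
      next
        fix p assume "p \<in> \<C>"
        then obtain C where C: "C \<in> ?D" "p = (pt (Suc ?K) C, W C)" by (auto simp: \<C>_def)
        have "C \<in> Nd (Suc ?K)" "good (Suc ?K) C" using C D good_ch[OF B(1,2)] by auto
        moreover have "pt (Suc ?K) C \<subseteq> U0" using pt_child[OF B(1) C(1)] B by blast
        moreover have "w(i := \<tau> (b C)) \<in> Y" using upd[OF B(5)] \<tau>T[OF C(1)] B(6) by blast
        moreover have "P (b C) C \<subseteq> {..<lim j}"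
          using P(3)[OF b(1)[OF C(1)]] C(1) Suc by (auto simp: lim_def)
        moreover have "card (P (b C) C) = \<alpha> (Suc ?K) C" using P(1) b(1) C(1) by blast
        ultimately show "\<Phi> (Suc j) (fst p) (snd p)"
          unfolding \<Phi>_def C(2) W_def
          by (intro disjI2 exI[of _ j] exI[of _ C] exI[of _ "w(i := \<tau> (b C))"] exI[of _ "P (b C) C"]) simp
      next
        fix p p' assume "p \<in> \<C>" "p' \<in> \<C>" "p \<noteq> p'"
        then obtain C C' where C: "C \<in> ?D" "p = (pt (Suc ?K) C, W C)"
            "C' \<in> ?D" "p' = (pt (Suc ?K) C', W C')" "C \<noteq> C'" by (auto simp: \<C>_def)
        have "C \<in> Nd (Suc ?K)" "C' \<in> Nd (Suc ?K)" using C D by auto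
        then show "\<not> same (k + (j + 1)) x y" if "x \<in> fst p" "y \<in> fst p'" for x y
          using that C same_node[of C "Suc ?K" x y] disj[of C "Suc ?K" C' y] by auto
        show "\<not> agree (j + 1) x y" if "x \<in> snd p" "y \<in> snd p'" for x y
        proof
          assume ag: "agree (j + 1) x y"
          have x: "x i = \<tau> (b C)" "x j \<in> P (b C) C" and y: "y i = \<tau> (b C')" "y j \<in> P (b
              C') C'"
            using that C W by auto
          have "x i = y i" "x j = y j" using ag Suc by (auto simp: agree_Suc)
          then have "b C = b C'"
            using x y \<tau> b(1)[OF C(1)] b(1)[OF C(3)] unfolding bij_betw_def inj_on_def by auto
          then show False
            using P(2)[OF b(1)[OF C(1)]] C x y \<open>x j = y j\<close> unfolding disjoint_family_on_def by auto
        qed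
      qed
    qed
  qed
  then show ?thesis unfolding U0_def Y_def by simp
qed


lemma tower_good_children:
  assumes A: "A \<in> Nd k"
  shows "tower (\<Union>(pt (Suc k) ` {B \<in> ch k A. good (Suc k) B})) (\<lambda>j. same (k + j))"
proof (rule tower_shift[OF tower])
  have Nd: "B \<in> Nd (Suc k)" if "B \<in> ch k A" for B using ch[OF A] that by blast
  then show "\<Union>(pt (Suc k) ` {B \<in> ch k A. good (Suc k) B}) \<subseteq> X"
    using pt[of _ "Suc k"] by auto
  fix x y assume "x \<in> \<Union>(pt (Suc k) ` {B \<in> ch k A. good (Suc k) B})" "same (Suc k) x y"
  then obtain B where "B \<in> ch k A" "good (Suc k) B" "x \<in> pt (Suc k) B" "y \<in> pt (Suc k) B"
    using same_node[OF Nd] by auto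
  then show "y \<in> \<Union>(pt (Suc k) ` {B \<in> ch k A. good (Suc k) B})" by auto
qed

text \<open>All of \<open>U\<close> lies in one class of level \<open>k\<close> and all words share
  a prefix of length \<open>k\<close>. So nothing can go wrong up to level \<open>k\<close>, and the
  constant \<open>c\<close> does not grow.\<close>

lemma prepend_word:
  assumes h: "coarse_equiv c (\<lambda>j. same (k + j)) agree U (seqs (card T) Q) h"
    and U: "U \<subseteq> X" "\<And>x y. \<lbrakk>x \<in> U; y \<in> U\<rbrakk> \<Longrightarrow> same k x y"
    and w: "w \<in> seqs Q Q" and T: "T \<subseteq> {..<Q}"
  shows "\<exists>f. coarse_equiv c same agree U {y \<in> seqs Q Q. agree k y w \<and> y k \<in> T} f"
proof -
  define V where "V = {y \<in> seqs Q Q. agree k y w \<and> y k \<in> T}"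
  have "finite T" using T finite_subset by blast
  then obtain \<tau> where \<tau>: "bij_betw \<tau> {..<card T} T"
    by (metis ex_bij_betw_nat_finite atLeast0LessThan)
  let ?\<tau>' = "inv_into {..<card T} \<tau>"
  have \<tau>': "?\<tau>' t < card T" "\<tau> (?\<tau>' t) = t" if "t \<in> T" for t
    using bij_betwE[OF bij_betw_inv_into[OF \<tau>]] bij_betw_inv_into_right[OF \<tau>] that by auto
  have \<tau>i: "\<tau> i \<in> T" "?\<tau>' (\<tau> i) = i" if "i < card T" for i
    using bij_betwE[OF \<tau>] bij_betw_inv_into_left[OF \<tau>] that by auto
  define s where "s y = (\<lambda>i. if i < k then w i else if i = k then \<tau> (y 0) else y (i - k))" for
      y :: "nat \<Rightarrow> nat"
  define g where "g z = (\<lambda>i. if i = 0 then ?\<tau>' (z k) else z (k + i))" for z :: "nat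
      \<Rightarrow> nat"
  have wQ: "w i < Q" for i using seqs_less[OF w, of i] by (simp split: if_splits)
  have sV: "s y \<in> V" if y: "y \<in> seqs (card T) Q" for y
  proof -
    have "\<tau> (y 0) \<in> T" using \<tau>i seqs_0[OF y] by blast
    moreover have "s y i < Q" for i
      using wQ T \<open>\<tau> (y 0) \<in> T\<close> seqs_pos[OF y, of "i - k"] by (auto simp: s_def)
    then have "s y \<in> seqs Q Q" by (intro seqsI) simp
    ultimately show ?thesis by (simp add: V_def agree_def s_def)
  qed
  have gY: "g z \<in> seqs (card T) Q" if z: "z \<in> V" for z
  proof (rule seqsI)
    have "z \<in> seqs Q Q" "z k \<in> T" using z by (simp_all add: V_def)
    then show "g z i < (if i = 0 then card T else Q)" for i
      using \<tau>'(1) seqs_less[of z Q Q "k + i"] by (auto simp: g_def split: if_splits)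
  qed
  have bs: "bij_betw s (seqs (card T) Q) V"
  proof (rule bij_betw_byWitness[where f' = g])
    show "\<forall>y\<in>seqs (card T) Q. g (s y) = y"
      using \<tau>i(2) seqs_0 by (auto simp: g_def s_def fun_eq_iff)
    show "\<forall>z\<in>V. s (g z) = z"
      using \<tau>'(2) by (auto simp: g_def s_def fun_eq_iff V_def agree_def)
  qed (use sV gY in auto)
  have ag: "agree (k + j) (s y) (s y') \<longleftrightarrow> agree j y y'"
    if "y \<in> seqs (card T) Q" "y' \<in> seqs (card T) Q" for j y y'
  proof
    assume *: "agree (k + j) (s y) (s y')"
    show "agree j y y'"
      unfolding agree_def
    proof (intro allI impI)
      fix i assume "i < j"
      then have eq: "s y (k + i) = s y' (k + i)" using * by (simp add: agree_def)
      show "y i = y' i"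
      proof (cases "i = 0")
        case True
        then have "\<tau> (y 0) = \<tau> (y' 0)" using eq by (simp add: s_def)
        then show ?thesis using \<tau>i(2) seqs_0[OF that(1)] seqs_0[OF that(2)] True by metis
      qed (use eq in \<open>simp add: s_def\<close>)
    qed
  qed (auto simp: agree_def s_def)
  have agk: "agree k (s y) (s y')" for y y' by (simp add: agree_def s_def)
  have hb: "bij_betw h U (seqs (card T) Q)" using h by (rule coarse_equiv_bij)
  have hU: "h x \<in> seqs (card T) Q" if "x \<in> U" for x using hb that by (auto dest: bij_betwE)
  have "coarse_equiv c same agree U V (s \<circ> h)"
    unfolding coarse_equiv_def
  proof (intro conjI ballI allI impI)
    show "bij_betw (s \<circ> h) U V" by (rule bij_betw_trans[OF hb bs])
  next
    fix x y j assume xy: "x \<in> U" "y \<in> U" "same (j + c) x y"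
    show "agree j ((s \<circ> h) x) ((s \<circ> h) y)"
    proof (cases "j \<le> k")
      case True
      then show ?thesis using agree_antimono[OF agk] by simp
    next
      case False
      then obtain i where i: "j = k + i" by (metis le_add_diff_inverse nat_le_linear)
      then have "same (k + (i + c)) x y" using xy by (simp add: add.assoc)
      then have "agree i (h x) (h y)" using h xy unfolding coarse_equiv_def by blast
      then show ?thesis using ag hU xy i by simp
    qed
  next
    fix x y j assume xy: "x \<in> U" "y \<in> U" "agree (j + c) ((s \<circ> h) x) ((s \<circ> h) y)"
    have XX: "x \<in> X" "y \<in> X" using xy U by auto
    show "same j x y"
    proof (cases "j \<le> k")
      case True
      then show ?thesis using tower_antimono[OF tower XX U(2)[OF xy(1,2)]] by simp
    next
      case False
      then obtain i where i: "j = k + i" by (metis le_add_diff_inverse nat_le_linear)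
      then have "agree (i + c) (h x) (h y)" using ag hU xy by (simp add: add.assoc)
      then show ?thesis using h xy i unfolding coarse_equiv_def by blast
    qed
  qed
  then show ?thesis unfolding V_def by blast
qed

text \<open>Only the bad children continue the recursion. The good children of a node form one
  single leaf together, whose words are those with a letter not given to a bad child.\<close>

theorem coarse_equiv_seqs: "\<exists>c f. coarse_equiv c same agree X (seqs Q Q) f"
proof -
  \<comment> \<open>The summand 2 comes from \<open>good_children_coarse_equiv\<close>, the rest
    from \<open>seqs_coarse_equiv\<close> with \<open>r \<le> Rmax\<close> and
    \<open>card T \<le> Q\<close>. Nothing depends on the node.\<close>
  define c where "c = 2 + 4 * (Rmax + Q)"
  define Y where "Y = seqs Q Q"
  define V where "V k w T = {y \<in> Y. agree k y w \<and> y k \<in> T}" for k w T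
  have less: "y i < Q" if "y \<in> Y" for y i using seqs_less[of y Q Q i] that by (simp add: Y_def split:
      if_splits)
  have upd: "w(i := t) \<in> Y" if "w \<in> Y" "t < Q" for w i t
    using less[OF that(1)] that(2) unfolding Y_def by (intro seqsI) simp
  define \<Phi> where "\<Phi> k U V' \<longleftrightarrow> (\<exists>A\<in>Nd k. \<exists>w\<in>Y. U = pt k
      A \<and> V' = {y \<in> Y. agree k y w})" for k U V'
  have "\<exists>f. coarse_equiv (2 * Suc c) same agree X Y f"
  proof (rule back_and_forth_leaves[where \<Phi> = \<Phi>, OF tower])
    show "tower Y agree" unfolding Y_def by (rule tower_seqs)
    have "(\<lambda>i. 0) \<in> Y" using Q by (auto simp: Y_def intro!: seqsI)
    then show "\<Phi> 0 X Y" unfolding \<Phi>_def using root by auto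
  next
    fix k U V' assume "\<Phi> k U V'"
    then show "U \<subseteq> X \<and> U \<noteq> {} \<and> V' \<subseteq> Y \<and> V' \<noteq> {}"
      unfolding \<Phi>_def using pt agree_refl by blast
  next
    fix k U V' x y j assume "\<Phi> k U V'" "x \<in> U" "y \<in> U" "j + c \<le> k"
    then obtain A where A: "A \<in> Nd k" "x \<in> pt k A" "y \<in> pt k A" by (auto simp: \<Phi>_def)
    then have "same k x y" unfolding same_def by blast
    then show "same j x y"
      by (rule tower_antimono[OF tower, rotated 2]) (use A pt[OF A(1)] \<open>j + c \<le> k\<close> in auto)
  next
    fix k U V' x y j assume "\<Phi> k U V'" "x \<in> V'" "y \<in> V'" "j + c \<le> k"
    then have "agree k x y" unfolding \<Phi>_def by (auto intro: agree_trans agree_sym)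
    then show "agree j x y" by (rule agree_antimono) (use \<open>j + c \<le> k\<close> in simp)
  next
    fix k U V' assume "\<Phi> k U V'"
    then obtain A w where A: "A \<in> Nd k" and w: "w \<in> Y" and UV: "U = pt k A" "V' = {y \<in> Y. agree
        k y w}"
      by (auto simp: \<Phi>_def)
    define G where "G = {B \<in> ch k A. good (Suc k) B}"
    define N where "N = {B \<in> ch k A. \<not> good (Suc k) B}"
    have GN: "ch k A = G \<union> N" "G \<inter> N = {}" by (auto simp: G_def N_def)
    have chA: "ch k A \<subseteq> Nd (Suc k)" "finite (ch k A)" "pt k A = \<Union>(pt (Suc k) ` ch k A)"
      using ch[OF A] by auto
    have N: "finite N" "card N < Q" using chA few_bad[OF A] by (simp_all add: N_def)
    then have "card N \<le> card {..<Q}" by simp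
    then obtain \<iota> where \<iota>: "\<iota> ` N \<subseteq> {..<Q}" "inj_on \<iota> N"
      using card_le_inj[OF N(1) finite_lessThan] by blast
    \<comment> \<open>At least one letter remains, because the inequality in \<open>few_bad\<close>
      is strict.\<close>
    define T where "T = {..<Q} - \<iota> ` N"
    have cardT: "card T = Q - card N" unfolding T_def using \<iota> N by (simp add: card_Diff_subset card_image)
    define r where "r = (\<Sum>B\<in>G. \<alpha> (Suc k) B)"
    let ?UG = "\<Union>(pt (Suc k) ` G)"
    have "G \<noteq> {}" "G \<subseteq> Nd (Suc k)" "finite G" using some_good[OF A] chA by (auto simp: G_def)
    have UGX: "?UG \<subseteq> X" "?UG \<noteq> {}"
    proof -
      have "pt (Suc k) B \<subseteq> X" "pt (Suc k) B \<noteq> {}" if "B \<in> G" for B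
        using pt[of B "Suc k"] that \<open>G \<subseteq> Nd (Suc k)\<close> by auto
      then show "?UG \<subseteq> X" "?UG \<noteq> {}" using \<open>G \<noteq> {}\<close> by auto
    qed
    have r: "1 \<le> r" "r \<le> Rmax"
    proof -
      obtain B where B: "B \<in> G" using \<open>G \<noteq> {}\<close> by blast
      then have "1 \<le> \<alpha> (Suc k) B" using \<alpha>_pos \<open>G \<subseteq> Nd (Suc k)\<close> by
          (auto simp: G_def)
      then show "1 \<le> r" using member_le_sum[OF B, of "\<alpha> (Suc k)"] \<open>finite G\<close>
          unfolding r_def by simp
      show "r \<le> Rmax" using \<alpha>_bound[OF A] unfolding r_def G_def .
    qed
    obtain h1 where h1: "coarse_equiv 2 (\<lambda>j. same (k + j)) agree ?UG (seqs r Q) h1"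
      using good_children_coarse_equiv[OF A] unfolding G_def r_def by blast
    obtain h2 where h2: "coarse_equiv (4 * (r + card T)) agree agree (seqs r Q) (seqs (card T) Q) h2"
    proof -
      have "card T \<ge> 1" using cardT N by simp
      then show ?thesis using seqs_coarse_equiv[OF r(1) _ Q] that by blast
    qed
    have tUG: "tower ?UG (\<lambda>j. same (k + j))" using tower_good_children[OF A] unfolding G_def .
    have "coarse_equiv c (\<lambda>j. same (k + j)) agree ?UG (seqs (card T) Q) (h2 \<circ> h1)"
      by (rule coarse_equiv_mono[OF coarse_equiv_trans[OF h1 h2] _ tUG tower_seqs])
        (use r cardT in \<open>simp add: c_def\<close>)
    moreover have "same k x y" if "x \<in> ?UG" "y \<in> ?UG" for x y
      unfolding same_def using that A pt_child[OF A] unfolding G_def by blast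
    moreover have "w \<in> seqs Q Q" "T \<subseteq> {..<Q}" using w by (auto simp: Y_def T_def)
    ultimately have "\<exists>f. coarse_equiv c same agree ?UG (V k w T) f"
      using prepend_word[of c k ?UG T "h2 \<circ> h1" w] UGX(1) unfolding V_def Y_def by blast
    then have leafG: "leaf c same agree X Y (Suc k) ?UG (V k w T)"
      unfolding leaf_def using UGX
      by (auto simp: V_def agree_def less_Suc_eq_le)
    define \<C> where "\<C> = insert (?UG, V k w T)
        ((\<lambda>B. (pt (Suc k) B, {y \<in> Y. agree (Suc k) y (w(k := \<iota> B))})) ` N)"
    have VB: "y \<in> {y \<in> Y. agree (Suc k) y (w(k := \<iota> B))} \<longleftrightarrow> y \<in> Y
        \<and> agree k y w \<and> y k = \<iota> B" for y B
      by (auto simp: agree_def less_Suc_eq)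
    show "\<exists>\<C>. U = \<Union>(fst ` \<C>) \<and> V' = \<Union>(snd ` \<C>) \<and>
        (\<forall>p\<in>\<C>. \<Phi> (Suc k) (fst p) (snd p) \<or> leaf c same agree X Y (Suc k) (fst p)
            (snd p)) \<and>
        (\<forall>p\<in>\<C>. \<forall>p'\<in>\<C>. p \<noteq> p' \<longrightarrow>
           (\<forall>x\<in>fst p. \<forall>y\<in>fst p'. \<not> same (k + c) x y) \<and>
               (\<forall>x\<in>snd p. \<forall>y\<in>snd p'. \<not> agree (k + c) x y))"
    proof (intro exI[of _ \<C>] conjI ballI impI)
      show "U = \<Union>(fst ` \<C>)" unfolding UV chA(3) GN(1) \<C>_def by auto
      have "y \<in> V' \<longleftrightarrow> y \<in> V k w T \<or> (\<exists>B\<in>N. y \<in> Y \<and>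
          agree k y w \<and> y k = \<iota> B)" for y
        using less[of y k] \<iota>(1) unfolding UV V_def T_def by auto
      then show "V' = \<Union>(snd ` \<C>)" unfolding \<C>_def using VB by auto
    next
      fix p assume "p \<in> \<C>"
      then consider "p = (?UG, V k w T)"
        | B where "B \<in> N" "p = (pt (Suc k) B, {y \<in> Y. agree (Suc k) y (w(k := \<iota> B))})"
        unfolding \<C>_def by blast
      then show "\<Phi> (Suc k) (fst p) (snd p) \<or> leaf c same agree X Y (Suc k) (fst p) (snd p)"
      proof cases
        case 2
        have "w(k := \<iota> B) \<in> Y" using upd[OF w] \<iota>(1) 2 by blast
        moreover have "B \<in> Nd (Suc k)" using chA GN 2 by blast
        ultimately show ?thesis unfolding \<Phi>_def 2(2) fst_conv snd_conv by blast
      qed (use leafG in simp)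
    next
      fix p p' assume p: "p \<in> \<C>" "p' \<in> \<C>" "p \<noteq> p'"
      have node: "\<exists>B\<in>ch k A. x \<in> pt (Suc k) B \<and> (if B \<in> G then p = (?UG, V k w T)
          else p = (pt (Suc k) B, {y \<in> Y. agree (Suc k) y (w(k := \<iota> B))}))"
        if "x \<in> fst p" "p \<in> \<C>" for x p
        using that GN unfolding \<C>_def by auto
      show "\<not> same (k + c) x y" if xy: "x \<in> fst p" "y \<in> fst p'" for x y
      proof
        assume s: "same (k + c) x y"
        obtain B where B: "B \<in> ch k A" "x \<in> pt (Suc k) B" "if B \<in> G then p = (?UG, V k w T)
          else p = (pt (Suc k) B, {y \<in> Y. agree (Suc k) y (w(k := \<iota> B))})"
          using node[OF xy(1) p(1)] by blast
        obtain B' where B': "B' \<in> ch k A" "y \<in> pt (Suc k) B'" "if B' \<in> G then p' = (?UG, V k w T)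
          else p' = (pt (Suc k) B', {y \<in> Y. agree (Suc k) y (w(k := \<iota> B'))})"
          using node[OF xy(2) p(2)] by blast
        have NN: "B \<in> Nd (Suc k)" "B' \<in> Nd (Suc k)" using B B' chA by auto
        then have XX: "x \<in> X" "y \<in> X" using B B' pt by blast+
        have "same (Suc k) x y"
          by (rule tower_antimono[OF tower XX s]) (simp add: c_def)
        then have "B = B'" using same_node[OF NN(1) B(2), of y] disj[OF NN _ B'(2)] by blast
        then show False using B(3) B'(3) p(3) by (simp split: if_splits)
      qed
      show "\<not> agree (k + c) x y" if "x \<in> snd p" "y \<in> snd p'" for x y
      proof
        assume "agree (k + c) x y"
        then have "agree (Suc k) x y" by (rule agree_antimono) (simp add: c_def)
        then have xy: "x k = y k" by (simp add: agree_Suc)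
        have letter: "(z k \<in> T \<and> q = (?UG, V k w T)) \<or> (\<exists>B\<in>N. z k = \<iota> B \<and>
            q = (pt (Suc k) B, {y \<in> Y. agree (Suc k) y (w(k := \<iota> B))}))"
          if "z \<in> snd q" "q \<in> \<C>" for z q
          using that VB unfolding \<C>_def V_def by auto
        show False
          using letter[OF that(1) p(1)] letter[OF that(2) p(2)] xy p(3) \<iota>(2)
          unfolding T_def inj_on_def by auto
      qed
    qed
  qed
  then show ?thesis unfolding Y_def by blast
qed

end

section \<open>Frobenius representability and bin packing with a reserve\<close>

section \<open>Exact packing\<close>

lemma bezout_Gcd:
  fixes C :: "nat set"
  assumes "finite C"
  shows "\<exists>z :: nat \<Rightarrow> int. (\<Sum>c\<in>C. z c * int c) = int (Gcd C)"
  using assms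
proof (induction C rule: finite_induct)
  case (insert c C)
  then obtain z where z: "(\<Sum>c\<in>C. z c * int c) = int (Gcd C)" by blast
  obtain u v where uv: "u * int c + v * int (Gcd C) = gcd (int c) (int (Gcd C))"
    using bezout_int by blast
  define z' where "z' i = (if i = c then u else v * z i)" for i
  have "(\<Sum>i\<in>C. z' i * int i) = (\<Sum>i\<in>C. v * (z i * int i))"
    by (rule sum.cong) (use insert in \<open>auto simp: z'_def\<close>)
  then have "(\<Sum>i\<in>insert c C. z' i * int i) = int (Gcd (insert c C))"
    using insert uv z by (simp add: z'_def flip: sum_distrib_left)
  then show ?case by blast
qed simp

text \<open>Separating the positive and negative parts of a Bezout combination for 1 yields two
  consecutive representable numbers \<open>m\<close> and \<open>Suc m\<close>, and these two alone
  represent everything from \<open>m * m\<close> on.\<close>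

lemma large_numbers_representable:
  fixes C :: "nat set"
  assumes "finite C" "Gcd C = 1"
  shows "\<exists>R0. \<forall>R\<ge>R0. \<exists>x. (\<Sum>c\<in>C. x c * c) = R"
proof -
  obtain z where z: "(\<Sum>c\<in>C. z c * int c) = 1" using bezout_Gcd[OF assms(1)] assms(2) by auto
  define x where "x c = nat (z c)" for c
  define y where "y c = nat (- z c)" for c
  define m where "m = (\<Sum>c\<in>C. y c * c)"
  have "(\<Sum>c\<in>C. int (x c * c)) - (\<Sum>c\<in>C. int (y c * c)) = (\<Sum>c\<in>C. z c * int c)"
    unfolding sum_subtractf[symmetric]
    by (rule sum.cong) (auto simp: x_def y_def simp flip: left_diff_distrib)
  then have "int (\<Sum>c\<in>C. x c * c) = int (Suc m)" using z by (simp add: m_def)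
  then have xm: "(\<Sum>c\<in>C. x c * c) = Suc m" by (simp only: of_nat_eq_iff)
  have "\<exists>x. (\<Sum>c\<in>C. x c * c) = R" if "R \<ge> m * m" for R
  proof -
    obtain a b where ab: "R = a * m + b * Suc m"
    proof (cases "m = 0")
      case True
      then show ?thesis using that[of 0 R] by simp
    next
      case False
      \<comment> \<open>The remainder is absorbed by turning \<open>r\<close> of the summands
        \<open>m\<close> into \<open>Suc m\<close>. There are enough of them, the quotient being at
        least \<open>m > r\<close>.\<close>
      define r where "r = R mod m"
      have "r < m" using False by (simp add: r_def)
      moreover have "m \<le> R div m" using \<open>R \<ge> m * m\<close> False by (simp add:
          less_eq_div_iff_mult_less_eq)
      ultimately have "(R div m - r) * m + r * Suc m = (R div m) * m + r"
        by (simp add: algebra_simps flip: distrib_right)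
      also have "\<dots> = R" by (simp add: r_def)
      finally show ?thesis using that[of "R div m - r" r] by simp
    qed
    have "(\<Sum>c\<in>C. (a * y c + b * x c) * c) = a * (\<Sum>c\<in>C. y c * c) + b * (\<Sum>c\<in>C. x c
        * c)"
      by (simp add: distrib_right sum.distrib sum_distrib_left mult.assoc)
    also have "\<dots> = R" unfolding ab xm m_def ..
    finally have "(\<Sum>c\<in>C. (a * y c + b * x c) * c) = R" .
    then show ?thesis by (intro exI)
  qed
  then show ?thesis by blast
qed

lemma greedy_subset:
  fixes s :: "'i \<Rightarrow> nat"
  assumes "finite I" "\<And>i. i \<in> I \<Longrightarrow> s i \<le> M" "N \<le> sum s I"
  shows "\<exists>J\<subseteq>I. sum s J \<le> N \<and> N \<le> sum s J + M"
  using assms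
proof (induction I rule: finite_induct)
  case (insert i I)
  show ?case
  proof (cases "N \<le> sum s I")
    case True
    then show ?thesis using insert by blast
  next
    case False
    then show ?thesis
      using insert.prems(1)[of i] insert.prems(2) insert.hyps by (intro exI[of _ I]) auto
  qed
qed auto

text \<open>Exact packing into bins of size \<open>Q\<close>: a reserve of items whose sizes range over
    \<open>C\<close> is kept
  aside, so that each bin, after a greedy filling, can be completed exactly.\<close>

lemma exact_packing:
  fixes s :: "'i \<Rightarrow> nat" and C :: "nat set"
  assumes C: "finite C" "C \<subseteq> {1..M}"
    and rep: "\<And>R. R \<ge> R0 \<Longrightarrow> \<exists>x. (\<Sum>c\<in>C. x c * c) = R"
    and Q: "Q \<ge> card C * M * (b * (R0 + M)) + R0"
    and I: "finite I" "\<And>i. i \<in> I \<Longrightarrow> s i \<le> M" "sum s I = Q * Suc b"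
    and reserve: "\<And>c. c \<in> C \<Longrightarrow> card {i \<in> I. s i = c} \<ge> b * (R0 + M)"
  shows "\<exists>f. (\<forall>i\<in>I. f i < Suc b) \<and> (\<forall>t<Suc b. (\<Sum>i | i \<in> I \<and>
      f i = t. s i) = Q)"
  using Q I reserve
\<comment> \<open>The last bin takes what is left and is right by the total. So only
  \<open>b\<close> of the \<open>Suc b\<close> bins draw on the reserve, each with at most
  \<open>R0 + M\<close> items of any size.\<close>
proof (induction b arbitrary: I)
  case 0
  then show ?case by (intro exI[of _ "\<lambda>_. 0"]) simp
next
  case (Suc b)
  let ?K = "R0 + M"
  have "\<exists>Z\<subseteq>{i \<in> I. s i = c}. card Z = Suc b * ?K" if "c \<in> C" for c
    using obtain_subset_with_card_n[OF Suc.prems(5)[OF that]] by metis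
  then obtain Z where Z: "\<And>c. c \<in> C \<Longrightarrow> Z c \<subseteq> {i \<in> I. s i = c}"
      "\<And>c. c \<in> C \<Longrightarrow> card (Z c) = Suc b * ?K"
    by metis
  have finZ: "finite (Z c)" if "c \<in> C" for c
    by (rule finite_subset[OF Z(1)[OF that]]) (simp add: Suc.prems(2))
  define Res where "Res = (\<Union>c\<in>C. Z c)"
  have sumZ: "sum s W = card W * c" if "W \<subseteq> Z c" "c \<in> C" for W c
  proof -
    have "sum s W = (\<Sum>i\<in>W. c)" by (rule sum.cong) (use that Z in auto)
    then show ?thesis by simp
  qed
  have disjZ: "Z c \<inter> Z c' = {}" if "c \<in> C" "c' \<in> C" "c \<noteq> c'" for c c'
    using Z(1)[OF that(1)] Z(1)[OF that(2)] that(3) by auto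
  have "sum s Res = (\<Sum>c\<in>C. sum s (Z c))"
    unfolding Res_def by (rule sum.UNION_disjoint) (use C finZ disjZ in auto)
  also have "\<dots> = (\<Sum>c\<in>C. Suc b * ?K * c)"
    by (rule sum.cong) (simp_all only: sumZ[OF subset_refl] Z(2))
  also have "\<dots> \<le> (\<Sum>c\<in>C. Suc b * ?K * M)"
    by (rule sum_mono) (use C in auto)
  also have "\<dots> = card C * M * (Suc b * ?K)" by simp
  finally have Res: "sum s Res \<le> card C * M * (Suc b * ?K)" .
  have ResI: "Res \<subseteq> I" using Z(1) by (auto simp: Res_def)
  have "sum s I = sum s (I - Res) + sum s Res"
    using sum.subset_diff[OF ResI Suc.prems(2)] .
  then have "Q * Suc (Suc b) \<le> sum s (I - Res) + Q" using Suc.prems(1,4) Res by linarith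
  then have "Q - R0 \<le> sum s (I - Res)" by simp
  \<comment> \<open>The greedy filling stops at least \<open>R0\<close> short of \<open>Q\<close>,
    so that the gap is representable, and at most \<open>R0 + M\<close> short, so that no size is
    used more often than that.\<close>
  then obtain J where J: "J \<subseteq> I - Res" "sum s J \<le> Q - R0" "Q - R0 \<le> sum s J + M"
    using greedy_subset[of "I - Res" s M "Q - R0"] Suc.prems(2,3) by auto
  have "R0 \<le> Q" using Suc.prems(1) by simp
  then have "Q - sum s J \<ge> R0" "Q - sum s J \<le> ?K" "sum s J \<le> Q" using J by linarith+
  from rep[OF this(1)] obtain x where x: "(\<Sum>c\<in>C. x c * c) = Q - sum s J" by blast
  have xK: "x c \<le> ?K" if "c \<in> C" for c
  proof -
    have "x c * 1 \<le> x c * c" using C that by (intro mult_le_mono2) auto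
    also have "\<dots> \<le> (\<Sum>c\<in>C. x c * c)" using C that by (intro member_le_sum) auto
    finally show ?thesis using x \<open>Q - sum s J \<le> ?K\<close> by simp
  qed
  then have "x c \<le> card (Z c)" if "c \<in> C" for c
    using Z(2)[OF that] xK[OF that] by simp
  then have "\<exists>W\<subseteq>Z c. card W = x c" if "c \<in> C" for c
    using obtain_subset_with_card_n that by metis
  then obtain W where W: "\<And>c. c \<in> C \<Longrightarrow> W c \<subseteq> Z c" "\<And>c. c \<in> C
      \<Longrightarrow> card (W c) = x c"
    by metis
  have finW: "finite (W c)" if "c \<in> C" for c using W(1) finZ finite_subset that by blast
  define B where "B = J \<union> (\<Union>c\<in>C. W c)"
  have "sum s (\<Union>c\<in>C. W c) = (\<Sum>c\<in>C. sum s (W c))"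
    by (rule sum.UNION_disjoint) (use C finW W(1) disjZ in \<open>auto, blast\<close>)
  also have "\<dots> = (\<Sum>c\<in>C. x c * c)"
    by (rule sum.cong) (simp_all only: sumZ[OF W(1)] W(2))
  finally have sumW: "sum s (\<Union>c\<in>C. W c) = Q - sum s J" using x by simp
  have "sum s B = sum s J + sum s (\<Union>c\<in>C. W c)"
    unfolding B_def
  proof (rule sum.union_disjoint)
    show "finite J" using J Suc.prems(2) finite_subset by blast
    show "finite (\<Union>c\<in>C. W c)" using C finW by blast
    show "J \<inter> (\<Union>c\<in>C. W c) = {}" using J W(1) unfolding Res_def by blast
  qed
  then have sumB: "sum s B = Q" using sumW \<open>sum s J \<le> Q\<close> by simp
  have BI: "B \<subseteq> I" using J W(1) ResI unfolding B_def Res_def by blast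
  have "sum s I = sum s (I - B) + sum s B" using sum.subset_diff[OF BI Suc.prems(2)] .
  then have sumI': "sum s (I - B) = Q * Suc b" using sumB Suc.prems(4) by simp
  have res: "card {i \<in> I - B. s i = c} \<ge> b * ?K" if "c \<in> C" for c
  proof -
    have "Z c - W c \<subseteq> {i \<in> I - B. s i = c}"
    proof
      fix i assume i: "i \<in> Z c - W c"
      then have "i \<in> Res" "i \<in> I" "s i = c" using that Z(1) by (auto simp: Res_def)
      moreover have "i \<notin> W c'" if "c' \<in> C" for c'
        using W(1)[OF that] Z(1)[OF that] \<open>s i = c\<close> i by auto
      ultimately show "i \<in> {i \<in> I - B. s i = c}" using J unfolding B_def by blast
    qed
    then have "card (Z c - W c) \<le> card {i \<in> I - B. s i = c}"
      by (rule card_mono[rotated]) (simp add: Suc.prems(2))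
    moreover have "card (Z c - W c) = Suc b * ?K - x c"
      using card_Diff_subset[OF finW[OF that] W(1)[OF that]] W(2) Z(2) that by simp
    ultimately show ?thesis using xK[OF that] by simp
  qed
  have "card C * M * (b * ?K) \<le> card C * M * (Suc b * ?K)" by (intro mult_le_mono2) simp
  then have "Q \<ge> card C * M * (b * ?K) + R0" using Suc.prems(1) by linarith
  then obtain f where f: "\<forall>i\<in>I - B. f i < Suc b"
      "\<forall>t<Suc b. (\<Sum>i | i \<in> I - B \<and> f i = t. s i) = Q"
    using Suc.IH[OF _ finite_Diff[OF Suc.prems(2)] Suc.prems(3) sumI' res] by auto
  define g where "g i = (if i \<in> B then Suc b else f i)" for i
  show ?case
  proof (intro exI[of _ g] conjI ballI allI impI)
    fix i assume "i \<in> I"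
    then show "g i < Suc (Suc b)" using f(1) by (auto simp: g_def less_Suc_eq)
  next
    fix t assume t: "t < Suc (Suc b)"
    show "(\<Sum>i | i \<in> I \<and> g i = t. s i) = Q"
    proof (cases "t = Suc b")
      case True
      moreover have "f i \<noteq> Suc b" if "i \<in> I - B" for i using f(1)[rule_format, OF that] by simp
      ultimately have "{i. i \<in> I \<and> g i = t} = B" using BI by (auto simp: g_def)
      then show ?thesis using sumB by simp
    next
      case False
      then have "{i. i \<in> I \<and> g i = t} = {i. i \<in> I - B \<and> f i = t}" using t by (auto simp:
          g_def)
      then show ?thesis using f(2) t False by simp
    qed
  qed
qed

section \<open>Counting cylinders: a relation between the alphabet sizes\<close>

section \<open>Sequence spaces and Hoelder equivalence\<close>

text \<open>A canonical name for a cylinder of length \<open>k\<close>: the number of cylinders that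
  meet a set is the cardinality of its image.\<close>

definition trunc :: "nat \<Rightarrow> (nat \<Rightarrow> nat) \<Rightarrow> nat \<Rightarrow> nat" where
  "trunc k x = (\<lambda>i. if i < k then x i else 0)"

lemma trunc_eq_iff: "trunc k x = trunc k y \<longleftrightarrow> agree k x y"
  by (auto simp: trunc_def agree_def fun_eq_iff)

lemma agree_upd_right: "i \<le> k \<Longrightarrow> agree i x (y(k := v)) \<longleftrightarrow> agree i x y"
  by (auto simp: agree_def)

text \<open>\<open>S\<close> is a union of cylinders of length \<open>a\<close>, so beyond this
  length every word that occurs has all its \<open>q\<close> one-letter extensions.\<close>

lemma card_trunc_saturated:
  assumes S: "S \<subseteq> seqs q q" and sat: "\<And>y z. \<lbrakk>y \<in> S; z \<in> seqs q q; agree a z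
      y\<rbrakk> \<Longrightarrow> z \<in> S"
  shows "finite (trunc (a + d) ` S) \<and> card (trunc (a + d) ` S) = card (trunc a ` S) * q ^ d"
proof -
  have less: "y i < q" if "y \<in> seqs q q" for y i using seqs_less[OF that, of i] by (simp split: if_splits)
  have bij: "bij_betw (\<lambda>(u, v). u(b := v)) (trunc b ` S \<times> {..<q}) (trunc (Suc b) ` S)" if "a
      \<le> b" for b
    unfolding bij_betw_def
  proof
    show "inj_on (\<lambda>(u, v). u(b := v)) (trunc b ` S \<times> {..<q})"
    proof (rule inj_onI, clarsimp)
      fix x y v v' assume eq: "(trunc b x)(b := v) = (trunc b y)(b := v')"
      have "trunc b x i = trunc b y i" for i
        using fun_cong[OF eq, of i] by (cases "i = b") (auto simp: trunc_def)
      then show "trunc b x = trunc b y \<and> v = v'" using fun_cong[OF eq, of b] by auto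
    qed
    have "(trunc b x)(b := v) \<in> trunc (Suc b) ` S" if "x \<in> S" "v < q" for x v
    proof -
      have "x(b := v) \<in> seqs q q" using less[of x] that S by (intro seqsI) auto
      then have "x(b := v) \<in> S" using sat[OF that(1)] \<open>a \<le> b\<close> by (simp add: agree_upd)
      moreover have "trunc (Suc b) (x(b := v)) = (trunc b x)(b := v)"
        by (auto simp: trunc_def fun_eq_iff less_Suc_eq)
      ultimately show ?thesis by (metis image_eqI)
    qed
    moreover have "trunc (Suc b) x \<in> (\<lambda>(u, v). u(b := v)) ` (trunc b ` S \<times> {..<q})" if
        "x \<in> S" for x
    proof -
      have "trunc (Suc b) x = (trunc b x)(b := x b)"
        by (auto simp: trunc_def fun_eq_iff less_Suc_eq)
      moreover have "x b < q" using less that S by blast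
      ultimately show ?thesis using that by (intro image_eqI[of _ _ "(trunc b x, x b)"]) auto
    qed
    ultimately show "(\<lambda>(u, v). u(b := v)) ` (trunc b ` S \<times> {..<q}) = trunc (Suc b) ` S" by auto
  qed
  have fin: "finite (trunc b ` S)" for b
  proof (rule finite_subset)
    show "trunc b ` S \<subseteq> {f. \<forall>i. (i \<in> {..<b} \<longrightarrow> f i \<in> {..<q})
        \<and> (i \<notin> {..<b} \<longrightarrow> f i = 0)}"
      using less S by (auto simp: trunc_def)
    show "finite {f. \<forall>i. (i \<in> {..<b} \<longrightarrow> f i \<in> {..<q}) \<and> (i \<notin>
        {..<b} \<longrightarrow> f i = (0::nat))}"
      by (rule finite_set_of_finite_funs) auto
  qed
  have "card (trunc (a + d) ` S) = card (trunc a ` S) * q ^ d"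
  proof (induction d)
    case (Suc d)
    then show ?case using bij_betw_same_card[OF bij[of "a + d"]] by (simp add: card_cartesian_product mult_ac)
  qed simp
  then show ?thesis using fin by blast
qed

text \<open>\<open>J k x\<close> below counts the words of length \<open>m k\<close> in the image of the
    cylinder of \<open>x\<close> of length \<open>k\<close>.
  The normalised count \<open>J k x * q ^ k / q' ^ m k\<close> of a word is the average over its one-letter
      extensions.\<close>

lemma power_relation:
  fixes f :: "(nat \<Rightarrow> nat) \<Rightarrow> nat \<Rightarrow> nat" and t c :: real
  assumes q: "q \<ge> 2" "q' \<ge> 2" and t: "t > 0" and c: "c \<ge> 0"
    and bij: "bij_betw f (seqs q q) (seqs q' q')"
    and down: "\<And>x y i j. \<lbrakk>x \<in> seqs q q; y \<in> seqs q q; real i + c \<le> t * real j;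
        agree j x y\<rbrakk>
                 \<Longrightarrow> agree i (f x) (f y)"
    and up: "\<And>x y i j. \<lbrakk>x \<in> seqs q q; y \<in> seqs q q; t * real j + c \<le> real i; agree
        i (f x) (f y)\<rbrakk>
                 \<Longrightarrow> agree j x y"
  shows "\<exists>a b. a \<ge> 1 \<and> b \<ge> 1 \<and> q ^ a = q' ^ b"
proof -
  define X where "X = seqs q q"
  define Y where "Y = seqs q' q'"
  \<comment> \<open>The least length to which \<open>up\<close> applies for \<open>k\<close>. Images
    of different cylinders of length \<open>k\<close> therefore share no word of length
    \<open>m k\<close>.\<close>
  define m where "m k = nat \<lceil>t * real k + c\<rceil>" for k
  have m: "t * real k + c \<le> real (m k)" "real (m k) < t * real k + c + 1" for k
  proof -
    have "0 \<le> t * real k + c" using t c by simp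
    then show "t * real k + c \<le> real (m k)" "real (m k) < t * real k + c + 1"
      unfolding m_def by (simp_all) linarith+
  qed
  have m_mono: "m k \<le> m (Suc k)" for k
    unfolding m_def by (intro nat_mono ceiling_mono) (use t in \<open>simp add: algebra_simps\<close>)
  have up': "agree k x y" if "x \<in> X" "y \<in> X" "agree (m k) (f x) (f y)" for k x y
    using up[OF that(1,2)[unfolded X_def] m(1) that(3)] .
  define cyl where "cyl k x = {y \<in> X. agree k y x}" for k x
  define J where "J k x = card (trunc (m k) ` f ` cyl k x)" for k x
  have fX: "f x \<in> Y" if "x \<in> X" for x using bij that by (auto simp: X_def Y_def dest: bij_betwE)
  have sat: "z \<in> f ` cyl k x" if yz: "y \<in> f ` cyl k x" "z \<in> Y" "agree (m k) z y" for x y z k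
  proof -
    obtain u where u: "u \<in> X" "agree k u x" "y = f u" using yz(1) by (auto simp: cyl_def)
    obtain v where v: "v \<in> X" "z = f v"
      using bij yz(2) unfolding bij_betw_def X_def Y_def by blast
    have "agree k v u" using up'[OF v(1) u(1)] yz(3) u v by simp
    then show ?thesis using u v by (auto simp: cyl_def intro: agree_trans)
  qed
  have subY: "f ` cyl k x \<subseteq> Y" for k x using fX by (auto simp: cyl_def)
  \<comment> \<open>The image of a cylinder lies in one cylinder of length about
    \<open>t * k - c\<close>, while words of length about \<open>t * k + c\<close> are counted. Both
    roundings included, the lengths differ by at most \<open>2 * c + 2\<close>.\<close>
  define E where "E = nat \<lceil>2 * c + 2\<rceil>"
  define Jmax where "Jmax = q' ^ E"
  have J_bounds: "1 \<le> J k x \<and> J k x \<le> Jmax" if "x \<in> X" for k x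
  proof
    have fin: "finite (trunc (m k) ` f ` cyl k x)"
      using card_trunc_saturated[of "f ` cyl k x" q' "m k" 0] sat[of _ k x] subY unfolding Y_def by auto
    moreover have "x \<in> cyl k x" using that by (simp add: cyl_def)
    ultimately show "1 \<le> J k x" unfolding J_def by (simp add: Suc_le_eq card_gt_0_iff) blast
    define i where "i = nat \<lfloor>t * real k - c\<rfloor>"
    define S where "S = {z \<in> Y. agree i z (f x)}"
    have i: "t * real k - c - 1 < real i" unfolding i_def by linarith
    have "agree i (f y) (f x)" if "y \<in> cyl k x" for y
    proof (cases "t * real k - c < 0")
      case True
      then show ?thesis by (simp add: i_def)
    next
      case False
      then have "real i + c \<le> t * real k" unfolding i_def by linarith
      then show ?thesis using down[of y x i k] that \<open>x \<in> X\<close> by (simp add: cyl_def X_def)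
    qed
    then have sub: "f ` cyl k x \<subseteq> S" using subY[of k x] by (auto simp: S_def)
    have satS: "z \<in> S" if "y \<in> S" "z \<in> seqs q' q'" "agree i z y" for y z
      using that by (auto simp: S_def Y_def intro: agree_trans)
    have "i \<le> m k"
    proof -
      have "\<lfloor>t * real k - c\<rfloor> \<le> \<lceil>t * real k + c\<rceil>" using c by linarith
      then show ?thesis unfolding i_def m_def by simp
    qed
    then obtain d where d: "m k = i + d" using le_Suc_ex by blast
    have "real d \<le> 2 * c + 2" using d i m(2)[of k] by simp
    then have dE: "d \<le> E" unfolding E_def by linarith
    have "trunc i ` S = {trunc i (f x)}"
      using fX[OF \<open>x \<in> X\<close>] by (auto simp: S_def trunc_eq_iff image_iff)
    then have "finite (trunc (m k) ` S) \<and> card (trunc (m k) ` S) = q' ^ d"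
      using card_trunc_saturated[of S q' i d] satS d by (auto simp: S_def Y_def)
    then have "J k x \<le> q' ^ d"
      unfolding J_def using card_mono[of "trunc (m k) ` S"] sub by (metis image_mono)
    also have "\<dots> \<le> Jmax" unfolding Jmax_def using q dE by (intro power_increasing) auto
    finally show "J k x \<le> Jmax" .
  qed
  have less: "y i < q" if "y \<in> X" for y i using seqs_less[of y q q i] that by (simp add: X_def split:
      if_splits)
  have upd: "x(k := v) \<in> X" if "x \<in> X" "v < q" for x k v
    using less[OF that(1)] that(2) unfolding X_def by (intro seqsI) simp
  have split: "cyl k x = (\<Union>v<q. cyl (Suc k) (x(k := v)))" for k x
    using less by (auto simp: cyl_def agree_Suc agree_upd_right)
  have J_sum: "(\<Sum>v<q. J (Suc k) (x(k := v))) = J k x * q' ^ (m (Suc k) - m k)" if "x \<in> X" for k x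
  proof -
    have *: "finite (trunc (m (Suc k)) ` f ` cyl k x) \<and>
        card (trunc (m (Suc k)) ` f ` cyl k x) = J k x * q' ^ (m (Suc k) - m k)"
      using card_trunc_saturated[of "f ` cyl k x" q' "m k" "m (Suc k) - m k"] sat[of _ k x] subY[of k x]
          m_mono[of k]
      unfolding J_def Y_def by auto
    have un: "trunc (m (Suc k)) ` f ` cyl k x = (\<Union>v<q. trunc (m (Suc k)) ` f ` cyl (Suc k) (x(k := v)))"
      using split[of k x] by (simp add: image_UN)
    have "card (trunc (m (Suc k)) ` f ` cyl k x) = (\<Sum>v<q. J (Suc k) (x(k := v)))"
      unfolding un J_def
    proof (rule card_UN_disjoint)
      show "\<forall>v\<in>{..<q}. finite (trunc (m (Suc k)) ` f ` cyl (Suc k) (x(k := v)))"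
        using * unfolding un by (auto intro: finite_subset)
      show "\<forall>v\<in>{..<q}. \<forall>v'\<in>{..<q}. v \<noteq> v' \<longrightarrow>
          trunc (m (Suc k)) ` f ` cyl (Suc k) (x(k := v)) \<inter> trunc (m (Suc k)) ` f ` cyl (Suc k) (x(k
              := v')) = {}"
      proof (intro ballI impI)
        fix v v' :: nat assume "v \<noteq> v'"
        show "trunc (m (Suc k)) ` f ` cyl (Suc k) (x(k := v)) \<inter> trunc (m (Suc k)) ` f ` cyl (Suc k)
            (x(k := v')) = {}"
        proof (rule ccontr)
          assume "\<not> ?thesis"
          then obtain w where w: "w \<in> trunc (m (Suc k)) ` f ` cyl (Suc k) (x(k := v))"
              "w \<in> trunc (m (Suc k)) ` f ` cyl (Suc k) (x(k := v'))" by blast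
          obtain y where y: "y \<in> cyl (Suc k) (x(k := v))" "w = trunc (m (Suc k)) (f y)"
            using w(1) by blast
          obtain y' where y': "y' \<in> cyl (Suc k) (x(k := v'))" "w = trunc (m (Suc k)) (f y')"
            using w(2) by blast
          have "agree (m (Suc k)) (f y) (f y')" using y(2) y'(2) by (simp flip: trunc_eq_iff)
          moreover have "y \<in> X" "y' \<in> X" using y y' by (simp_all add: cyl_def)
          ultimately have "agree (Suc k) y y'" using up'[of y y' "Suc k"] by simp
          moreover have "y k = v" "y' k = v'" using y(1) y'(1) by (simp_all add: cyl_def agree_Suc)
          ultimately show False using \<open>v \<noteq> v'\<close> by (simp add: agree_Suc)
        qed
      qed
    qed simp
    then show ?thesis using * by simp
  qed
  \<comment> \<open>One of the \<open>q\<close> extensions is at least average.\<close>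
  have nondec: "\<exists>v<q. J k x * q' ^ (m (Suc k) - m k) \<le> J (Suc k) (x(k := v)) * q" if "x \<in>
      X" for k x
  proof (rule ccontr)
    assume "\<not> ?thesis"
    then have *: "J (Suc k) (x(k := v)) * q < J k x * q' ^ (m (Suc k) - m k)" if "v < q" for v
      using that by (meson not_le)
    have "(\<Sum>v<q. J (Suc k) (x(k := v)) * q) < (\<Sum>v<q. J k x * q' ^ (m (Suc k) - m k))"
      by (rule sum_strict_mono) (use * q in \<open>auto simp: lessThan_empty_iff\<close>)
    also have "\<dots> = (\<Sum>v<q. J (Suc k) (x(k := v))) * q" by (simp add: J_sum[OF that])
    finally show False by (simp add: sum_distrib_right)
  qed
  define nx where "nx k x = (SOME v. v < q \<and>
      J k x * q' ^ (m (Suc k) - m k) \<le> J (Suc k) (x(k := v)) * q)" for k x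
  have nx: "nx k x < q \<and> J k x * q' ^ (m (Suc k) - m k) \<le> J (Suc k) (x(k := nx k x)) * q"
    if "x \<in> X" for k x
    unfolding nx_def by (rule someI_ex) (rule nondec[OF that])
  define path where "path = rec_nat (\<lambda>_. 0) (\<lambda>k x. x(k := nx k x))"
  have path_S: "path (Suc k) = (path k)(k := nx k (path k))" for k by (simp add: path_def)
  have pathX: "path k \<in> X" for k
  proof (induction k)
    case 0
    then show ?case using q by (auto simp: path_def X_def intro!: seqsI)
  next
    case (Suc k)
    then show ?case unfolding path_S using upd nx by blast
  qed
  define L where "L k = J k (path k)" for k
  have L: "1 \<le> L k" "L k \<le> Jmax" for k using J_bounds[OF pathX] by (auto simp: L_def)
  have L_step: "L k * q' ^ (m (Suc k) - m k) \<le> L (Suc k) * q" for k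
    using nx[OF pathX] unfolding L_def path_S by blast
  define g where "g k = real (L k) * real q ^ k / real q' ^ m k" for k
  have gpos: "g k > 0" for k unfolding g_def using L(1)[of k] q by (intro divide_pos_pos mult_pos_pos) auto
  have ratio: "g (Suc k) / g k = real (L (Suc k)) / real (L k) * real q / real q' ^ (m (Suc k) - m k)" for k
  proof -
    have "real q' ^ m (Suc k) = real q' ^ m k * real q' ^ (m (Suc k) - m k)"
      using m_mono[of k] by (simp flip: power_add)
    then show ?thesis unfolding g_def using q L(1)[of k] by (simp add: field_simps)
  qed
  have one: "1 \<le> g (Suc k) / g k" for k
  proof -
    have "real (L k) * real q' ^ (m (Suc k) - m k) \<le> real (L (Suc k)) * real q"
      using L_step[of k] by (metis of_nat_le_iff of_nat_mult of_nat_power)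
    then show ?thesis unfolding ratio using L(1)[of k] q by (simp add: field_simps)
  qed
  have "g k \<le> g (Suc k)" for k using one[of k] gpos[of k] by (simp add: pos_le_divide_eq)
  then have "incseq g" by (rule incseq_SucI)
  \<comment> \<open>The first \<open>m k\<close> letters of the image determine the first
    \<open>k\<close> letters of the point. The resulting comparison of numbers of words is what
    bounds \<open>g\<close>.\<close>
  have qm: "q ^ k \<le> q' ^ m k" for k
  proof -
    let ?\<phi> = "\<lambda>w. trunc k (SOME x. x \<in> X \<and> trunc (m k) (f x) = w)"
    have "trunc k x = ?\<phi> (trunc (m k) (f x))" if "x \<in> X" for x
    proof -
      let ?P = "\<lambda>y. y \<in> X \<and> trunc (m k) (f y) = trunc (m k) (f x)"
      have "?P (SOME y. ?P y)" by (rule someI[of ?P x]) (use that in simp)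
      then show ?thesis using up'[OF that, of "SOME y. ?P y" k] by (simp add: trunc_eq_iff agree_sym)
    qed
    moreover have "f ` X = Y" using bij by (simp add: bij_betw_def X_def Y_def)
    ultimately have "trunc k ` X \<subseteq> ?\<phi> ` trunc (m k) ` Y" by (auto intro!: image_eqI)
    moreover have fin: "finite (trunc (m k) ` Y) \<and> card (trunc (m k) ` Y) = card (trunc 0 ` Y) * q' ^ m k"
      using card_trunc_saturated[of Y q' 0 "m k"] by (simp add: Y_def)
    ultimately have "card (trunc k ` X) \<le> card (trunc (m k) ` Y)"
      by (intro surj_card_le) simp_all
    moreover have "card (trunc k ` X) = card (trunc 0 ` X) * q ^ k"
      using card_trunc_saturated[of X q 0 k] by (simp add: X_def)
    moreover have "trunc 0 ` X = {\<lambda>_. 0}" "trunc 0 ` Y = {\<lambda>_. 0}"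
      using pathX fX by (auto simp: trunc_def)
    ultimately show ?thesis using fin by simp
  qed
  have "g k \<le> real Jmax" for k
  proof -
    have "real q ^ k / real q' ^ m k \<le> 1" using qm[of k] q by (simp add: divide_le_eq flip: of_nat_power)
    then have "real (L k) * (real q ^ k / real q' ^ m k) \<le> real Jmax * 1"
      using L(2)[of k] by (intro mult_mono) auto
    then show ?thesis by (simp add: g_def)
  qed
  then obtain l where l: "g \<longlonglongrightarrow> l" using incseq_convergent[OF \<open>incseq
      g\<close>] by metis
  have "g 0 \<le> l" using incseq_le[OF \<open>incseq g\<close> l] .
  then have "l > 0" using gpos[of 0] by simp
  then have lim1: "(\<lambda>k. g (Suc k) / g k) \<longlonglongrightarrow> 1"
    using tendsto_divide[OF LIMSEQ_Suc[OF l] l] by simp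
  define e where "e = nat \<lceil>t + 1\<rceil>"
  \<comment> \<open>\<open>L\<close> is bounded and \<open>m\<close> grows by at most
    \<open>e\<close> per step, so the quotients of \<open>g\<close> take finitely many values;
    \<open>F\<close> collects those different from 1. As the quotients converge to 1, they are
    eventually equal to 1.\<close>
  define F where "F = (\<lambda>(a, b, d). real a / real b * real q / real q' ^ d) ` ({..Jmax} \<times>
      {..Jmax} \<times> {..e}) - {1}"
  have "m (Suc k) - m k \<le> e" for k
    using m(2)[of "Suc k"] m(1)[of k] m_mono[of k] unfolding e_def by (simp add: algebra_simps) linarith
  then have inF: "g (Suc k) / g k \<in> insert 1 F" for k
    unfolding ratio F_def using L(2)[of k] L(2)[of "Suc k"]
    by (auto simp: image_iff intro!: bexI[of _ "(L (Suc k), L k, m (Suc k) - m k)"])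
  have "finite F" unfolding F_def by auto
  then have "open (- F)" by (intro open_Compl finite_imp_closed)
  moreover have "1 \<in> - F" by (simp add: F_def)
  ultimately have "\<forall>\<^sub>F k in sequentially. g (Suc k) / g k \<in> - F"
    using topological_tendstoD[OF lim1] by blast
  then obtain k0 where k0: "\<And>k. k \<ge> k0 \<Longrightarrow> g (Suc k) / g k \<notin> F"
    unfolding eventually_sequentially by auto
  have "g (Suc k) = g k" if "k \<ge> k0" for k
    using inF[of k] k0[OF that] gpos[of k] by simp
  then have const: "g (k0 + i) = g k0" for i by (induction i) auto
  \<comment> \<open>\<open>L\<close> takes values in \<open>{1..Jmax}\<close> and is sampled at
    \<open>Jmax + 1\<close> indices. While \<open>g\<close> is constant, a repetition of
    \<open>L\<close> becomes an equation between powers.\<close>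
  have "\<not> inj_on (\<lambda>i. L (k0 + i)) {..Jmax}"
  proof
    assume "inj_on (\<lambda>i. L (k0 + i)) {..Jmax}"
    then have "card {..Jmax} \<le> card {1..Jmax}"
      by (rule card_inj_on_le) (use L in auto)
    then show False by simp
  qed
  then obtain i j where ij: "i < j" "L (k0 + i) = L (k0 + j)"
    unfolding inj_on_def by (metis nat_neq_iff)
  define k where "k = k0 + i"
  define k' where "k' = k0 + j"
  have kk: "k < k'" "L k = L k'" "g k = g k'" using ij const by (auto simp: k_def k'_def)
  have "m k \<le> m k'" using lift_Suc_mono_le[of m k k'] m_mono kk by simp
  have "real q ^ k / real q' ^ m k = real q ^ k' / real q' ^ m k'"
  proof -
    have "real (L k') * (real q ^ k / real q' ^ m k) = real (L k') * (real q ^ k' / real q' ^ m k')"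
      using kk(3) unfolding g_def kk(2) by simp
    then show ?thesis using L(1)[of k'] by (simp only: mult_cancel_left) simp
  qed
  moreover have "real q ^ k' = real q ^ k * real q ^ (k' - k)" "real q' ^ m k' = real q' ^ m k * real q' ^
      (m k' - m k)"
    using kk \<open>m k \<le> m k'\<close> by (simp_all flip: power_add)
  ultimately have "real q ^ (k' - k) = real q' ^ (m k' - m k)"
    using q by (simp add: field_simps)
  then have eq: "q ^ (k' - k) = q' ^ (m k' - m k)"
    by (metis of_nat_eq_iff of_nat_power)
  moreover have "k' - k \<ge> 1" using kk by simp
  moreover have "m k' - m k \<ge> 1"
  proof (rule ccontr)
    assume "\<not> ?thesis"
    then have "q ^ (k' - k) = 1" using eq by simp
    then show False using q kk by simp
  qed
  ultimately show ?thesis by blast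
qed

section \<open>Metric spaces coded by sequences, and Hoelder maps between them\<close>

text \<open>For \<open>b > 1\<close>, \<open>X\<close> is bi-Lipschitz equivalent to
  \<open>seqs q q\<close> with the ultrametric \<open>1 / b ^ j\<close>, where \<open>j\<close> is
  the length of the common prefix. The two implications express this without defining that
  metric.\<close>

definition coded :: "'a::metric_space set \<Rightarrow> nat \<Rightarrow> real \<Rightarrow> bool" where
  "coded X q b \<longleftrightarrow> (\<exists>f C. C \<ge> 1 \<and> bij_betw f X (seqs q q) \<and>
     (\<forall>x\<in>X. \<forall>y\<in>X. \<forall>j. (agree j (f x) (f y) \<longrightarrow> dist x y \<le>
         C / b ^ j) \<and>
        (dist x y < 1 / (C * b ^ j) \<longrightarrow> agree j (f x) (f y))))"

lemma first_disagreement: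
  assumes "x \<noteq> y"
  shows "\<exists>j. agree j x y \<and> \<not> agree (Suc j) x y"
proof -
  obtain i where i: "x i \<noteq> y i" using assms by blast
  define j where "j = (LEAST i. x i \<noteq> y i)"
  have "x j \<noteq> y j" unfolding j_def by (rule LeastI[of _ i]) (rule i)
  moreover have "x l = y l" if "l < j" for l using not_less_Least[of l "\<lambda>i. x i \<noteq> y i"] that
      by (auto simp: j_def)
  ultimately show ?thesis by (auto simp: agree_def)
qed

lemma powr_power_swap: "b > 0 \<Longrightarrow> (b ^ j) powr s = (b powr s) ^ j" for b :: real
  by (simp add: powr_powr mult.commute flip: powr_realpow)

text \<open>The codings have the same alphabet and can be composed; the exponent \<open>s\<close> is
  determined by \<open>b powr s = b'\<close>.\<close>

lemma coded_imp_Hoelder_equivalent: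
  fixes X :: "'a::metric_space set" and Y :: "'b::metric_space set"
  assumes X: "coded X q b" and Y: "coded Y q b'" and b: "b > 1" "b' > 1"
  shows "strictly_Hoelder_equivalent X Y"
proof -
  obtain f C where f: "C \<ge> 1" "bij_betw f X (seqs q q)"
    "\<And>x y j. \<lbrakk>x \<in> X; y \<in> X; agree j (f x) (f y)\<rbrakk> \<Longrightarrow> dist x y
        \<le> C / b ^ j"
    "\<And>x y j. \<lbrakk>x \<in> X; y \<in> X; dist x y < 1 / (C * b ^ j)\<rbrakk> \<Longrightarrow>
        agree j (f x) (f y)"
    using X unfolding coded_def by blast
  obtain f' C' where f': "C' \<ge> 1" "bij_betw f' Y (seqs q q)"
    "\<And>x y j. \<lbrakk>x \<in> Y; y \<in> Y; agree j (f' x) (f' y)\<rbrakk> \<Longrightarrow> dist x y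
        \<le> C' / b' ^ j"
    "\<And>x y j. \<lbrakk>x \<in> Y; y \<in> Y; dist x y < 1 / (C' * b' ^ j)\<rbrakk> \<Longrightarrow>
        agree j (f' x) (f' y)"
    using Y unfolding coded_def by blast
  define h where "h = inv_into Y f' \<circ> f"
  have h: "bij_betw h X Y" unfolding h_def by (rule bij_betw_trans[OF f(2) bij_betw_inv_into[OF f'(2)]])
  have hY: "h x \<in> Y" if "x \<in> X" for x using h that by (auto dest: bij_betwE)
  have f'h: "f' (h x) = f x" if "x \<in> X" for x
    using bij_betw_inv_into_right[OF f'(2)] f(2) that by (auto simp: h_def dest: bij_betwE)
  define s where "s = ln b' / ln b"
  have s: "s > 0" "b powr s = b'" using b by (auto simp: s_def powr_def)
  \<comment> \<open>The factor \<open>b'\<close> pays for the one letter between the last agreement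
    and the first disagreement.\<close>
  define K where "K = C' * C powr s * b'"
  have Cs: "C powr s \<ge> 1" using f(1) s(1) by (simp add: ge_one_powr_ge_zero)
  have K: "K > 0" unfolding K_def using f'(1) Cs b by (intro mult_pos_pos) auto
  have "inverse K * dist x y powr s \<le> dist (h x) (h y) \<and> dist (h x) (h y) \<le> K * dist x y powr s"
    if xy: "x \<in> X" "y \<in> X" for x y
  proof (cases "x = y")
    case False
    then have "f x \<noteq> f y" using f(2) xy by (auto simp: bij_betw_def inj_on_def)
    then obtain j where j: "agree j (f x) (f y)" "\<not> agree (Suc j) (f x) (f y)"
      using first_disagreement by blast
    have 1: "dist x y \<le> C / b ^ j" by (rule f(3)[OF xy j(1)])
    have 2: "1 / (C * b ^ Suc j) \<le> dist x y" using f(4)[OF xy] j(2) by (meson not_le)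
    have 3: "dist (h x) (h y) \<le> C' / b' ^ j" using f'(3)[OF hY hY] f'h j(1) xy by simp
    have 4: "1 / (C' * b' ^ Suc j) \<le> dist (h x) (h y)"
    proof (rule ccontr)
      assume "\<not> ?thesis"
      then have "agree (Suc j) (f' (h x)) (f' (h y))" using f'(4)[OF hY hY] xy by simp
      then show False using j(2) f'h xy by simp
    qed
    have bj: "b ^ i > 0" "b' ^ i > 0" for i using b by auto
    have "dist x y powr s \<le> (C / b ^ j) powr s" using 1 s by (intro powr_mono2) auto
    also have "\<dots> = C powr s / b' ^ j" using f(1) b s by (simp add: powr_divide powr_power_swap)
    finally have u: "dist x y powr s \<le> C powr s / b' ^ j" .
    have "1 / (C powr s * b' ^ Suc j) = (1 / (C * b ^ Suc j)) powr s"
      using f(1) b s bj[of "Suc j"] by (simp add: powr_divide powr_mult powr_power_swap del: power_Suc)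
    also have "\<dots> \<le> dist x y powr s" using 2 f(1) bj[of "Suc j"] s by (intro powr_mono2) auto
    finally have l: "1 / (C powr s * b' ^ Suc j) \<le> dist x y powr s" .
    have "inverse K * dist x y powr s \<le> inverse K * (C powr s / b' ^ j)"
      using u K by (intro mult_left_mono) auto
    also have "\<dots> = 1 / (C' * b' ^ Suc j)"
      using Cs f(1) f'(1) b by (simp add: K_def field_simps)
    finally have lower: "inverse K * dist x y powr s \<le> dist (h x) (h y)" using 4 by simp
    have "C' / b' ^ j = K * (1 / (C powr s * b' ^ Suc j))"
      using Cs f(1) b by (simp add: K_def field_simps)
    also have "\<dots> \<le> K * dist x y powr s" using l K by (intro mult_left_mono) auto
    finally have "dist (h x) (h y) \<le> K * dist x y powr s" using 3 by simp
    then show ?thesis using lower by blast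
  qed simp
  then show ?thesis unfolding strictly_Hoelder_equivalent_def using h s K by blast
qed

text \<open>In terms of words, a Hoelder equivalence multiplies the lengths of common prefixes by
  \<open>t = s * ln b / ln b'\<close>, up to an additive error \<open>c\<close>.\<close>

lemma Hoelder_equivalent_imp_power_relation:
  fixes X :: "'a::metric_space set" and Y :: "'b::metric_space set"
  assumes X: "coded X q b" and Y: "coded Y q' b'" and b: "b > 1" "b' > 1" and q: "q \<ge> 2" "q' \<ge> 2"
    and H: "strictly_Hoelder_equivalent X Y"
  shows "\<exists>k l. k \<ge> 1 \<and> l \<ge> 1 \<and> q ^ k = q' ^ l"
proof -
  obtain f C where f: "C \<ge> 1" "bij_betw f X (seqs q q)"
    "\<And>x y j. \<lbrakk>x \<in> X; y \<in> X; agree j (f x) (f y)\<rbrakk> \<Longrightarrow> dist x y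
        \<le> C / b ^ j"
    "\<And>x y j. \<lbrakk>x \<in> X; y \<in> X; dist x y < 1 / (C * b ^ j)\<rbrakk> \<Longrightarrow>
        agree j (f x) (f y)"
    using X unfolding coded_def by blast
  obtain f' C' where f': "C' \<ge> 1" "bij_betw f' Y (seqs q' q')"
    "\<And>x y j. \<lbrakk>x \<in> Y; y \<in> Y; agree j (f' x) (f' y)\<rbrakk> \<Longrightarrow> dist x y
        \<le> C' / b' ^ j"
    "\<And>x y j. \<lbrakk>x \<in> Y; y \<in> Y; dist x y < 1 / (C' * b' ^ j)\<rbrakk> \<Longrightarrow>
        agree j (f' x) (f' y)"
    using Y unfolding coded_def by blast
  obtain \<phi> s K where \<phi>: "bij_betw \<phi> X Y" "s > 0" "K > 0"
    "\<And>x y. \<lbrakk>x \<in> X; y \<in> X\<rbrakk> \<Longrightarrow> inverse K * dist x y powr s \<le>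
        dist (\<phi> x) (\<phi> y)"
    "\<And>x y. \<lbrakk>x \<in> X; y \<in> X\<rbrakk> \<Longrightarrow> dist (\<phi> x) (\<phi> y) \<le> K
        * dist x y powr s"
    using H unfolding strictly_Hoelder_equivalent_def by blast
  let ?i = "inv_into X f"
  define F where "F = f' \<circ> \<phi> \<circ> ?i"
  have bij: "bij_betw F (seqs q q) (seqs q' q')"
    unfolding F_def by (rule bij_betw_trans[OF bij_betw_inv_into[OF f(2)] bij_betw_trans[OF \<phi>(1) f'(2)]])
  have iX: "?i u \<in> X" "f (?i u) = u" if "u \<in> seqs q q" for u
    using that bij_betw_inv_into_right[OF f(2)] bij_betw_inv_into[OF f(2)] by (auto dest: bij_betwE)
  have \<phi>Y: "\<phi> x \<in> Y" if "x \<in> X" for x using \<phi>(1) that by (auto dest: bij_betwE)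
  define t where "t = s * ln b / ln b'"
  have t: "t > 0" using \<phi>(2) b by (simp add: t_def)
  have bt: "(b ^ j) powr s = b' powr (t * real j)" for j
    using b by (simp add: t_def powr_def ln_realpow)
  define W where "W = K * C powr s * C'"
  have Cs: "C powr s \<ge> 1" using f(1) \<phi>(2) by (simp add: ge_one_powr_ge_zero)
  have W: "W > 0" unfolding W_def using \<phi>(3) Cs f'(1) by (intro mult_pos_pos) auto
  \<comment> \<open>\<open>c\<close> converts the multiplicative constant \<open>W\<close> into a
    shift of levels. The summand 1 makes \<open>W < b' powr c\<close> strict, as required by the
    strict inequality in \<open>coded\<close>.\<close>
  define c where "c = max 0 (ln W / ln b' + 1)"
  have c: "c \<ge> 0" "W < b' powr c"
  proof -
    have "ln W < c * ln b'"
    proof -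
      have "ln W / ln b' < c" by (simp add: c_def)
      then show ?thesis using b by (simp add: divide_less_eq)
    qed
    then have "exp (ln W) < exp (c * ln b')" by (rule exp_less_mono)
    then show "W < b' powr c" using W b by (simp add: powr_def)
  qed (simp add: c_def)
  show ?thesis
  proof (rule power_relation[OF q t c(1) bij])
    fix u v i j assume uv: "u \<in> seqs q q" "v \<in> seqs q q" and ij: "real i + c \<le> t * real j" and
        ag: "agree j u v"
    let ?x = "?i u" and ?y = "?i v"
    have xy: "?x \<in> X" "?y \<in> X" "f ?x = u" "f ?y = v" using iX uv by auto
    have "dist (\<phi> ?x) (\<phi> ?y) \<le> K * dist ?x ?y powr s" by (rule \<phi>(5)[OF xy(1,2)])
    also have "\<dots> \<le> K * (C / b ^ j) powr s"
      using f(3)[OF xy(1,2), of j] xy ag \<phi>(2,3) by (intro mult_left_mono powr_mono2) auto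
    also have "\<dots> = K * C powr s / b' powr (t * real j)"
      using f(1) b by (simp add: powr_divide bt)
    also have "\<dots> \<le> K * C powr s / b' powr (real i + c)"
      using ij b \<phi>(3) Cs by (intro divide_left_mono powr_mono mult_nonneg_nonneg mult_pos_pos) auto
    also have "\<dots> = W / b' powr c / (C' * b' ^ i)"
      using b f'(1) by (simp add: powr_add powr_realpow W_def field_simps)
    also have "\<dots> < 1 / (C' * b' ^ i)"
      using c(2) b f'(1) by (intro divide_strict_right_mono) auto
    finally have "agree i (f' (\<phi> ?x)) (f' (\<phi> ?y))" using f'(4) \<phi>Y xy by blast
    then show "agree i (F u) (F v)" by (simp add: F_def)
  next
    fix u v i j assume uv: "u \<in> seqs q q" "v \<in> seqs q q" and ij: "t * real j + c \<le> real i" and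
        ag: "agree i (F u) (F v)"
    let ?x = "?i u" and ?y = "?i v"
    have xy: "?x \<in> X" "?y \<in> X" "f ?x = u" "f ?y = v" using iX uv by auto
    have "dist (\<phi> ?x) (\<phi> ?y) \<le> C' / b' ^ i"
      using f'(3)[OF \<phi>Y \<phi>Y] xy ag by (simp add: F_def)
    moreover have "dist ?x ?y powr s \<le> K * dist (\<phi> ?x) (\<phi> ?y)"
      using \<phi>(4)[OF xy(1,2)] \<phi>(3) by (simp add: field_simps)
    ultimately have "dist ?x ?y powr s \<le> K * (C' / b' ^ i)"
      using \<phi>(3) by (meson mult_left_mono order_trans less_imp_le)
    also have "\<dots> = K * C' / b' powr real i" using b by (simp add: powr_realpow)
    also have "\<dots> \<le> K * C' / b' powr (t * real j + c)"
      using ij b \<phi>(3) f'(1) by (intro divide_left_mono powr_mono mult_nonneg_nonneg mult_pos_pos) auto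
    also have "\<dots> = W / b' powr c / (C powr s * (b ^ j) powr s)"
      unfolding bt using b Cs f(1) by (simp add: powr_add W_def field_simps)
    also have "\<dots> < 1 / (C powr s * (b ^ j) powr s)"
      using c(2) b f(1) by (intro divide_strict_right_mono mult_pos_pos) auto
    also have "\<dots> = (1 / (C * b ^ j)) powr s"
      using b f(1) by (simp add: powr_divide powr_mult)
    finally have "dist ?x ?y powr s < (1 / (C * b ^ j)) powr s" .
    moreover have "(1 / (C * b ^ j)) powr s \<le> dist ?x ?y powr s" if "1 / (C * b ^ j) \<le> dist ?x ?y"
      using that \<phi>(2) f(1) b by (intro powr_mono2) auto
    ultimately have "dist ?x ?y < 1 / (C * b ^ j)" by (meson not_le)
    then show "agree j u v" using f(4)[OF xy(1,2)] xy by simp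
  qed
qed

lemma ln_ratio_rational_iff:
  assumes "N \<ge> 2" "N' \<ge> (2::nat)"
  shows "ln (real N) / ln (real N') \<in> \<rat> \<longleftrightarrow> (\<exists>k l. k \<ge> 1 \<and> l
      \<ge> 1 \<and> N ^ k = N' ^ l)"
proof
  assume rat: "ln (real N) / ln (real N') \<in> \<rat>"
  have pos: "ln (real N) > 0" "ln (real N') > 0" using assms by auto
  obtain m k :: nat where mk: "k \<noteq> 0" "\<bar>ln (real N) / ln (real N')\<bar> = real m / real k"
    using Rats_abs_nat_div_natE[OF rat] by metis
  then have eq: "ln (real N) / ln (real N') = real m / real k" using pos by simp
  then have "m \<noteq> 0" using pos by (metis divide_eq_0_iff less_irrefl of_nat_0)
  have "real k * ln (real N) = real m * ln (real N')" using eq pos mk(1) by (simp add: field_simps)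
  then have "ln (real N ^ k) = ln (real N' ^ m)" using assms by (simp add: ln_realpow)
  then have "real N ^ k = real N' ^ m" using assms by (subst (asm) ln_inj_iff) auto
  then have "N ^ k = N' ^ m" by (metis of_nat_eq_iff of_nat_power)
  then show "\<exists>k l. k \<ge> 1 \<and> l \<ge> 1 \<and> N ^ k = N' ^ l" using mk(1) \<open>m \<noteq>
      0\<close> by (metis One_nat_def Suc_leI neq0_conv)
next
  assume "\<exists>k l. k \<ge> 1 \<and> l \<ge> 1 \<and> N ^ k = N' ^ l"
  then obtain k l where kl: "k \<ge> 1" "l \<ge> 1" "N ^ k = N' ^ l" by blast
  have "real N ^ k = real N' ^ l" using kl(3) by (metis of_nat_power)
  then have "ln (real N ^ k) = ln (real N' ^ l)" by simp
  then have "real k * ln (real N) = real l * ln (real N')" using assms by (simp add: ln_realpow)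
  then have "ln (real N) / ln (real N') = real l / real k" using assms kl by (simp add: field_simps)
  then show "ln (real N) / ln (real N') \<in> \<rat>" by simp
qed

section \<open>Chains with short steps stay short, also in finite unions\<close>

section \<open>Chains in totally disconnected compact sets\<close>

definition chain_rel :: "real \<Rightarrow> 'a::metric_space set \<Rightarrow> ('a \<times> 'a) set" where
  "chain_rel \<delta> X = {(x, y). x \<in> X \<and> y \<in> X \<and> dist x y < \<delta>}"

text \<open>For compact sets, a uniform form of total disconnectedness. Unlike the latter, it passes
  to finite unions by elementary estimates.\<close>

definition chain_thin :: "'a::metric_space set \<Rightarrow> bool" where
  "chain_thin X \<longleftrightarrow> (\<forall>\<eta>>0. \<exists>\<delta>>0. \<forall>x y. (x, y) \<in>
      (chain_rel \<delta> X)\<^sup>* \<longrightarrow> dist x y \<le> \<eta>)"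

lemma chain_thin_empty: "chain_thin {}"
proof -
  have "chain_rel \<delta> ({} :: 'a set) = {}" for \<delta> by (simp add: chain_rel_def)
  then show ?thesis unfolding chain_thin_def by (auto intro: exI[of _ 1])
qed

text \<open>With a step size far below the one suitable for \<open>A\<close>, a chain in \<open>A \<union>
    B\<close> makes only short
  excursions into \<open>B\<close>, so that its points in \<open>A\<close> form a chain in
      \<open>A\<close>.\<close>

lemma chain_thin_Un:
  fixes A B :: "'a::metric_space set"
  assumes "chain_thin A" "chain_thin B"
  shows "chain_thin (A \<union> B)"
  unfolding chain_thin_def
proof (intro allI impI)
  fix \<eta> :: real assume \<eta>: "\<eta> > 0"
  obtain \<delta>A where \<delta>A: "\<delta>A > 0" "\<And>x y. (x, y) \<in> (chain_rel \<delta>A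
      A)\<^sup>* \<Longrightarrow> dist x y \<le> \<eta> / 4"
    using assms(1) \<eta> unfolding chain_thin_def by (meson divide_pos_pos zero_less_numeral)
  \<comment> \<open>A bound for one excursion into \<open>B\<close>: points of \<open>A\<close>
    before and after it are then less than \<open>\<delta>A\<close> apart, and the excursions at
    both ends together with the chain in \<open>A\<close> stay below \<eta>.\<close>
  define \<epsilon> where "\<epsilon> = min (\<eta> / 8) (\<delta>A / 4)"
  have \<epsilon>: "\<epsilon> > 0" "\<epsilon> \<le> \<eta> / 8" "\<epsilon> \<le> \<delta>A / 4" using
      \<eta> \<delta>A(1) by (auto simp: \<epsilon>_def)
  obtain \<delta>B where \<delta>B: "\<delta>B > 0" "\<And>x y. (x, y) \<in> (chain_rel \<delta>B
      B)\<^sup>* \<Longrightarrow> dist x y \<le> \<epsilon>"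
    using assms(2) \<epsilon>(1) unfolding chain_thin_def by meson
  define \<delta> where "\<delta> = min \<delta>B \<epsilon>"
  have \<delta>: "\<delta> > 0" "\<delta> \<le> \<delta>B" "\<delta> \<le> \<epsilon>" using \<delta>B(1)
      \<epsilon>(1) by (auto simp: \<delta>_def)
  let ?RA = "(chain_rel \<delta>A A)\<^sup>*" and ?RB = "(chain_rel \<delta>B B)\<^sup>*"
  \<comment> \<open>Read \<open>a\<close> as the last point of \<open>A\<close> that the chain has
    visited and \<open>y\<close> as its current point.\<close>
  define near where "near a y \<longleftrightarrow> y = a \<or> (\<exists>b. dist a b < \<delta> \<and> (b,
      y) \<in> ?RB)" for a y
  have near_dist: "dist a y \<le> \<delta> + \<epsilon>" if "near a y" for a y
    using that unfolding near_def
  proof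
    assume "\<exists>b. dist a b < \<delta> \<and> (b, y) \<in> ?RB"
    then obtain b where "dist a b < \<delta>" "(b, y) \<in> ?RB" by blast
    then show ?thesis using \<delta>B(2)[of b y] dist_triangle[of a y b] by linarith
  qed (use \<delta>(1) \<epsilon>(1) in simp)
  have stepA: "(a, z) \<in> chain_rel \<delta>A A" if "near a y" "dist y z < \<delta>" "a \<in> A" "z \<in>
      A" for a y z
  proof -
    have "dist a z < \<delta>A"
      using near_dist[OF that(1)] that(2) dist_triangle[of a z y] \<delta> \<epsilon> \<delta>A(1) by linarith
    then show ?thesis using that by (simp add: chain_rel_def)
  qed
  have stepA0: "(a, y) \<in> chain_rel \<delta>A A" if "near a y" "a \<in> A" "y \<in> A" for a y
    using stepA[OF that(1) _ that(2,3)] \<delta>(1) by simp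
  \<comment> \<open>Either the chain is so far a (possibly trivial) chain in \<open>B\<close>, or
    its trace in \<open>A\<close> is a \<open>\<delta>A\<close>-chain from \<open>a0\<close> to
    \<open>a1\<close>.\<close>
  have inv: "(x, y) \<in> ?RB \<or> (\<exists>a0 a1. dist x a0 \<le> \<epsilon> + \<delta> \<and> a1 \<in>
      A \<and> (a0, a1) \<in> ?RA \<and> near a1 y)"
    if "(x, y) \<in> (chain_rel \<delta> (A \<union> B))\<^sup>*" for x y
    using that
  proof (induction rule: rtrancl_induct)
    case base
    then show ?case by blast
  next
    case (step y z)
    have yz: "y \<in> A \<union> B" "z \<in> A \<union> B" "dist y z < \<delta>" using step.hyps(2) by
        (auto simp: chain_rel_def)
    from step.IH show ?case
    proof
      assume xy: "(x, y) \<in> ?RB"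
      have dxy: "dist x y \<le> \<epsilon>" by (rule \<delta>B(2)[OF xy])
      consider "z \<in> A" | "z \<in> B" "y \<in> B" | "z \<in> B" "y \<in> A" using yz by blast
      then show ?case
      proof cases
        case 1
        have "dist x z \<le> \<epsilon> + \<delta>" using dxy yz(3) dist_triangle[of x z y] by linarith
        then show ?thesis using 1 near_def by blast
      next
        case 2
        then have "(y, z) \<in> chain_rel \<delta>B B" using yz \<delta>(2) by (simp add: chain_rel_def)
        then show ?thesis using xy by (meson rtrancl.rtrancl_into_rtrancl)
      next
        case 3
        have "near y z" using yz(3) unfolding near_def by blast
        moreover have "dist x y \<le> \<epsilon> + \<delta>" using dxy \<delta>(1) by simp
        ultimately show ?thesis using 3 by blast
      qed
    next
      assume "\<exists>a0 a1. dist x a0 \<le> \<epsilon> + \<delta> \<and> a1 \<in> A \<and> (a0, a1) \<in>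
          ?RA \<and> near a1 y"
      then obtain a0 a1 where a: "dist x a0 \<le> \<epsilon> + \<delta>" "a1 \<in> A" "(a0, a1) \<in> ?RA"
          "near a1 y" by blast
      have ext: "\<exists>a2. a2 \<in> A \<and> (a0, a2) \<in> ?RA \<and> near a2 z"
      proof (cases "z \<in> A")
        case True
        then have "(a0, z) \<in> ?RA" using stepA[OF a(4) yz(3) a(2)] a(3) by (meson
            rtrancl.rtrancl_into_rtrancl)
        then show ?thesis using True near_def by blast
      next
        case zA: False
        then have zB: "z \<in> B" using yz by blast
        show ?thesis
        proof (cases "y \<in> A")
          case True
          then have "(a0, y) \<in> ?RA" using stepA0[OF a(4) a(2)] a(3) by (meson rtrancl.rtrancl_into_rtrancl)
          moreover have "near y z" using yz(3) unfolding near_def by blast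
          ultimately show ?thesis using True by blast
        next
          case False
          then have "(y, z) \<in> chain_rel \<delta>B B" using yz zB \<delta>(2) by (simp add: chain_rel_def)
          moreover have "y \<noteq> a1" using False a(2) by blast
          ultimately have "near a1 z"
            using a(4) unfolding near_def by (meson rtrancl.rtrancl_into_rtrancl)
          then show ?thesis using a by blast
        qed
      qed
      then show ?case using a(1) by blast
    qed
  qed
  have "dist x y \<le> \<eta>" if "(x, y) \<in> (chain_rel \<delta> (A \<union> B))\<^sup>*" for x y
    using inv[OF that]
  proof
    assume "(x, y) \<in> ?RB"
    then have "dist x y \<le> \<epsilon>" by (rule \<delta>B(2))
    then show ?thesis using \<epsilon> \<eta> by linarith
  next
    assume "\<exists>a0 a1. dist x a0 \<le> \<epsilon> + \<delta> \<and> a1 \<in> A \<and> (a0, a1) \<in>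
        ?RA \<and> near a1 y"
    then obtain a0 a1 where a: "dist x a0 \<le> \<epsilon> + \<delta>" "(a0, a1) \<in> ?RA" "near a1 y" by blast
    have "dist x y \<le> dist x a0 + dist a0 a1 + dist a1 y"
      using dist_triangle[of x y a0] dist_triangle[of a0 y a1] by linarith
    then show ?thesis using a(1) \<delta>A(2)[OF a(2)] near_dist[OF a(3)] \<epsilon> \<delta> by linarith
  qed
  then show "\<exists>\<delta>>0. \<forall>x y. (x, y) \<in> (chain_rel \<delta> (A \<union> B))\<^sup>*
      \<longrightarrow> dist x y \<le> \<eta>"
    using \<delta>(1) by blast
qed

lemma chain_thin_UN:
  assumes "finite I" "\<And>i. i \<in> I \<Longrightarrow> chain_thin (X i)"
  shows "chain_thin (\<Union>i\<in>I. X i)"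
  using assms by (induction I rule: finite_induct) (auto intro: chain_thin_Un chain_thin_empty)

lemma chain_thin_translation:
  fixes X :: "'a::real_normed_vector set"
  assumes "chain_thin X"
  shows "chain_thin ((+) a ` X)"
proof -
  have shift: "(x - a, y - a) \<in> (chain_rel \<delta> X)\<^sup>*" if "(x, y) \<in> (chain_rel \<delta>
      ((+) a ` X))\<^sup>*" for x y \<delta>
    using that
  proof (induction rule: rtrancl_induct)
    case (step y z)
    then have "(y - a, z - a) \<in> chain_rel \<delta> X" by (auto simp: chain_rel_def)
    then show ?case using step by (meson rtrancl.rtrancl_into_rtrancl)
  qed simp
  have dist: "dist (x - a) (y - a) = dist x y" for x y by (simp add: dist_norm)
  show ?thesis
    unfolding chain_thin_def
  proof (intro allI impI)
    fix \<eta> :: real assume "\<eta> > 0"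
    then obtain \<delta> where "\<delta> > 0" "\<forall>x y. (x, y) \<in> (chain_rel \<delta> X)\<^sup>*
        \<longrightarrow> dist x y \<le> \<eta>"
      using assms unfolding chain_thin_def by blast
    then show "\<exists>\<delta>>0. \<forall>x y. (x, y) \<in> (chain_rel \<delta> ((+) a ` X))\<^sup>*
        \<longrightarrow> dist x y \<le> \<eta>"
      using shift dist by metis
  qed
qed

text \<open>The Sura-Bura theorem provides small relatively clopen neighbourhoods, finitely many of
  which cover \<open>S\<close>. Each has a positive distance from its complement in
  \<open>S\<close>, so a chain with shorter steps never leaves the one in which it starts.\<close>

lemma chain_thin_compact_totally_disconnected:
  fixes S :: "'a::euclidean_space set"
  assumes S: "compact S" and td: "totally_disconnected S"
  shows "chain_thin S"
  unfolding chain_thin_def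
proof (intro allI impI)
  fix \<eta> :: real assume \<eta>: "\<eta> > 0"
  define P where "P x p \<longleftrightarrow> open (fst p) \<and> x \<in> fst p \<and> fst p \<inter> S
      \<subseteq> ball x (\<eta> / 2) \<and> snd p > 0 \<and>
      (\<forall>y\<in>fst p \<inter> S. \<forall>z\<in>S. dist y z < snd p \<longrightarrow> z \<in> fst
          p)" for x and p :: "'a set \<times> real"
  have "\<exists>p. P x p" if x: "x \<in> S" for x
  proof -
    have C: "{x} \<in> components S"
      using td x unfolding totally_disconnected_def components_def by blast
    obtain K where K: "openin (top_of_set S) K" "compact K" "{x} \<subseteq> K" "K \<subseteq> ball x
        (\<eta> / 2)"
      using Sura_Bura_clopen_subset[OF closed_imp_locally_compact[OF compact_imp_closed[OF S]] C, of "ball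
          x (\<eta> / 2)"] \<eta>
      by auto
    obtain V where V: "open V" "K = S \<inter> V" using K(1) by (auto simp: openin_open)
    have "S - K = S - V" using V(2) by blast
    then have "closed (S - K)" using V(1) S by (simp add: closed_Diff compact_imp_closed)
    then obtain \<delta> where \<delta>: "\<delta> > 0" "\<forall>y\<in>K. \<forall>z\<in>S - K. \<delta>
        \<le> dist y z"
      using separate_compact_closed[OF K(2), of "S - K"] by blast
    have "P x (V, \<delta>)" unfolding P_def fst_conv snd_conv
    proof (intro conjI ballI impI)
      fix y z assume yz: "y \<in> V \<inter> S" "z \<in> S" "dist y z < \<delta>"
      then have "y \<in> K" using V(2) by blast
      then show "z \<in> V" using \<delta>(2) yz V(2) by force
    qed (use K V \<delta> in auto)
    then show ?thesis by blast
  qed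
  moreover define p where "p x = (SOME p. P x p)" for x
  ultimately have p: "P x (p x)" if "x \<in> S" for x
    using that by (simp add: someI_ex)
  have op: "open (fst (p x))" "x \<in> fst (p x)" if "x \<in> S" for x
    using p[OF that] unfolding P_def by blast+
  have "S \<subseteq> (\<Union>x\<in>S. fst (p x))" using op(2) by blast
  from compactE_image[OF S op(1) this] obtain C where C: "C \<subseteq> S" "finite C" "S \<subseteq>
      (\<Union>x\<in>C. fst (p x))"
    by blast
  define \<delta> where "\<delta> = Min (insert 1 ((\<lambda>x. snd (p x)) ` C))"
  have \<delta>_le: "\<delta> \<le> snd (p c)" if "c \<in> C" for c
    unfolding \<delta>_def by (rule Min_le) (use C that in auto)
  have "\<delta> > 0" unfolding \<delta>_def using C p by (subst Min_gr_iff) (auto simp: P_def)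
  moreover have "dist x y \<le> \<eta>" if "(x, y) \<in> (chain_rel \<delta> S)\<^sup>*" for x y
  proof (cases "x \<in> S")
    case True
    then obtain c where c: "c \<in> C" "x \<in> fst (p c)" using C(3) by blast
    have Pc: "P c (p c)" using p C(1) c(1) by blast
    have "y \<in> fst (p c) \<inter> S" using that
    proof (induction rule: rtrancl_induct)
      case (step y z)
      then have "z \<in> S" "dist y z < snd (p c)" using \<delta>_le[OF c(1)] by (auto simp: chain_rel_def)
      then show ?case using Pc step.IH unfolding P_def by blast
    qed (use True c in simp)
    then have "dist c y < \<eta> / 2" "dist c x < \<eta> / 2" using Pc c True unfolding P_def by auto
    then show ?thesis using dist_triangle2[of x y c] by (simp add: dist_commute)
  next
    case False
    have "x = y" using that False
      by (induction rule: rtrancl_induct) (auto simp: chain_rel_def)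
    then show ?thesis using \<eta> by simp
  qed
  ultimately show "\<exists>\<delta>>0. \<forall>x y. (x, y) \<in> (chain_rel \<delta> S)\<^sup>*
      \<longrightarrow> dist x y \<le> \<eta>"
    by blast
qed

section \<open>Integer vectors with prescribed base \<open>n\<close> digits\<close>

section \<open>Digit expansions and their components\<close>

text \<open>An integer vector \<open>z\<close> stands for the cube
  \<open>(z + [0,1]^d) / n^k\<close> of level \<open>k\<close>. Division by \<open>n ^ m\<close>
  passes to the cube \<open>m\<close> levels up that contains it, and the remainder gives the
  position within that cube.\<close>

definition zdiv :: "nat \<Rightarrow> ('d \<Rightarrow> int) \<Rightarrow> 'd \<Rightarrow> int" where
    "zdiv m z = (\<lambda>i. z i div int m)"

definition zmod :: "nat \<Rightarrow> ('d \<Rightarrow> int) \<Rightarrow> 'd \<Rightarrow> int" where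
    "zmod m z = (\<lambda>i. z i mod int m)"

definition zcat :: "nat \<Rightarrow> ('d \<Rightarrow> int) \<Rightarrow> ('d \<Rightarrow> int)
    \<Rightarrow> 'd \<Rightarrow> int" where
  "zcat m u v = (\<lambda>i. int m * u i + v i)"

text \<open>The closed unit cubes with lower corners \<open>z\<close> and \<open>w\<close>
  meet.\<close>

definition adjacent :: "('d \<Rightarrow> int) \<Rightarrow> ('d \<Rightarrow> int) \<Rightarrow> bool" where
  "adjacent z w \<longleftrightarrow> (\<forall>i. \<bar>z i - w i\<bar> \<le> 1)"

definition rvec :: "('d::finite \<Rightarrow> int) \<Rightarrow> real ^ 'd" where
  "rvec z = (\<chi> i. real_of_int (z i))"

lemma zcat_zdiv_zmod: "zcat m (zdiv m z) (zmod m z) = z"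
  by (simp add: zcat_def zdiv_def zmod_def)

lemma zdiv_zcat: "(\<And>i. 0 \<le> v i \<and> v i < int m) \<Longrightarrow> zdiv m (zcat m u v) = u"
  unfolding zdiv_def zcat_def
proof
  fix i assume "\<And>i. 0 \<le> v i \<and> v i < int m"
  from this[of i] show "(int m * u i + v i) div int m = u i" by simp
qed

lemma zmod_zcat: "(\<And>i. 0 \<le> v i \<and> v i < int m) \<Longrightarrow> zmod m (zcat m u v) = v"
  unfolding zmod_def zcat_def
proof
  fix i assume "\<And>i. 0 \<le> v i \<and> v i < int m"
  from this[of i] show "(int m * u i + v i) mod int m = v i" by simp
qed

lemma zdiv_zdiv: "zdiv b (zdiv a z) = zdiv (a * b) z"
  by (simp add: zdiv_def fun_eq_iff zdiv_zmult2_eq)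

lemma adjacent_sym: "adjacent z w \<Longrightarrow> adjacent w z"
  by (simp add: adjacent_def abs_minus_commute)

lemma div_close:
  fixes a b m :: int
  assumes "m > 0" "\<bar>a - b\<bar> \<le> c * m"
  shows "\<bar>a div m - b div m\<bar> \<le> c"
proof -
  have "a div m \<le> b div m + c" if "a \<le> b + c * m" for a b
    using zdiv_mono1[OF that \<open>m > 0\<close>] \<open>m > 0\<close> by (simp add: div_mult_self1)
  then show ?thesis using assms(2) by (metis abs_diff_le_iff abs_le_iff add.commute diff_le_eq minus_diff_eq)
qed

lemma adjacent_zdiv: "m > 0 \<Longrightarrow> adjacent z w \<Longrightarrow> adjacent (zdiv m z) (zdiv m w)"
  unfolding adjacent_def zdiv_def
proof
  fix i assume "m > 0" and adj: "\<forall>i. \<bar>z i - w i\<bar> \<le> 1"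
  have "1 \<le> int m" using \<open>m > 0\<close> by simp
  then have "\<bar>z i - w i\<bar> \<le> 1 * int m" using adj[rule_format, of i] by linarith
  then show "\<bar>z i div int m - w i div int m\<bar> \<le> 1" by (rule div_close[rotated]) (use \<open>m
      > 0\<close> in simp)
qed

lemma adjacent_zcat: "adjacent (zcat m u v) (zcat m u w) \<longleftrightarrow> adjacent v w"
  by (simp add: adjacent_def zcat_def)

locale digits =
  fixes n :: nat and D :: "(nat ^ 'd) set"
  assumes n: "n \<ge> 2" and D: "digit_set n D" and D_ne: "D \<noteq> {}"
begin

definition digs :: "('d \<Rightarrow> int) set" where
  "digs = (\<lambda>d i. int (d $ i)) ` D"

primrec pts :: "nat \<Rightarrow> ('d \<Rightarrow> int) set" where
  "pts 0 = {\<lambda>_. 0}"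
| "pts (Suc k) = {z. zdiv n z \<in> pts k \<and> zmod n z \<in> digs}"

lemma finite_D: "finite D"
  using D by (rule finite_digit_set)

lemma digs_bounds: "z \<in> digs \<Longrightarrow> 0 \<le> z i \<and> z i < int n"
  using D by (auto simp: digs_def digit_set_def)

lemma pts_bounds: "z \<in> pts k \<Longrightarrow> 0 \<le> z i \<and> z i < int (n ^ k)"
proof (induction k arbitrary: z)
  case (Suc k)
  then have *: "0 \<le> z i div int n" "z i div int n < int (n ^ k)"
    by (auto simp: zdiv_def dest!: Suc.IH)
  obtain q r where qr: "q = z i div int n" "r = z i mod int n" by blast
  have "z i = int n * q + r" unfolding qr by simp
  moreover have "0 \<le> r" "r < int n" unfolding qr using n by simp_all
  moreover have "int n * q \<le> int n * (int (n ^ k) - 1)"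
    using * unfolding qr by (intro mult_left_mono) auto
  moreover have "0 \<le> int n * q" unfolding qr using * by simp
  ultimately show ?case by (simp add: algebra_simps)
qed simp

text \<open>A word splits into its first \<open>l\<close> and its last \<open>k\<close> digits. The
  self-similarity of all levels is contained in this equivalence.\<close>

lemma pts_add: "z \<in> pts (l + k) \<longleftrightarrow> zdiv (n ^ k) z \<in> pts l \<and> zmod (n ^ k) z
    \<in> pts k"
proof (induction k arbitrary: z)
  case 0
  have "zdiv 1 z = z" "zmod 1 z = (\<lambda>_. 0)" by (simp_all add: zdiv_def zmod_def)
  then show ?case by simp
next
  case (Suc k)
  have "zdiv (n ^ k) (zdiv n z) = zdiv (n ^ Suc k) z" by (simp add: zdiv_zdiv)
  moreover have "zmod (n ^ k) (zdiv n z) = zdiv n (zmod (n ^ Suc k) z)"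
    using n by (simp add: zmod_def zdiv_def fun_eq_iff zmod_zmult2_eq)
  moreover have "zmod n (zmod (n ^ Suc k) z) = zmod n z"
    by (simp add: zmod_def fun_eq_iff mod_mod_cancel)
  ultimately show ?case using Suc.IH[of "zdiv n z"] by auto
qed

lemma pts_zcat:
  assumes "u \<in> pts l" "v \<in> pts k"
  shows "zcat (n ^ k) u v \<in> pts (l + k)" "zdiv (n ^ k) (zcat (n ^ k) u v) = u"
    "zmod (n ^ k) (zcat (n ^ k) u v) = v"
proof -
  have v: "0 \<le> v i \<and> v i < int (n ^ k)" for i using pts_bounds[OF assms(2)] .
  show 1: "zdiv (n ^ k) (zcat (n ^ k) u v) = u" by (rule zdiv_zcat) (rule v)
  show 2: "zmod (n ^ k) (zcat (n ^ k) u v) = v" by (rule zmod_zcat) (rule v)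
  show "zcat (n ^ k) u v \<in> pts (l + k)" using assms 1 2 by (simp add: pts_add)
qed

lemma pts_1: "pts 1 = digs"
proof -
  have "z \<in> pts 1 \<longleftrightarrow> z \<in> digs" for z
  proof
    assume z: "z \<in> pts 1"
    then have "zmod n z = z"
      using pts_bounds[OF z] by (simp add: zmod_def fun_eq_iff)
    then show "z \<in> digs" using z by auto
  next
    assume z: "z \<in> digs"
    then have "zmod n z = z" "zdiv n z = (\<lambda>_. 0)"
      using digs_bounds[OF z] by (simp_all add: zmod_def zdiv_def fun_eq_iff)
    then show "z \<in> pts 1" using z by simp
  qed
  then show ?thesis by blast
qed

lemma bij_pts_above:
  assumes "A \<subseteq> pts l"
  shows "bij_betw (\<lambda>(u, v). zcat (n ^ k) u v) (A \<times> pts k) {z \<in> pts (l + k). zdiv (n ^ k)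
      z \<in> A}"
proof (rule bij_betw_byWitness[where f' = "\<lambda>z. (zdiv (n ^ k) z, zmod (n ^ k) z)"])
  show "\<forall>z\<in>{z \<in> pts (l + k). zdiv (n ^ k) z \<in> A}. (\<lambda>(u, v). zcat (n ^ k) u v)
      (zdiv (n ^ k) z, zmod (n ^ k) z) = z"
    by (simp add: zcat_zdiv_zmod)
  show "\<forall>p\<in>A \<times> pts k. (\<lambda>z. (zdiv (n ^ k) z, zmod (n ^ k) z)) ((\<lambda>(u, v).
      zcat (n ^ k) u v) p) = p"
    using assms by (auto simp: pts_zcat subset_iff)
  show "(\<lambda>(u, v). zcat (n ^ k) u v) ` (A \<times> pts k) \<subseteq> {z \<in> pts (l + k). zdiv (n
      ^ k) z \<in> A}"
    using assms by (auto simp: pts_zcat subset_iff)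
  show "(\<lambda>z. (zdiv (n ^ k) z, zmod (n ^ k) z)) ` {z \<in> pts (l + k). zdiv (n ^ k) z \<in> A}
      \<subseteq> A \<times> pts k"
    by (auto simp: pts_add)
qed

lemma card_pts: "finite (pts k) \<and> card (pts k) = card D ^ k"
proof (induction k)
  case (Suc k)
  have "inj_on (\<lambda>d i. int (d $ i)) D" by (auto simp: inj_on_def vec_eq_iff fun_eq_iff)
  then have digs: "card digs = card D" "finite digs" unfolding digs_def using finite_D by (auto simp:
      card_image)
  have "{z \<in> pts (k + 1). zdiv (n ^ 1) z \<in> pts k} = pts (Suc k)" by auto
  then have "bij_betw (\<lambda>(u, v). zcat (n ^ 1) u v) (pts k \<times> pts 1) (pts (Suc k))"
    using bij_pts_above[of "pts k" k 1] by simp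
  then show ?case using bij_betw_same_card bij_betw_finite Suc digs pts_1
    by (metis card_cartesian_product finite_cartesian_product power_Suc2)
qed simp

lemma finite_pts: "finite (pts k)"
  using card_pts by blast

lemma card_pts_above: "A \<subseteq> pts l \<Longrightarrow> card {z \<in> pts (l + k). zdiv (n ^ k) z
    \<in> A} = card A * card D ^ k"
  using bij_betw_same_card[OF bij_pts_above[of A l k]] card_pts[of k] by (simp add: card_cartesian_product)

section \<open>Components of the adjacency graph of the cubes of one level\<close>

definition link :: "nat \<Rightarrow> (('d \<Rightarrow> int) \<times> ('d \<Rightarrow> int)) set" where
  "link k = {(z, w). z \<in> pts k \<and> w \<in> pts k \<and> adjacent z w}"

definition comp :: "nat \<Rightarrow> ('d \<Rightarrow> int) \<Rightarrow> ('d \<Rightarrow> int) set" where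
  "comp k z = {w. (z, w) \<in> (link k)\<^sup>*}"

definition nodes :: "nat \<Rightarrow> ('d \<Rightarrow> int) set set" where
  "nodes k = comp k ` pts k"

lemma link_sym: "(z, w) \<in> (link k)\<^sup>* \<Longrightarrow> (w, z) \<in> (link k)\<^sup>*"
proof -
  have "sym (link k)" by (auto simp: sym_def link_def adjacent_sym)
  then show "(z, w) \<in> (link k)\<^sup>* \<Longrightarrow> (w, z) \<in> (link k)\<^sup>*"
    by (rule symD[OF sym_rtrancl])
qed

lemma link_pts: "(z, w) \<in> (link k)\<^sup>* \<Longrightarrow> z \<in> pts k \<Longrightarrow> w \<in> pts k"
  by (induction rule: rtrancl_induct) (auto simp: link_def)

lemma comp_self: "z \<in> comp k z"
  by (simp add: comp_def)

lemma comp_eq: "w \<in> comp k z \<Longrightarrow> comp k w = comp k z"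
  unfolding comp_def using link_sym by (auto intro: rtrancl_trans)

lemma node_comp: "A \<in> nodes k \<Longrightarrow> z \<in> A \<Longrightarrow> A = comp k z"
  unfolding nodes_def using comp_eq by blast

lemma node_pts: "A \<in> nodes k \<Longrightarrow> A \<subseteq> pts k"
  unfolding nodes_def comp_def using link_pts by blast

lemma node_ne: "A \<in> nodes k \<Longrightarrow> A \<noteq> {}"
  unfolding nodes_def using comp_self by blast

lemma node_adjacent: "\<lbrakk>A \<in> nodes k; B \<in> nodes k; a \<in> A; b \<in> B; adjacent a
    b\<rbrakk> \<Longrightarrow> A = B"
proof -
  assume *: "A \<in> nodes k" "B \<in> nodes k" "a \<in> A" "b \<in> B" "adjacent a b"
  then have "(a, b) \<in> link k" using node_pts by (auto simp: link_def)
  then have "b \<in> comp k a" by (auto simp: comp_def)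
  then show "A = B" using comp_eq node_comp * by metis
qed

lemma finite_node: "A \<in> nodes k \<Longrightarrow> finite A"
  using node_pts finite_pts finite_subset by blast

lemma finite_nodes: "finite (nodes k)"
  unfolding nodes_def using finite_pts by blast

text \<open>An inclusion is enough: division maps components into components, so a single point of
  \<open>B\<close> decides (\<open>above_node\<close>).\<close>

definition above :: "nat \<Rightarrow> ('d \<Rightarrow> int) set \<Rightarrow> ('d \<Rightarrow> int) set
    \<Rightarrow> bool" where
  "above m A B \<longleftrightarrow> zdiv (n ^ m) ` B \<subseteq> A"

lemma zdiv_link: "(z, w) \<in> (link (l + k))\<^sup>* \<Longrightarrow> (zdiv (n ^ k) z, zdiv (n ^ k) w)
    \<in> (link l)\<^sup>*"
proof (induction rule: rtrancl_induct)
  case (step y w)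
  then have "(zdiv (n ^ k) y, zdiv (n ^ k) w) \<in> link l"
    using n by (auto simp: link_def pts_add intro: adjacent_zdiv)
  with step.IH show ?case by (rule rtrancl.rtrancl_into_rtrancl)
qed simp

lemma above_comp: "\<lbrakk>A \<in> nodes l; z \<in> pts (l + k); zdiv (n ^ k) z \<in> A\<rbrakk>
    \<Longrightarrow> above k A (comp (l + k) z)"
  unfolding above_def using zdiv_link node_comp by (fastforce simp: comp_def)

lemma above_node:
  assumes "A \<in> nodes l" "B \<in> nodes (l + k)" "z \<in> B" "zdiv (n ^ k) z \<in> A"
  shows "above k A B"
  using above_comp[OF assms(1) _ assms(4)] node_comp[OF assms(2,3)] node_pts[OF assms(2)] assms(3) by auto

lemma above_trans: "above k A B \<Longrightarrow> above m B C \<Longrightarrow> above (k + m) A C"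
proof -
  assume *: "above k A B" "above m B C"
  have "zdiv (n ^ (k + m)) z = zdiv (n ^ k) (zdiv (n ^ m) z)" for z :: "'d \<Rightarrow> int"
    by (simp add: zdiv_zdiv power_add mult.commute)
  then show "above (k + m) A C" using * by (auto simp: above_def image_subset_iff)
qed

text \<open>Conservation of mass: the components below \<open>A\<close> partition the extensions of
  its words.\<close>

lemma sum_card_above:
  assumes A: "A \<in> nodes l"
  shows "(\<Sum>B | B \<in> nodes (l + k) \<and> above k A B. card B) = card A * card D ^ k"
proof -
  let ?I = "{B. B \<in> nodes (l + k) \<and> above k A B}"
  have "\<Union>?I = {z \<in> pts (l + k). zdiv (n ^ k) z \<in> A}"
  proof
    show "\<Union>?I \<subseteq> {z \<in> pts (l + k). zdiv (n ^ k) z \<in> A}"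
      using node_pts by (fastforce simp: above_def)
    show "{z \<in> pts (l + k). zdiv (n ^ k) z \<in> A} \<subseteq> \<Union>?I"
      using above_comp[OF A] comp_self by (auto simp: nodes_def)
  qed
  moreover have "card (\<Union>?I) = (\<Sum>B\<in>?I. card B)"
  proof (rule card_Union_disjoint)
    show "pairwise disjnt ?I"
      unfolding pairwise_def disjnt_def using node_comp by blast
  qed (use finite_node in auto)
  ultimately show ?thesis using card_pts_above[OF node_pts[OF A]] by simp
qed

end

section \<open>Components away from the faces and their copies\<close>

context digits
begin

text \<open>Where all digits coincide in a coordinate, so do all points of a level
  (\<open>not_free_const\<close>). In that direction there are no neighbouring cubes, while a
  distance from the faces may be unattainable, for instance if the common digit is 0.\<close>

definition free :: "'d \<Rightarrow> bool" where
  "free i \<longleftrightarrow> (\<exists>d\<in>D. \<exists>d'\<in>D. d $ i < d' $ i)"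

definition deep :: "nat \<Rightarrow> int \<Rightarrow> ('d \<Rightarrow> int) \<Rightarrow> bool" where
  "deep k b z \<longleftrightarrow> (\<forall>i. free i \<longrightarrow> b \<le> z i \<and> z i < int (n ^
      k) - b)"

definition interior_node :: "nat \<Rightarrow> ('d \<Rightarrow> int) set \<Rightarrow> bool" where
  "interior_node k A \<longleftrightarrow> A \<in> nodes k \<and> (\<forall>z\<in>A. deep k 1 z)"

lemma not_free_const:
  assumes "\<not> free i" "u \<in> pts l" "v \<in> pts l"
  shows "u i = v i"
  using assms(2,3)
proof (induction l arbitrary: u v)
  case (Suc l)
  have "zdiv n u i = zdiv n v i" using Suc by auto
  moreover have "zmod n u i = zmod n v i"
    using Suc.prems assms(1) unfolding free_def pts.simps digs_def
    by (auto simp: not_less) (metis le_antisym)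
  ultimately show ?case unfolding zdiv_def zmod_def by (metis mult_div_mod_eq)
qed simp

lemma scale_bounds:
  fixes a P q v :: int
  assumes "1 \<le> a" "a < P - 1" "0 \<le> v" "v < q"
  shows "q \<le> q * a + v \<and> q * a + v < q * P - q"
proof -
  have "q \<le> q * a" using mult_left_mono[of 1 a q] assms by simp
  moreover have "q * a \<le> q * P - 2 * q"
    using mult_left_mono[of a "P - 2" q] assms by (simp add: algebra_simps)
  ultimately show ?thesis using assms by linarith
qed

text \<open>A digit \<open>e\<close> followed by a smaller one \<open>e'\<close>: the first is not 0
  and the second is not \<open>m - 1\<close>, so the number avoids both ends of its range.\<close>

lemma two_digits_bounds:
  fixes z P e e' m :: int
  assumes "0 \<le> z" "z < P" "0 \<le> e'" "e' < e" "e < m"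
  shows "1 \<le> m\<^sup>2 * z + (m * e + e') \<and> m\<^sup>2 * z + (m * e + e') < m\<^sup>2 * P - 1"
proof -
  have "0 \<le> m\<^sup>2 * z" using assms by simp
  moreover have "m\<^sup>2 * z \<le> m\<^sup>2 * P - m\<^sup>2"
    using mult_left_mono[of z "P - 1" "m\<^sup>2"] assms by (simp add: algebra_simps)
  moreover have "m \<le> m * e" using mult_left_mono[of 1 e m] assms by simp
  moreover have "m * e \<le> m\<^sup>2 - m"
    using mult_left_mono[of e "m - 1" m] assms by (simp add: algebra_simps power2_eq_square)
  ultimately show ?thesis using assms by linarith
qed

lemma deep_zcat:
  assumes "z \<in> pts k" "deep k 1 z" "v \<in> pts m"
  shows "deep (k + m) (int (n ^ m)) (zcat (n ^ m) z v)"
  unfolding deep_def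
proof (intro allI impI)
  fix i assume "free i"
  then have "1 \<le> z i" "z i < int (n ^ k) - 1" using assms(2) unfolding deep_def by auto
  from scale_bounds[OF this, of "v i" "int (n ^ m)"] pts_bounds[OF assms(3), of i]
  show "int (n ^ m) \<le> zcat (n ^ m) z v i \<and> zcat (n ^ m) z v i < int (n ^ (k + m)) - int (n ^ m)"
    by (simp add: zcat_def power_add mult.commute)
qed

text \<open>The free coordinates are treated one at a time by appending two digits, the one with the
  larger entry first. Coordinates treated earlier only move farther from the faces
  (\<open>scale_bounds\<close>).\<close>

lemma exists_deep: "\<exists>k z. z \<in> pts k \<and> deep k 1 z"
proof -
  have "\<exists>k z. z \<in> pts k \<and> (\<forall>i\<in>J. free i \<longrightarrow> 1 \<le> z i \<and> z
      i < int (n ^ k) - 1)" if "finite J" for J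
    using that
  proof (induction J rule: finite_induct)
    case empty
    then show ?case by (intro exI[of _ 0] exI[of _ "\<lambda>_. 0"]) simp
  next
    case (insert j J)
    then obtain k z where z: "z \<in> pts k" "\<forall>i\<in>J. free i \<longrightarrow> 1 \<le> z i \<and>
        z i < int (n ^ k) - 1" by blast
    show ?case
    proof (cases "free j")
      case False
      then show ?thesis using z by blast
    next
      case True
      then obtain d d' where d: "d \<in> D" "d' \<in> D" "d $ j < d' $ j" unfolding free_def by blast
      define e where "e = (\<lambda>i. int (d' $ i))"
      define e' where "e' = (\<lambda>i. int (d $ i))"
      have e: "e \<in> pts 1" "e' \<in> pts 1" unfolding pts_1 using d by (auto simp: e_def e'_def digs_def)
      define v where "v = zcat (n ^ 1) e e'"
      have v: "v \<in> pts 2" using pts_zcat(1)[OF e] by (simp add: v_def numeral_2_eq_2)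
      define w where "w = zcat (n ^ 2) z v"
      have w: "w \<in> pts (k + 2)" using pts_zcat(1)[OF z(1) v] by (simp add: w_def)
      have pow: "int (n ^ (k + 2)) = (int n)\<^sup>2 * int (n ^ k)" by (simp add: power2_eq_square)
      have "1 \<le> w i \<and> w i < int (n ^ (k + 2)) - 1" if "i \<in> insert j J" "free i" for i
      proof (cases "i = j")
        case True
        have "w j = (int n)\<^sup>2 * z j + (int n * e j + e' j)"
          by (simp add: w_def v_def zcat_def)
        moreover have "0 \<le> e' j" "e' j < e j" "e j < int n"
          using d pts_bounds[OF e(1), of j] by (auto simp: e_def e'_def)
        ultimately have "1 \<le> w j \<and> w j < (int n)\<^sup>2 * int (n ^ k) - 1"
          using two_digits_bounds[of "z j" "int (n ^ k)" "e' j" "e j" "int n"] pts_bounds[OF z(1), of j]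
          by presburger
        then show ?thesis unfolding pow True .
      next
        case False
        then have "1 \<le> z i" "z i < int (n ^ k) - 1" using z that by auto
        from scale_bounds[OF this, of "v i" "int (n ^ 2)"] pts_bounds[OF v, of i]
        have "(int n)\<^sup>2 \<le> w i" "w i < (int n)\<^sup>2 * int (n ^ k) - (int n)\<^sup>2"
          by (auto simp: w_def zcat_def)
        moreover have "(int n)\<^sup>2 \<ge> 1" using n by simp
        ultimately show ?thesis unfolding pow by linarith
      qed
      then show ?thesis using w by blast
    qed
  qed
  from this[of UNIV] show ?thesis unfolding deep_def by auto
qed

lemma interior_above:
  assumes "interior_node k A" "C \<in> nodes (k + m)" "above m A C"
  shows "interior_node (k + m) C"
  unfolding interior_node_def
proof (intro conjI ballI)
  fix z assume "z \<in> C"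
  then have a: "zdiv (n ^ m) z \<in> A" "z \<in> pts (k + m)" using assms node_pts by (auto simp: above_def)
  then have "deep (k + m) (int (n ^ m)) (zcat (n ^ m) (zdiv (n ^ m) z) (zmod (n ^ m) z))"
    using assms(1) by (intro deep_zcat) (auto simp: interior_node_def pts_add)
  moreover have "int (n ^ m) \<ge> 1" using n by simp
  ultimately show "deep (k + m) 1 z" unfolding zcat_zdiv_zmod deep_def by fastforce
qed (rule assms)

lemma inj_zcat: "inj_on (zcat m u) S"
  by (rule inj_onI) (simp add: zcat_def fun_eq_iff)

text \<open>A node away from the faces of the cube is not touched by anything outside the cube, so that
  each of its copies is again a node.\<close>

lemma copy_node:
  assumes C: "interior_node k C" and u: "u \<in> pts l"
  shows "zcat (n ^ k) u ` C \<in> nodes (l + k)"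
proof -
  have Cn: "C \<in> nodes k" using C by (simp add: interior_node_def)
  obtain c where c: "c \<in> C" using node_ne[OF Cn] by blast
  have Cc: "C = comp k c" by (rule node_comp[OF Cn c])
  let ?f = "zcat (n ^ k) u"
  have sub1: "(?f c, ?f c') \<in> (link (l + k))\<^sup>*" if "(c, c') \<in> (link k)\<^sup>*" for c'
    using that
  proof (induction rule: rtrancl_induct)
    case (step y z)
    then have "(?f y, ?f z) \<in> link (l + k)"
      using u pts_zcat(1) by (auto simp: link_def adjacent_zcat)
    with step.IH show ?case by (rule rtrancl.rtrancl_into_rtrancl)
  qed simp
  have sub2: "w \<in> ?f ` C" if "(?f c, w) \<in> (link (l + k))\<^sup>*" for w
    using that
  proof (induction rule: rtrancl_induct)
    case base
    then show ?case using c by simp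
  next
    case (step y w)
    then obtain c' where c': "c' \<in> C" "y = ?f c'" by blast
    have w: "w \<in> pts (l + k)" "adjacent y w" using step by (auto simp: link_def)
    have wl: "zdiv (n ^ k) w \<in> pts l" "zmod (n ^ k) w \<in> pts k" using w by (auto simp: pts_add)
    have "zdiv (n ^ k) w i = u i" for i
    proof (cases "free i")
      case False
      then show ?thesis using not_free_const wl u by blast
    next
      case True
      then have "1 \<le> c' i" "c' i < int (n ^ k) - 1" using C c' by (auto simp: interior_node_def deep_def)
      moreover have "\<bar>y i - w i\<bar> \<le> 1" using w(2) by (simp add: adjacent_def)
      ultimately have r: "0 \<le> w i - int (n ^ k) * u i" "w i - int (n ^ k) * u i < int (n ^ k)"
        using c'(2) by (auto simp: zcat_def)
      have "w i div int (n ^ k) = (int (n ^ k) * u i + (w i - int (n ^ k) * u i)) div int (n ^ k)" by simp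
      also have "\<dots> = u i" by (subst div_mult_self4) (use r n in \<open>auto simp:
          div_pos_pos_trivial\<close>)
      finally show ?thesis by (simp add: zdiv_def)
    qed
    then have "zdiv (n ^ k) w = u" by blast
    then have wf: "w = ?f (zmod (n ^ k) w)" using zcat_zdiv_zmod[of "n ^ k" w] by simp
    then have "adjacent c' (zmod (n ^ k) w)" using w(2) c'(2) adjacent_zcat by metis
    then have "(c', zmod (n ^ k) w) \<in> link k"
      using wl c' node_pts[OF Cn] by (auto simp: link_def)
    moreover have "(c, c') \<in> (link k)\<^sup>*" using c' Cc by (simp add: comp_def)
    ultimately have "zmod (n ^ k) w \<in> C" unfolding Cc comp_def by (simp add: rtrancl.rtrancl_into_rtrancl)
    then show ?case using wf by blast
  qed
  have "comp (l + k) (?f c) = ?f ` C"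
    using sub1 sub2 unfolding comp_def Cc by (auto simp: comp_def)
  moreover have "?f c \<in> pts (l + k)" using pts_zcat(1) u c node_pts[OF Cn] by blast
  ultimately show ?thesis unfolding nodes_def by blast
qed

text \<open>Descendants of an interior node are interior, so \<open>copy_node\<close> applies to
  them as well, and nothing from outside can join them.\<close>

lemma above_copy:
  assumes A: "interior_node k A" and u: "u \<in> pts l"
    and C: "C \<in> nodes (l + k + m)" "above m (zcat (n ^ k) u ` A) C"
  shows "\<exists>C0. C0 \<in> nodes (k + m) \<and> above m A C0 \<and> C = zcat (n ^ (k + m)) u ` C0"
proof -
  obtain z where z: "z \<in> C" using node_ne[OF C(1)] by blast
  then obtain a where a: "a \<in> A" "zdiv (n ^ m) z = zcat (n ^ k) u a" using C(2) by (auto simp: above_def)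
  have An: "A \<in> nodes k" using A by (simp add: interior_node_def)
  have ap: "a \<in> pts k" using a node_pts[OF An] by blast
  define c where "c = zmod (n ^ (k + m)) z"
  have zp: "z \<in> pts (l + (k + m))" using z node_pts[OF C(1)] by (auto simp: add.assoc)
  then have c: "c \<in> pts (k + m)" by (simp add: c_def pts_add[of _ l "k + m"])
  have "zdiv (n ^ m) c = zmod (n ^ k) (zdiv (n ^ m) z)"
    unfolding c_def zdiv_def zmod_def fun_eq_iff
    using n by (simp add: power_add mult.commute[of "n ^ k"] zmod_zmult2_eq)
  then have ca: "zdiv (n ^ m) c = a" using a(2) pts_zcat(3)[OF u ap] by simp
  have "zdiv (n ^ (k + m)) z = zdiv (n ^ k) (zdiv (n ^ m) z)"
    by (simp add: zdiv_zdiv power_add mult.commute)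
  then have "zdiv (n ^ (k + m)) z = u" using a(2) pts_zcat(2)[OF u ap] by simp
  then have zc: "z = zcat (n ^ (k + m)) u c" using zcat_zdiv_zmod[of "n ^ (k + m)" z] by (simp add: c_def)
  define C0 where "C0 = comp (k + m) c"
  have C0: "C0 \<in> nodes (k + m)" "above m A C0"
    using c above_comp[OF An c] ca a by (auto simp: C0_def nodes_def)
  have "interior_node (k + m) C0" by (rule interior_above[OF A C0])
  from copy_node[OF this u] have copy: "zcat (n ^ (k + m)) u ` C0 \<in> nodes (l + k + m)"
    by (simp add: add.assoc)
  have "z \<in> zcat (n ^ (k + m)) u ` C0" using zc comp_self by (auto simp: C0_def)
  then have "C = zcat (n ^ (k + m)) u ` C0" using node_comp[OF copy] node_comp[OF C(1) z] by simp
  then show ?thesis using C0 by blast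
qed

lemma above_refl: "above 0 A A"
  by (auto simp: above_def zdiv_def)

end

section \<open>Components of uniformly bounded size\<close>

text \<open>\<open>bounded\<close> is the only consequence of total disconnectedness on which the
  coding relies; \<open>link_bounded\<close> supplies \<open>B\<close>.\<close>

locale bounded_digits = digits n D for n :: nat and D :: "(nat ^ 'd) set" +
  fixes B :: nat
  assumes bounded: "\<lbrakk>(z, w) \<in> (link k)\<^sup>*; z \<in> pts k\<rbrakk> \<Longrightarrow>
      \<bar>z i - w i\<bar> \<le> int B"
    and card_D: "card D \<ge> 2"
begin

text \<open>Appending \<open>B + 1\<close> digits to a deep point removes it by at least
  \<open>n ^ (B + 1) > B\<close> from the faces, farther than its component can reach.\<close>

lemma exists_interior_node: "\<exists>k A. interior_node k A"
proof -
  obtain k z where z: "z \<in> pts k" "deep k 1 z" using exists_deep by blast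
  let ?m = "B + 1"
  have "B + 1 \<le> n ^ ?m"
  proof -
    have "?m < 2 ^ ?m" by (rule less_exp)
    also have "(2::nat) ^ ?m \<le> n ^ ?m" using n by (intro power_mono) auto
    finally show ?thesis by simp
  qed
  then have nm: "int B + 1 \<le> int (n ^ ?m)" by (metis of_nat_1 of_nat_add of_nat_le_iff)
  obtain v where v: "v \<in> pts ?m"
    using card_pts[of ?m] card_D by (metis card.empty card_gt_0_iff ex_in_conv less_le_trans
        not_numeral_le_zero power_not_zero zero_less_numeral not_gr_zero)
  let ?w = "zcat (n ^ ?m) z v"
  have w: "?w \<in> pts (k + ?m)" by (rule pts_zcat(1)[OF z(1) v])
  have dw: "deep (k + ?m) (int (n ^ ?m)) ?w" by (rule deep_zcat[OF z v])
  have "deep (k + ?m) 1 y" if "y \<in> comp (k + ?m) ?w" for y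
    unfolding deep_def
  proof (intro allI impI)
    fix i assume "free i"
    moreover have "\<bar>?w i - y i\<bar> \<le> int B" using bounded that w by (auto simp: comp_def)
    ultimately show "1 \<le> y i \<and> y i < int (n ^ (k + ?m)) - 1"
      using dw nm unfolding deep_def by (smt (verit))
  qed
  then have "interior_node (k + ?m) (comp (k + ?m) ?w)"
    using w by (auto simp: interior_node_def nodes_def)
  then show ?thesis by blast
qed

text \<open>The number of integer points in a box of radius \<open>B\<close>, which is all the room
  a component has.\<close>

definition M :: nat where "M = (2 * B + 1) ^ CARD('d)"

lemma card_node: "A \<in> nodes k \<Longrightarrow> 1 \<le> card A \<and> card A \<le> M"
proof
  assume A: "A \<in> nodes k"
  then show "1 \<le> card A" using finite_node node_ne by (simp add: Suc_le_eq card_gt_0_iff)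
  obtain z where z: "z \<in> A" using node_ne[OF A] by blast
  define box where "box = PiE UNIV (\<lambda>i. {z i - int B..z i + int B})"
  have "A \<subseteq> box"
  proof
    fix w assume "w \<in> A"
    then have "(z, w) \<in> (link k)\<^sup>*" using node_comp[OF A z] by (simp add: comp_def)
    moreover have "z \<in> pts k" using z node_pts[OF A] by blast
    ultimately have "\<bar>z i - w i\<bar> \<le> int B" for i using bounded by blast
    then have "z i - int B \<le> w i \<and> w i \<le> z i + int B" for i by (metis abs_diff_le_iff
        diff_le_eq add.commute)
    then show "w \<in> box" by (auto simp: box_def PiE_UNIV_domain)
  qed
  moreover have "finite box" unfolding box_def by (intro finite_PiE) auto
  ultimately have "card A \<le> card box" by (rule card_mono[rotated])
  also have "card box = M" unfolding box_def M_def by (subst card_PiE) (simp_all add: nat_add_distrib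
      nat_mult_distrib)
  finally show "card A \<le> M" .
qed

lemma M_pos: "M \<ge> 1" by (simp add: M_def)

end

section \<open>Divisibility of masses and the scarcity of bad components\<close>

locale good_digits = bounded_digits n D B for n :: nat and D :: "(nat ^ 'd) set" and B :: nat +
  fixes k0 :: nat and A0 :: "('d \<Rightarrow> int) set"
  assumes A0: "interior_node k0 A0"
begin

definition vals :: "nat set" where
  "vals = {card C | m C. C \<in> nodes (k0 + m) \<and> above m A0 C}"

definition g :: nat where "g = Gcd vals"

text \<open>The criterion is divisibility rather than being a copy of something below
  \<open>A0\<close>: it is inherited by descendants, and it is what lets the packing divide all
  sizes by \<open>g\<close>.\<close>

definition good :: "nat \<Rightarrow> ('d \<Rightarrow> int) set \<Rightarrow> bool" where
  "good l A \<longleftrightarrow> (\<forall>m C. C \<in> nodes (l + m) \<longrightarrow> above m A C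
      \<longrightarrow> g dvd card C)"

lemma vals_bounds: "vals \<subseteq> {1..M}"
  unfolding vals_def using card_node by auto

lemma g_pos: "g \<ge> 1"
proof -
  have A0n: "A0 \<in> nodes k0" using A0 by (simp add: interior_node_def)
  then have "card A0 \<in> vals" unfolding vals_def using above_refl by (auto intro!: exI[of _ 0] exI[of _ A0])
  then have "g dvd card A0" unfolding g_def by (rule Gcd_dvd)
  moreover have "card A0 \<noteq> 0" using card_node[OF A0n] by simp
  ultimately show ?thesis by (cases g) auto
qed

lemma good_above: "\<lbrakk>good l A; above m A C\<rbrakk> \<Longrightarrow> good (l + m) C"
  unfolding good_def using above_trans by (metis add.assoc)

lemma good_copy: "u \<in> pts l \<Longrightarrow> good (l + k0) (zcat (n ^ k0) u ` A0)"
  unfolding good_def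
proof (intro allI impI)
  fix m C assume u: "u \<in> pts l" and C: "C \<in> nodes (l + k0 + m)" "above m (zcat (n ^ k0) u ` A0) C"
  obtain C0 where C0: "C0 \<in> nodes (k0 + m)" "above m A0 C0" "C = zcat (n ^ (k0 + m)) u ` C0"
    using above_copy[OF A0 u C] by blast
  have "card C = card C0" unfolding C0(3) by (rule card_image[OF inj_zcat])
  moreover have "card C0 \<in> vals" using C0 by (auto simp: vals_def)
  ultimately show "g dvd card C" unfolding g_def by (metis Gcd_dvd)
qed

definition bad :: "nat \<Rightarrow> ('d \<Rightarrow> int) set \<Rightarrow> nat \<Rightarrow> ('d
    \<Rightarrow> int) set" where
  "bad l A m = {z \<in> pts (l + m). zdiv (n ^ m) z \<in> A \<and> \<not> good (l + m) (comp (l + m) z)}"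

lemma finite_bad: "finite (bad l A m)"
  unfolding bad_def using finite_pts by simp

lemma bad_parent:
  assumes z: "z \<in> bad l A (m + j)"
  shows "zdiv (n ^ j) z \<in> bad l A m"
proof -
  have zp: "z \<in> pts (l + m + j)" "zdiv (n ^ (m + j)) z \<in> A" "\<not> good (l + m + j) (comp (l + m +
      j) z)"
    using z by (auto simp: bad_def add.assoc)
  have u: "zdiv (n ^ j) z \<in> pts (l + m)" using zp by (simp add: pts_add)
  have "zdiv (n ^ m) (zdiv (n ^ j) z) = zdiv (n ^ (m + j)) z"
    by (simp add: zdiv_zdiv power_add mult.commute)
  moreover have "\<not> good (l + m) (comp (l + m) (zdiv (n ^ j) z))"
  proof
    assume gd: "good (l + m) (comp (l + m) (zdiv (n ^ j) z))"
    have "above j (comp (l + m) (zdiv (n ^ j) z)) (comp (l + m + j) z)"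
      by (rule above_comp) (use u zp comp_self in \<open>auto simp: nodes_def\<close>)
    from good_above[OF gd this] show False using zp by simp
  qed
  ultimately show ?thesis using u zp by (simp add: bad_def)
qed

lemma card_bad_add: "card (bad l A (m + j)) \<le> card (bad l A m) * card D ^ j"
proof -
  have "bad l A (m + j) \<subseteq> (\<lambda>(u, v). zcat (n ^ j) u v) ` (bad l A m \<times> pts j)"
  proof
    fix z assume z: "z \<in> bad l A (m + j)"
    then have "z \<in> pts (l + m + j)" by (simp add: bad_def add.assoc)
    then have "zmod (n ^ j) z \<in> pts j" by (simp add: pts_add)
    then show "z \<in> (\<lambda>(u, v). zcat (n ^ j) u v) ` (bad l A m \<times> pts j)"
      using bad_parent[OF z] zcat_zdiv_zmod[of "n ^ j" z]
      by (intro image_eqI[of _ _ "(zdiv (n ^ j) z, zmod (n ^ j) z)"]) auto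
  qed
  then have "card (bad l A (m + j)) \<le> card (bad l A m \<times> pts j)"
    by (rule surj_card_le[rotated]) (simp add: finite_bad finite_pts)
  then show ?thesis using card_pts by (simp add: card_cartesian_product)
qed

text \<open>Among all extensions of a word by \<open>k0\<close> digits, the one by a point of
  \<open>A0\<close> lands in a copy of \<open>A0\<close>, which is good.\<close>

lemma card_bad_step: "card (bad l A (m + k0)) \<le> card (bad l A m) * (card D ^ k0 - 1)"
proof -
  have A0n: "A0 \<in> nodes k0" using A0 by (simp add: interior_node_def)
  obtain a0 where a0: "a0 \<in> A0" using node_ne[OF A0n] by blast
  have "bad l A (m + k0) \<subseteq> (\<lambda>(u, v). zcat (n ^ k0) u v) ` (bad l A m \<times> (pts k0 -
      {a0}))"
  proof
    fix z assume z: "z \<in> bad l A (m + k0)"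
    then have zp: "z \<in> pts (l + m + k0)" "\<not> good (l + m + k0) (comp (l + m + k0) z)"
      by (auto simp: bad_def add.assoc)
    let ?u = "zdiv (n ^ k0) z" and ?v = "zmod (n ^ k0) z"
    have u: "?u \<in> pts (l + m)" "?v \<in> pts k0" using zp by (auto simp: pts_add)
    have "?v \<noteq> a0"
    proof
      assume "?v = a0"
      then have zz: "z \<in> zcat (n ^ k0) ?u ` A0" using a0 zcat_zdiv_zmod[of "n ^ k0" z] by (metis imageI)
      have "zcat (n ^ k0) ?u ` A0 = comp (l + m + k0) z"
        by (rule node_comp[OF copy_node[OF A0 u(1)] zz])
      then show False using good_copy[OF u(1)] zp by simp
    qed
    then show "z \<in> (\<lambda>(u, v). zcat (n ^ k0) u v) ` (bad l A m \<times> (pts k0 - {a0}))"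
      using bad_parent[OF z] zcat_zdiv_zmod[of "n ^ k0" z] u
      by (intro image_eqI[of _ _ "(?u, ?v)"]) auto
  qed
  then have "card (bad l A (m + k0)) \<le> card (bad l A m \<times> (pts k0 - {a0}))"
    by (rule surj_card_le[rotated]) (simp add: finite_bad finite_pts)
  moreover have "card (pts k0 - {a0}) = card D ^ k0 - 1"
    using a0 node_pts[OF A0n] card_pts by auto
  ultimately show ?thesis by (simp add: card_cartesian_product)
qed

text \<open>At most \<open>M\<close> points start, and every block of \<open>k0\<close> digits
  reduces the proportion of bad points by the factor \<open>(q - 1) / q\<close>. After
  \<open>t\<close> blocks the factor \<open>M\<close> is overcome, for all nodes alike, and further
  digits do not raise the proportion.\<close>

lemma few_bad: "\<exists>L1. \<forall>L\<ge>L1. \<forall>l. \<forall>A\<in>nodes l. card (bad l A L) < card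
    D ^ L"
proof -
  define q where "q = card D ^ k0"
  have q: "q \<ge> 1" using card_D by (simp add: q_def)
  define x where "x = real (q - 1) / real q"
  have "x < 1" "0 \<le> x" using q by (auto simp: x_def)
  then obtain t where t: "x ^ t < 1 / real M"
    using real_arch_pow_inv[of "1 / real M" x] M_pos by auto
  have "real M * real (q - 1) ^ t < real q ^ t"
    using t q M_pos by (simp add: x_def power_divide field_simps)
  then have t': "M * (q - 1) ^ t < q ^ t" by (metis of_nat_less_iff of_nat_mult of_nat_power)
  have "card (bad l A L) < card D ^ L" if L: "L \<ge> t * k0" and A: "A \<in> nodes l" for L l A
  proof -
    have "card (bad l A (s * k0)) \<le> M * (q - 1) ^ s" for s
    proof (induction s)
      case 0
      have "bad l A 0 \<subseteq> A" by (auto simp: bad_def zdiv_def)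
      then have "card (bad l A 0) \<le> card A" by (rule card_mono[OF finite_node[OF A]])
      then show ?case using card_node[OF A] by simp
    next
      case (Suc s)
      have "card (bad l A (Suc s * k0)) \<le> card (bad l A (s * k0)) * (q - 1)"
        using card_bad_step[of l A "s * k0"] by (simp add: q_def add.commute)
      also have "\<dots> \<le> M * (q - 1) ^ s * (q - 1)" using Suc by (rule mult_le_mono1)
      finally show ?case by (simp add: mult_ac)
    qed
    then have "card (bad l A (t * k0)) < q ^ t" using t' le_less_trans by blast
    moreover have "card (bad l A L) \<le> card (bad l A (t * k0)) * card D ^ (L - t * k0)"
      using card_bad_add[of l A "t * k0" "L - t * k0"] L by simp
    moreover have "q ^ t * card D ^ (L - t * k0) = card D ^ L"
      using L by (simp add: q_def mult.commute flip: power_mult power_add)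
    moreover have "card D ^ (L - t * k0) > 0" using card_D by simp
    ultimately show ?thesis by (metis le_less_trans mult_less_mono1)
  qed
  then show ?thesis by blast
qed

end

section \<open>Exact packing of the descendants of a good component\<close>

context good_digits
begin

text \<open>\<open>exact_packing\<close> is applied to the sizes divided by \<open>g\<close>, whose
  gcd below \<open>A0\<close> is 1. Copies of descendants of \<open>A0\<close> serve as the reserve;
  the goodness of \<open>A\<close> makes all sizes divisible by \<open>g\<close>.\<close>

lemma packing:
  "\<exists>L2. \<forall>L\<ge>L2. \<forall>l. \<forall>A\<in>nodes l. good l A \<longrightarrow>
     (\<exists>b. (\<forall>C\<in>{C \<in> nodes (l + L). above L A C}. b C < card A div g) \<and>
       (\<forall>t<card A div g. (\<Sum>C | C \<in> {C \<in> nodes (l + L). above L A C} \<and> b C = t.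
           card C div g) = card D ^ L))"
proof -
  define Cv where "Cv = (\<lambda>v. v div g) ` vals"
  have gv: "g dvd v" if "v \<in> vals" for v unfolding g_def using that by (rule Gcd_dvd)
  have fin_vals: "finite vals" using vals_bounds finite_subset by blast
  have Cv: "finite Cv" "Cv \<subseteq> {1..M}"
  proof -
    show "finite Cv" using fin_vals by (simp add: Cv_def)
    show "Cv \<subseteq> {1..M}"
    proof
      fix c assume "c \<in> Cv"
      then obtain v where v: "v \<in> vals" "c = v div g" by (auto simp: Cv_def)
      have "1 \<le> v" "v \<le> M" using vals_bounds v(1) by auto
      moreover have "g * c = v" using gv[OF v(1)] v(2) by simp
      ultimately have "1 \<le> c" by (cases c) auto
      moreover have "c \<le> M" using v(2) \<open>v \<le> M\<close> div_le_dividend le_trans by blast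
      ultimately show "c \<in> {1..M}" by simp
    qed
  qed
  have "(\<lambda>c. g * c) ` Cv = vals"
    unfolding Cv_def image_image using gv by (simp cong: image_cong_simp)
  then have "g = g * Gcd Cv" using Gcd_mult[of g Cv] by (simp add: g_def)
  then have "Gcd Cv = 1" using g_pos by simp
  then obtain R0 where R0: "\<And>R. R \<ge> R0 \<Longrightarrow> \<exists>x. (\<Sum>c\<in>Cv. x c * c) = R"
    using large_numbers_representable[OF Cv(1)] by blast
  define K where "K = R0 + M"
  \<comment> \<open>Only finitely many masses occur below \<open>A0\<close>, so a bounded number of
    levels exhibits them all.\<close>
  have "\<exists>K1. \<forall>v\<in>vals. \<exists>m C. m \<le> K1 \<and> C \<in> nodes (k0 + m) \<and>
      above m A0 C \<and> card C = v"
  proof -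
    have "\<exists>m C. C \<in> nodes (k0 + m) \<and> above m A0 C \<and> card C = v" if "v \<in> vals" for v
      using that by (auto simp: vals_def)
    then obtain m where m: "\<And>v. v \<in> vals \<Longrightarrow> \<exists>C. C \<in> nodes (k0 + m v)
        \<and> above (m v) A0 C \<and> card C = v"
      by metis
    have "m v \<le> (\<Sum>v\<in>vals. m v)" if "v \<in> vals" for v
      using member_le_sum[OF that, of m] fin_vals by simp
    then show ?thesis using m by blast
  qed
  then obtain K1 where K1: "\<And>v. v \<in> vals \<Longrightarrow>
      \<exists>m C. m \<le> K1 \<and> C \<in> nodes (k0 + m) \<and> above m A0 C \<and> card C = v" by blast
  \<comment> \<open>The first two summands meet the condition on the bin size, with
    \<open>b \<le> M\<close>; the last one is the reserve required of each size.\<close>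
  define W where "W = card Cv * M * (M * K) + R0 + M * K"
  have "\<exists>b. (\<forall>C\<in>{C \<in> nodes (l + L). above L A C}. b C < card A div g) \<and>
       (\<forall>t<card A div g. (\<Sum>C | C \<in> {C \<in> nodes (l + L). above L A C} \<and> b C = t.
           card C div g) = card D ^ L)"
    if L: "L \<ge> k0 + K1 + W" and A: "A \<in> nodes l" and gA: "good l A" for L l A
  proof -
    let ?I = "{C \<in> nodes (l + L). above L A C}"
    let ?s = "\<lambda>C :: ('d \<Rightarrow> int) set. card C div g"
    have N: "card D ^ j \<ge> j" for j
    proof -
      have "j < 2 ^ j" by (rule less_exp)
      also have "(2::nat) ^ j \<le> card D ^ j" using card_D by (intro power_mono) auto
      finally show ?thesis by simp
    qed
    define L' where "L' = L - (k0 + K1)"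
    have NL': "card D ^ L' \<ge> W" using N[of L'] L by (simp add: L'_def)
    have "card D ^ L' \<le> card D ^ L" using card_D by (intro power_increasing) (auto simp: L'_def)
    then have NL: "card D ^ L \<ge> W" using NL' by simp
    have gdvd: "g dvd card C" if "C \<in> ?I" for C using gA that by (auto simp: good_def)
    have gA': "g dvd card A" using gA A above_refl unfolding good_def by (metis add.right_neutral)
    have "g * (\<Sum>C\<in>?I. ?s C) = (\<Sum>C\<in>?I. card C)"
      unfolding sum_distrib_left by (rule sum.cong) (use gdvd in auto)
    also have "\<dots> = card A * card D ^ L" by (rule sum_card_above[OF A])
    also have "\<dots> = g * (card A div g * card D ^ L)" using gA' by simp
    finally have sum: "(\<Sum>C\<in>?I. ?s C) = card A div g * card D ^ L" using g_pos by simp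
    have "card A \<noteq> 0" using card_node[OF A] by simp
    then have "card A div g \<noteq> 0" using gA' by (auto elim!: dvdE)
    then obtain b where b: "card A div g = Suc b" by (cases "card A div g") auto
    have "card A div g \<le> M" using card_node[OF A] div_le_dividend le_trans by blast
    then have bM: "b \<le> M" using b by simp
    have bK: "b * K \<le> M * K" using bM by (rule mult_le_mono1)
    have "\<exists>f. (\<forall>i\<in>?I. f i < Suc b) \<and> (\<forall>t<Suc b. (\<Sum>i | i \<in> ?I
        \<and> f i = t. ?s i) = card D ^ L)"
    proof (rule exact_packing[OF Cv R0])
      have "card Cv * M * (b * (R0 + M)) \<le> card Cv * M * (M * K)"
        using bK by (intro mult_le_mono2) (simp add: K_def)
      then show "card Cv * M * (b * (R0 + M)) + R0 \<le> card D ^ L" using NL unfolding W_def by linarith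
      show "finite ?I" using finite_nodes by simp
      show "?s C \<le> M" if "C \<in> ?I" for C
        using card_node[of C "l + L"] that div_le_dividend le_trans by blast
      show "sum ?s ?I = card D ^ L * Suc b" using sum b by simp
    next
      fix c assume "c \<in> Cv"
      then obtain v where v: "v \<in> vals" "c = v div g" by (auto simp: Cv_def)
      obtain m C where C: "m \<le> K1" "C \<in> nodes (k0 + m)" "above m A0 C" "card C = v"
        using K1[OF v(1)] by blast
      have iC: "interior_node (k0 + m) C" by (rule interior_above[OF A0 C(2,3)])
      define j where "j = L - (k0 + m)"
      have j: "L = j + (k0 + m)" using L C(1) by (simp add: j_def)
      \<comment> \<open>Every word \<open>u\<close> that lies \<open>j\<close> levels below
        \<open>A\<close> carries one copy of \<open>C\<close>. With the \<open>k0 + m\<close> levels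
        of \<open>C\<close> this makes \<open>L\<close> levels.\<close>
      define U where "U = {u \<in> pts (l + j). zdiv (n ^ j) u \<in> A}"
      define F where "F u = zcat (n ^ (k0 + m)) u ` C" for u
      have Cp: "C \<subseteq> pts (k0 + m)" by (rule node_pts[OF C(2)])
      have "inj_on F U"
      proof (rule inj_onI)
        fix u u' assume uu: "u \<in> U" "u' \<in> U" "F u = F u'"
        obtain x where x: "x \<in> C" using node_ne[OF C(2)] by blast
        then have "zcat (n ^ (k0 + m)) u x \<in> F u'" using uu by (auto simp: F_def)
        then obtain y where y: "y \<in> C" "zcat (n ^ (k0 + m)) u x = zcat (n ^ (k0 + m)) u' y"
          by (auto simp: F_def)
        have "u = zdiv (n ^ (k0 + m)) (zcat (n ^ (k0 + m)) u x)"
          using pts_zcat(2)[of u "l + j" x "k0 + m"] uu x Cp by (auto simp: U_def)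
        also have "\<dots> = u'"
          using pts_zcat(2)[of u' "l + j" y "k0 + m"] uu y Cp by (auto simp: U_def)
        finally show "u = u'" .
      qed
      moreover have "F u \<in> {i \<in> ?I. ?s i = c}" if u: "u \<in> U" for u
      proof -
        have up: "u \<in> pts (l + j)" "zdiv (n ^ j) u \<in> A" using u by (auto simp: U_def)
        have "F u \<in> nodes (l + L)"
          using copy_node[OF iC up(1)] unfolding F_def j by (simp add: add.assoc)
        moreover have "above L A (F u)"
          unfolding above_def
        proof
          fix w assume "w \<in> zdiv (n ^ L) ` F u"
          then obtain x where x: "x \<in> C" "w = zdiv (n ^ L) (zcat (n ^ (k0 + m)) u x)" by (auto simp: F_def)
          have "w = zdiv (n ^ j) (zdiv (n ^ (k0 + m)) (zcat (n ^ (k0 + m)) u x))"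
            unfolding x(2) zdiv_zdiv j by (simp add: power_add mult_ac)
          then show "w \<in> A" using pts_zcat(2)[OF up(1), of x "k0 + m"] x(1) Cp up(2) by auto
        qed
        moreover have "card (F u) = v" unfolding F_def using C(4) by (simp add: card_image[OF inj_zcat])
        ultimately show ?thesis using v(2) by simp
      qed
      ultimately have "card U \<le> card {i \<in> ?I. ?s i = c}"
        by (intro card_inj_on_le[of F]) (auto simp: finite_nodes)
      moreover have "card U = card A * card D ^ j"
        unfolding U_def by (rule card_pts_above[OF node_pts[OF A]])
      moreover have "card D ^ L' \<le> card A * card D ^ j"
      proof -
        have "card D ^ L' \<le> card D ^ j"
          using card_D C(1) by (intro power_increasing) (auto simp: L'_def j_def)
        also have "\<dots> \<le> card A * card D ^ j" using card_node[OF A] by simp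
        finally show ?thesis .
      qed
      ultimately show "b * (R0 + M) \<le> card {i \<in> ?I. ?s i = c}"
        using NL' bK unfolding W_def K_def by linarith
    qed
    then show ?thesis unfolding b .
  qed
  then show ?thesis by blast
qed

end

section \<open>Pieces and cells: size and separation\<close>

section \<open>Cells of the fractal cube\<close>

context digits
begin

definition E :: "(real ^ 'd) set" where
  "E = fractal_cube n D"

definition piece :: "nat \<Rightarrow> ('d \<Rightarrow> int) \<Rightarrow> (real ^ 'd) set" where
  "piece k z = (\<lambda>x. (x + rvec z) /\<^sub>R real (n ^ k)) ` E"

definition cell :: "nat \<Rightarrow> ('d \<Rightarrow> int) set \<Rightarrow> (real ^ 'd) set" where
  "cell k A = \<Union>(piece k ` A)"

definition same :: "nat \<Rightarrow> real ^ 'd \<Rightarrow> real ^ 'd \<Rightarrow> bool" where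
  "same k x y \<longleftrightarrow> (\<exists>A\<in>nodes k. x \<in> cell k A \<and> y \<in> cell k A)"

lemma E_attractor: "is_attractor n D E"
  unfolding E_def by (rule is_attractor_fractal_cube[OF n D D_ne])

lemma compact_E: "compact E" and E_ne: "E \<noteq> {}" and E_eq: "(\<Union>d\<in>D. cube_map n d ` E) = E"
  using is_attractorD[OF E_attractor] .

text \<open>Where the coordinate attains its maximum \<open>a\<close>, self-similarity gives
  \<open>n * a \<le> a + (n - 1)\<close>; the minimum is treated likewise.\<close>

lemma E_bounds:
  assumes "x \<in> E"
  shows "0 \<le> x $ i \<and> x $ i \<le> 1"
proof -
  have cont: "continuous_on E (\<lambda>x. x $ i)" by (intro continuous_intros)
  have n0: "real n > 1" using n by simp
  have coord: "\<exists>b\<in>E. \<exists>d\<in>D. real n * (a $ i) = b $ i + real (d $ i) \<and> real (d $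
      i) \<le> real n - 1" if "a \<in> E" for a
  proof -
    obtain d b where d: "d \<in> D" "b \<in> E" "a = cube_map n d b" using E_eq \<open>a \<in> E\<close> by
        blast
    have "d $ i < n" using D d(1) by (auto simp: digit_set_def)
    then have "real (d $ i) \<le> real n - 1" by linarith
    moreover have "real n * (a $ i) = b $ i + real (d $ i)" using n0 by (simp add: d(3) cube_map_def)
    ultimately show ?thesis using d by blast
  qed
  obtain a where a: "a \<in> E" "\<And>x. x \<in> E \<Longrightarrow> x $ i \<le> a $ i"
    using continuous_attains_sup[OF compact_E E_ne cont] by blast
  obtain b d where b: "b \<in> E" "real n * (a $ i) = b $ i + real (d $ i)" "real (d $ i) \<le> real n - 1"
    using coord[OF a(1)] by blast
  have "(real n - 1) * (a $ i) \<le> (real n - 1) * 1" using b a(2)[OF b(1)] by (simp add: algebra_simps)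
  then have "a $ i \<le> 1" using n0 by (simp only: mult_le_cancel_left)
  moreover
  obtain a' where a': "a' \<in> E" "\<And>x. x \<in> E \<Longrightarrow> a' $ i \<le> x $ i"
    using continuous_attains_inf[OF compact_E E_ne cont] by blast
  obtain b' d' where b': "b' \<in> E" "real n * (a' $ i) = b' $ i + real (d' $ i)"
    using coord[OF a'(1)] by blast
  have "(real n - 1) * 0 \<le> (real n - 1) * (a' $ i)" using b' a'(2)[OF b'(1)] by (simp add: algebra_simps)
  then have "0 \<le> a' $ i" using n0 by (simp only: mult_le_cancel_left)
  ultimately show ?thesis using a(2)[OF assms] a'(2)[OF assms] by linarith
qed

lemma scale_zcat:
  "((y + rvec v) /\<^sub>R real (n ^ m) + rvec u) /\<^sub>R real (n ^ k) = (y + rvec (zcat (n ^ m) u v))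
      /\<^sub>R real (n ^ (k + m))"
  using n by (simp add: vec_eq_iff rvec_def zcat_def power_add field_simps)

lemma E_digs: "E = \<Union>(piece 1 ` digs)"
proof -
  have "cube_map n d = (\<lambda>x. (x + rvec (\<lambda>i. int (d $ i))) /\<^sub>R real (n ^ 1))" for d ::
      "nat ^ 'd"
    by (simp add: cube_map_def rvec_def fun_eq_iff)
  then have "(\<Union>d\<in>D. cube_map n d ` E) = \<Union>(piece 1 ` digs)"
    by (simp add: piece_def digs_def)
  then show ?thesis using E_eq by simp
qed

text \<open>Stated relative to the decomposition for \<open>m\<close>, since the case
  \<open>m = 1\<close> serves to prove that decomposition in general
  (\<open>E_pieces\<close>).\<close>

lemma piece_split_aux:
  assumes "E = \<Union>(piece m ` pts m)"
  shows "piece k u = (\<Union>v\<in>pts m. piece (k + m) (zcat (n ^ m) u v))"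
proof -
  have "piece k u = (\<lambda>x. (x + rvec u) /\<^sub>R real (n ^ k)) ` \<Union>(piece m ` pts m)"
    unfolding piece_def[of k] using assms by simp
  also have "\<dots> = (\<Union>v\<in>pts m. (\<lambda>x. (x + rvec u) /\<^sub>R real (n ^ k)) ` piece m
      v)" by blast
  also have "\<dots> = (\<Union>v\<in>pts m. piece (k + m) (zcat (n ^ m) u v))"
    unfolding piece_def image_image scale_zcat ..
  finally show ?thesis .
qed

lemma E_pieces: "E = \<Union>(piece k ` pts k)"
proof (induction k)
  case 0
  have "rvec (\<lambda>_. 0) = (0 :: real ^ 'd)" by (simp add: rvec_def vec_eq_iff)
  then show ?case by (simp add: piece_def)
next
  case (Suc k)
  have one: "E = \<Union>(piece 1 ` pts 1)" unfolding pts_1 by (rule E_digs)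
  note Suc
  also have "\<Union>(piece k ` pts k) = (\<Union>u\<in>pts k. \<Union>v\<in>pts 1. piece (k + 1) (zcat (n
      ^ 1) u v))"
    by (intro SUP_cong refl piece_split_aux[OF one])
  also have "\<dots> = \<Union>(piece (k + 1) ` ((\<lambda>(u, v). zcat (n ^ 1) u v) ` (pts k \<times> pts
      1)))" by auto
  also have "(\<lambda>(u, v). zcat (n ^ 1) u v) ` (pts k \<times> pts 1) = pts (k + 1)"
    using bij_pts_above[of "pts k" k 1] by (auto simp: bij_betw_def pts_add)
  finally show ?case by simp
qed

lemmas piece_split = piece_split_aux[OF E_pieces]

lemma piece_coord:
  assumes "x \<in> piece k z"
  shows "of_int (z i) \<le> real (n ^ k) * (x $ i) \<and> real (n ^ k) * (x $ i) \<le> of_int (z i) + 1"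
proof -
  obtain y where y: "y \<in> E" "x = (y + rvec z) /\<^sub>R real (n ^ k)" using assms by (auto simp: piece_def)
  have "real (n ^ k) * (x $ i) = y $ i + of_int (z i)" using n by (simp add: y(2) rvec_def)
  then show ?thesis using E_bounds[OF y(1), of i] by simp
qed

text \<open>Cubes whose corners differ by 2 or more in some coordinate are at least one side length
  apart.\<close>

lemma close_pieces_adjacent:
  assumes "x \<in> piece k z" "y \<in> piece k w" "dist x y < 1 / real (n ^ k)"
  shows "adjacent z w"
  unfolding adjacent_def
proof
  fix i
  have "\<bar>x $ i - y $ i\<bar> \<le> dist x y" using dist_vec_nth_le[of x i y] by (simp add: dist_real_def)
  then have "\<bar>x $ i - y $ i\<bar> < 1 / real (n ^ k)" using assms(3) by linarith
  then have "real (n ^ k) * \<bar>x $ i - y $ i\<bar> < 1" using n by (simp add: field_simps)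
  then have "\<bar>real (n ^ k) * (x $ i) - real (n ^ k) * (y $ i)\<bar> < 1"
    by (simp add: abs_mult flip: right_diff_distrib)
  then have "\<bar>real_of_int (z i) - real_of_int (w i)\<bar> < 2"
    using piece_coord[OF assms(1), of i] piece_coord[OF assms(2), of i] by linarith
  then show "\<bar>z i - w i\<bar> \<le> 1" by linarith
qed

lemma dist_pieces:
  assumes "x \<in> piece k z" "y \<in> piece k w" "\<And>i. \<bar>z i - w i\<bar> \<le> int b"
  shows "dist x y \<le> real CARD('d) * (real b + 1) / real (n ^ k)"
proof -
  have "\<bar>(x - y) $ i\<bar> \<le> (real b + 1) / real (n ^ k)" for i
  proof -
    have "\<bar>real_of_int (z i) - real_of_int (w i)\<bar> \<le> real b" using assms(3)[of i] by linarith
    then have "\<bar>real (n ^ k) * (x $ i) - real (n ^ k) * (y $ i)\<bar> \<le> real b + 1"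
      using piece_coord[OF assms(1), of i] piece_coord[OF assms(2), of i] by linarith
    then have "real (n ^ k) * \<bar>x $ i - y $ i\<bar> \<le> real b + 1"
      by (simp add: abs_mult flip: right_diff_distrib)
    then show ?thesis using n by (simp add: field_simps)
  qed
  then have "(\<Sum>i\<in>UNIV. \<bar>(x - y) $ i\<bar>) \<le> (\<Sum>i\<in>(UNIV :: 'd set). (real b + 1)
      / real (n ^ k))"
    by (rule sum_mono)
  then show ?thesis using norm_le_l1_cart[of "x - y"] by (simp add: dist_norm)
qed

lemma cell_root: "pts 0 \<in> nodes 0" "cell 0 (pts 0) = E"
proof -
  have "comp 0 (\<lambda>_. 0) \<subseteq> pts 0"
  proof
    fix w assume "w \<in> comp 0 (\<lambda>_. 0)"
    then show "w \<in> pts 0" using link_pts[of "\<lambda>_. 0" w 0] by (simp add: comp_def)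
  qed
  then have "comp 0 (\<lambda>_. 0) = pts 0" using comp_self[of "\<lambda>_. 0" 0] by auto
  then show "pts 0 \<in> nodes 0" by (auto simp: nodes_def)
  show "cell 0 (pts 0) = E" unfolding cell_def using E_pieces by blast
qed

lemma cell_split:
  assumes A: "A \<in> nodes k"
  shows "cell k A = \<Union>(cell (k + m) ` {C \<in> nodes (k + m). above m A C})"
proof
  show "cell k A \<subseteq> \<Union>(cell (k + m) ` {C \<in> nodes (k + m). above m A C})"
  proof
    fix x assume "x \<in> cell k A"
    then obtain z where z: "z \<in> A" "x \<in> piece k z" by (auto simp: cell_def)
    have zk: "z \<in> pts k" using z node_pts[OF A] by blast
    obtain v where v: "v \<in> pts m" "x \<in> piece (k + m) (zcat (n ^ m) z v)" using z(2) piece_split by blast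
    note zc = pts_zcat[OF zk v(1)]
    have "above m A (comp (k + m) (zcat (n ^ m) z v))" by (rule above_comp[OF A zc(1)]) (simp add: zc z)
    moreover have "comp (k + m) (zcat (n ^ m) z v) \<in> nodes (k + m)" using zc by (auto simp: nodes_def)
    moreover have "x \<in> cell (k + m) (comp (k + m) (zcat (n ^ m) z v))"
      using v(2) comp_self by (auto simp: cell_def)
    ultimately show "x \<in> \<Union>(cell (k + m) ` {C \<in> nodes (k + m). above m A C})" by blast
  qed
  show "\<Union>(cell (k + m) ` {C \<in> nodes (k + m). above m A C}) \<subseteq> cell k A"
  proof
    fix x assume "x \<in> \<Union>(cell (k + m) ` {C \<in> nodes (k + m). above m A C})"
    then obtain C w where C: "C \<in> nodes (k + m)" "above m A C" "w \<in> C" "x \<in> piece (k + m) w"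
      by (auto simp: cell_def)
    have "w \<in> pts (k + m)" using C node_pts by blast
    then have "zmod (n ^ m) w \<in> pts m" by (simp add: pts_add)
    moreover have "x \<in> piece (k + m) (zcat (n ^ m) (zdiv (n ^ m) w) (zmod (n ^ m) w))"
      unfolding zcat_zdiv_zmod by (rule C(4))
    ultimately have "x \<in> piece k (zdiv (n ^ m) w)" unfolding piece_split[of k _ m] by blast
    moreover have "zdiv (n ^ m) w \<in> A" using C by (auto simp: above_def)
    ultimately show "x \<in> cell k A" by (auto simp: cell_def)
  qed
qed

lemma cell_disjoint:
  assumes "A \<in> nodes k" "B \<in> nodes k" "x \<in> cell k A" "y \<in> cell k B" "dist x y < 1 / real (n
      ^ k)"
  shows "A = B"
proof -
  obtain z w where zw: "z \<in> A" "x \<in> piece k z" "w \<in> B" "y \<in> piece k w"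
    using assms(3,4) by (auto simp: cell_def)
  have "adjacent z w" by (rule close_pieces_adjacent[OF zw(2,4) assms(5)])
  then show ?thesis using node_adjacent assms(1,2) zw by blast
qed

lemma cell_unique: "\<lbrakk>A \<in> nodes k; B \<in> nodes k; x \<in> cell k A; x \<in> cell k B\<rbrakk>
    \<Longrightarrow> A = B"
  using cell_disjoint[of A k B x x] n by simp

lemma cell_cover: "x \<in> E \<Longrightarrow> \<exists>A\<in>nodes k. x \<in> cell k A"
proof -
  assume "x \<in> E"
  then obtain z where "z \<in> pts k" "x \<in> piece k z" using E_pieces[of k] by blast
  then have "x \<in> cell k (comp k z)" "comp k z \<in> nodes k" using comp_self by (auto simp: cell_def
      nodes_def)
  then show ?thesis by blast
qed

lemma cell_subset: "A \<in> nodes k \<Longrightarrow> cell k A \<noteq> {} \<and> cell k A \<subseteq> E"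
  using node_ne[of A k] node_pts[of A k] E_ne E_pieces[of k] unfolding cell_def piece_def by fastforce

lemma same_near: "\<lbrakk>x \<in> E; y \<in> E; dist x y < 1 / real (n ^ k)\<rbrakk> \<Longrightarrow>
    same k x y"
proof -
  assume *: "x \<in> E" "y \<in> E" "dist x y < 1 / real (n ^ k)"
  obtain A B where AB: "A \<in> nodes k" "x \<in> cell k A" "B \<in> nodes k" "y \<in> cell k B"
    using cell_cover * by meson
  then have "A = B" using cell_disjoint * by blast
  then show ?thesis unfolding same_def using AB by blast
qed

lemma same_trans: "same k x y \<Longrightarrow> same k y z \<Longrightarrow> same k x z"
  unfolding same_def using cell_unique by blast

lemma same_sym: "same k x y \<Longrightarrow> same k y x"
  unfolding same_def by blast

lemma same_antimono:
  assumes "same (k + m) x y"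
  shows "same k x y"
proof -
  obtain C where C: "C \<in> nodes (k + m)" "x \<in> cell (k + m) C" "y \<in> cell (k + m) C"
    using assms unfolding same_def by blast
  obtain z where z: "z \<in> C" using node_ne[OF C(1)] by blast
  then have zp: "z \<in> pts (k + m)" using node_pts[OF C(1)] by blast
  define A where "A = comp k (zdiv (n ^ m) z)"
  have A: "A \<in> nodes k" using zp by (auto simp: A_def nodes_def pts_add)
  have "above m A C" by (rule above_node[OF A C(1) z]) (simp add: A_def comp_self)
  then have "cell (k + m) C \<subseteq> cell k A" using cell_split[OF A, of m] C(1) by blast
  then show ?thesis unfolding same_def using A C by blast
qed

section \<open>Total disconnectedness bounds the components\<close>

text \<open>Magnified, a chain of touching cubes becomes a chain with steps below \<delta> in a
  finite union of translates of \<open>E\<close>, as long as it remains within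
  \<open>2 * n ^ p\<close> of its start. By thinness it then even remains within
  \<open>n ^ p\<close>, so one more step never takes it out of range.\<close>

lemma link_bounded:
  assumes td: "totally_disconnected E"
  shows "\<exists>B. \<forall>k z w. (z, w) \<in> (link k)\<^sup>* \<longrightarrow> z \<in> pts k
      \<longrightarrow> (\<forall>i. \<bar>z i - w i\<bar> \<le> int B)"
proof -
  \<comment> \<open>Differences between the ancestors of \<open>w\<close> and \<open>z\<close>,
    \<open>p\<close> levels up, for all \<open>w\<close> in the range considered below. Finitely
    many translates suffice, whatever \<open>k\<close> is.\<close>
  define V where "V = PiE (UNIV :: 'd set) (\<lambda>_. {-3..3 :: int})"
  have finV: "finite V" unfolding V_def by (intro finite_PiE) auto
  define X where "X = (\<Union>v\<in>V. (+) (rvec v) ` E)"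
  have "chain_thin X"
    unfolding X_def
    by (intro chain_thin_UN finV chain_thin_translation chain_thin_compact_totally_disconnected compact_E td)
  then obtain \<delta> where \<delta>: "\<delta> > 0" "\<And>x y. (x, y) \<in> (chain_rel \<delta>
      X)\<^sup>* \<Longrightarrow> dist x y \<le> 1"
    unfolding chain_thin_def by (metis zero_less_one)
  obtain p where p: "real CARD('d) / \<delta> < 2 ^ p" using real_arch_pow[of 2 "real CARD('d) / \<delta>"]
      by auto
  have "(2::real) ^ p \<le> real n ^ p" using n by (intro power_mono) auto
  then have p': "real CARD('d) / real (n ^ p) < \<delta>"
    using p \<delta>(1) n by (simp add: field_simps) (smt (verit) mult_left_mono)
  obtain e where e: "e \<in> E" using E_ne by blast
  have "\<bar>z i - w i\<bar> \<le> int (n ^ p)" if zw: "(z, w) \<in> (link k)\<^sup>*" "z \<in> pts k" for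
      k z w i
  proof (cases "p \<le> k")
    case False
    have "w \<in> pts k" by (rule link_pts[OF zw])
    then have "\<bar>z i - w i\<bar> \<le> int (n ^ k)" using pts_bounds[OF zw(2), of i] pts_bounds[of w k
        i] by linarith
    also have "int (n ^ k) \<le> int (n ^ p)" using n False by (intro of_nat_mono power_increasing) auto
    finally show ?thesis .
  next
    case True
    then obtain l where k: "k = l + p" using le_Suc_ex[OF True] by (metis add.commute)
    let ?z0 = "zdiv (n ^ p) z"
    \<comment> \<open>A sample point of the cube \<open>w\<close>, magnified so that the ancestors
      \<open>p\<close> levels up are unit cubes, with that of \<open>z\<close> at the
      origin.\<close>
    define P where "P w = (e + rvec w) /\<^sub>R real (n ^ p) - rvec ?z0" for w
    have diff: "P w - P w' = rvec (\<lambda>i. w i - w' i) /\<^sub>R real (n ^ p)" for w w'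
      by (simp add: P_def rvec_def vec_eq_iff diff_divide_distrib field_simps)
    have inX: "P w \<in> X" if "w \<in> pts k" "\<And>i. \<bar>z i - w i\<bar> \<le> 2 * int (n ^ p)" for w
    proof -
      define v where "v i = zdiv (n ^ p) w i - ?z0 i" for i
      have "\<bar>w i - z i\<bar> \<le> 3 * int (n ^ p)" for i using that(2)[of i] by linarith
      then have "\<bar>v i\<bar> \<le> 3" for i unfolding v_def zdiv_def using n by (intro div_close) auto
      then have "v \<in> V" unfolding V_def by (auto simp: PiE_UNIV_domain abs_le_iff) (metis minus_le_iff)
      have "zmod (n ^ p) w \<in> pts p" using that(1) k by (simp add: pts_add)
      then have "(e + rvec (zmod (n ^ p) w)) /\<^sub>R real (n ^ p) \<in> E"
        using E_pieces[of p] e by (auto simp: piece_def)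
      moreover have "P w = rvec v + (e + rvec (zmod (n ^ p) w)) /\<^sub>R real (n ^ p)"
      proof -
        have "real_of_int (w i) = real (n ^ p) * real_of_int (w i div int (n ^ p)) + real_of_int (w i mod
            int (n ^ p))" for i
          by (metis mult_div_mod_eq of_int_add of_int_mult of_int_of_nat_eq)
        then show ?thesis using n
          by (simp add: P_def rvec_def v_def vec_eq_iff zdiv_def zmod_def field_simps)
      qed
      ultimately show ?thesis unfolding X_def using \<open>v \<in> V\<close> by blast
    qed
    \<comment> \<open>The bound \<open>n ^ p\<close> is carried through the induction: it gives
      \<open>2 * n ^ p\<close> after one more step, which keeps the sample points in
      \<open>X\<close>, and thinness of \<open>X\<close> restores \<open>n ^ p\<close>.\<close>
    have step: "(P z, P w) \<in> (chain_rel \<delta> X)\<^sup>* \<and> w \<in> pts k \<and> (\<forall>i.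
        \<bar>z i - w i\<bar> \<le> int (n ^ p))"
      using zw(1)
    proof (induction rule: rtrancl_induct)
      case base
      then show ?case using zw(2) by simp
    next
      case (step y w)
      have yw: "y \<in> pts k" "w \<in> pts k" "adjacent y w" using step.hyps(2) by (auto simp: link_def)
      have np: "int (n ^ p) \<ge> 1" using n by simp
      have zy: "\<bar>z i - y i\<bar> \<le> int (n ^ p)" for i using step.IH by blast
      have adj: "\<bar>y i - w i\<bar> \<le> 1" for i using yw(3) by (simp add: adjacent_def)
      have "P y \<in> X" "P w \<in> X"
      proof -
        show "P y \<in> X"
        proof (rule inX[OF yw(1)])
          show "\<bar>z i - y i\<bar> \<le> 2 * int (n ^ p)" for i using zy[of i] np by linarith
        qed
        show "P w \<in> X"
        proof (rule inX[OF yw(2)])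
          show "\<bar>z i - w i\<bar> \<le> 2 * int (n ^ p)" for i using zy[of i] adj[of i] np by linarith
        qed
      qed
      moreover have "dist (P y) (P w) < \<delta>"
      proof -
        have "norm (rvec (\<lambda>i. y i - w i)) \<le> (\<Sum>i\<in>UNIV. \<bar>rvec (\<lambda>i. y i - w
            i) $ i\<bar>)"
          by (rule norm_le_l1_cart)
        also have "\<dots> \<le> (\<Sum>i\<in>(UNIV :: 'd set). 1)"
          by (rule sum_mono) (use adj in \<open>simp add: rvec_def flip: of_int_diff of_int_abs\<close>)
        finally have "norm (rvec (\<lambda>i. y i - w i)) \<le> real CARD('d)" by simp
        then have "dist (P y) (P w) \<le> real CARD('d) / real (n ^ p)"
          unfolding dist_norm diff
          by (simp add: divide_inverse mult.commute[of "inverse _"] mult_right_mono)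
        then show ?thesis using p' by simp
      qed
      ultimately have "(P y, P w) \<in> chain_rel \<delta> X" by (simp add: chain_rel_def)
      then have chain: "(P z, P w) \<in> (chain_rel \<delta> X)\<^sup>*" 
        by (rule rtrancl.rtrancl_into_rtrancl[rotated]) (use step.IH in blast)
      have "\<bar>z i - w i\<bar> \<le> int (n ^ p)" for i
      proof -
        have "\<bar>(P z - P w) $ i\<bar> \<le> 1"
          using \<delta>(2)[OF chain] component_le_norm_cart[of "P z - P w" i] by (simp add: dist_norm)
        then have "\<bar>real_of_int (z i - w i)\<bar> \<le> real (n ^ p)"
          unfolding diff using n by (simp add: rvec_def field_simps)
        then show ?thesis by linarith
      qed
      then show ?case using chain yw by blast
    qed
    then show ?thesis by blast
  qed
  then show ?thesis by blast
qed

end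

section \<open>The cells as a tower of equivalence relations\<close>

context bounded_digits
begin

lemma same_dist: "same k x y \<Longrightarrow> dist x y \<le> real CARD('d) * (real B + 1) / real (n ^ k)"
proof -
  assume "same k x y"
  then obtain A z w where A: "A \<in> nodes k" "z \<in> A" "x \<in> piece k z" "w \<in> A" "y \<in> piece k w"
    unfolding same_def cell_def by blast
  have "(z, w) \<in> (link k)\<^sup>*" using node_comp[OF A(1,2)] A(4) by (simp add: comp_def)
  moreover have "z \<in> pts k" using A node_pts by blast
  ultimately show ?thesis using dist_pieces[OF A(3,5)] bounded by blast
qed

text \<open>Completeness comes from compactness: a subsequence converges, and points closer than the
  side length of the cubes share a cell. Separation comes from the shrinking diameters of
  cells.\<close>

lemma tower_same:
  assumes L: "L \<ge> 1"
  shows "tower E (\<lambda>j. same (j * L))"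
  unfolding tower_def
proof (intro conjI allI ballI impI)
  fix j x assume "x \<in> E"
  then show "same (j * L) x x" using cell_cover unfolding same_def by blast
next
  fix j x y assume "same (j * L) x y"
  then show "same (j * L) y x" by (rule same_sym)
next
  fix j x y z assume "same (j * L) x y" "same (j * L) y z"
  then show "same (j * L) x z" by (rule same_trans)
next
  fix j x y assume "same (Suc j * L) x y"
  then show "same (j * L) x y" using same_antimono[of "j * L" L x y] by (simp add: add.commute)
next
  fix x y assume s: "\<forall>j. same (j * L) x y"
  define c where "c = real CARD('d) * (real B + 1)"
  have n1: "real n > 1" using n by simp
  show "x = y"
  proof (rule ccontr)
    assume "x \<noteq> y"
    then have d: "dist x y > 0" by simp
    obtain k where k: "c / dist x y < real n ^ k" using real_arch_pow[OF n1] by blast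
    have "real n ^ k \<le> real n ^ (k * L)" using n1 L by (intro power_increasing) auto
    then have "real n ^ k * dist x y \<le> real (n ^ (k * L)) * dist x y" by (intro mult_right_mono) simp_all
    moreover have "c < real n ^ k * dist x y" using k d by (simp add: pos_divide_less_eq)
    ultimately have "c < real (n ^ (k * L)) * dist x y" by linarith
    then have "c / real (n ^ (k * L)) < dist x y" using n by (simp add: field_simps)
    then show False using same_dist[of "k * L" x y] s by (simp add: c_def)
  qed
next
  fix u :: "nat \<Rightarrow> real ^ 'd"
  assume u: "\<forall>k. u k \<in> E" "\<forall>k. same (k * L) (u k) (u (Suc k))"
  obtain x r where x: "x \<in> E" "strict_mono r" "(u \<circ> r) \<longlonglongrightarrow> x"
    using compact_E u(1) unfolding compact_def by blast
  have le: "same (k * L) (u k) (u l)" if "k \<le> l" for k l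
    using that
  proof (induction l rule: dec_induct)
    case base
    then show ?case using u(1) cell_cover unfolding same_def by blast
  next
    case (step l)
    have "l * L = k * L + (l - k) * L" using step.hyps by (simp flip: distrib_right)
    then have "same (k * L) (u l) (u (Suc l))" using u(2) same_antimono[of "k * L" "(l - k) * L"] by metis
    then show ?case using step.IH same_trans by blast
  qed
  have "same (k * L) x (u k)" for k
  proof -
    have "\<forall>\<^sub>F m in sequentially. dist ((u \<circ> r) m) x < 1 / real (n ^ (k * L))"
      using tendstoD[OF x(3), of "1 / real (n ^ (k * L))"] n by simp
    then obtain m0 where m0: "\<And>m. m \<ge> m0 \<Longrightarrow> dist (u (r m)) x < 1 / real (n ^ (k * L))"
      unfolding eventually_sequentially by auto
    define m where "m = max m0 k"
    have "k \<le> r m" using seq_suble[OF x(2), of m] by (simp add: m_def)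
    then have "same (k * L) (u k) (u (r m))" by (rule le)
    moreover have "same (k * L) (u (r m)) x"
      by (rule same_near) (use u x m0[of m] in \<open>auto simp: m_def\<close>)
    ultimately show ?thesis using same_trans same_sym by blast
  qed
  then show "\<exists>x\<in>E. \<forall>k. same (k * L) x (u k)" using x(1) by blast
qed

end

section \<open>Coding the fractal cube\<close>

context good_digits
begin

text \<open>One generation of \<open>mass_tree\<close> comprises \<open>L\<close> levels of cubes,
  with \<open>L\<close> large enough for both \<open>few_bad\<close> and \<open>packing\<close>. The
  weight of a good node is its cardinality divided by \<open>g\<close>.\<close>

lemma coarse_equiv_E:
  "\<exists>L0\<ge>1. \<forall>L\<ge>L0. \<exists>c f. coarse_equiv c (\<lambda>j. same (j * L)) agree E
      (seqs (card D ^ L) (card D ^ L)) f"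
proof -
  obtain L1 where L1: "\<And>L l A. \<lbrakk>L \<ge> L1; A \<in> nodes l\<rbrakk> \<Longrightarrow> card
      (bad l A L) < card D ^ L"
    using few_bad by blast
  obtain L2 where L2: "\<And>L l A. \<lbrakk>L \<ge> L2; A \<in> nodes l; good l A\<rbrakk> \<Longrightarrow>
     \<exists>b. (\<forall>C\<in>{C \<in> nodes (l + L). above L A C}. b C < card A div g) \<and>
       (\<forall>t<card A div g. (\<Sum>C | C \<in> {C \<in> nodes (l + L). above L A C} \<and> b C = t.
           card C div g) = card D ^ L)"
    using packing by blast
  have "\<exists>c f. coarse_equiv c (\<lambda>j. same (j * L)) agree E (seqs (card D ^ L) (card D ^ L)) f"
    if L: "L \<ge> L1" "L \<ge> L2" "L \<ge> 1" for L
  proof -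
    define Nd where "Nd j = nodes (j * L)" for j
    define pt where "pt j = cell (j * L)" for j
    define ch where "ch j A = {C \<in> nodes (j * L + L). above L A C}" for j A
    define gd where "gd j = good (j * L)" for j
    define \<alpha> where "\<alpha> j A = card A div g" for j :: nat and A :: "('d \<Rightarrow> int) set"
    have same_eq: "(\<lambda>k x y. \<exists>A\<in>Nd k. x \<in> pt k A \<and> y \<in> pt k A) =
        (\<lambda>j. same (j * L))"
      by (simp add: fun_eq_iff same_def Nd_def pt_def)
    have SucL: "Suc j * L = j * L + L" for j by simp
    have fin: "finite (ch j A)" for j A unfolding ch_def using finite_nodes by simp
    have above_sets: "{C. C \<in> nodes (j * L + L) \<and> above L A C} = ch j A" for j A by (simp add: ch_def)
    interpret mass_tree E Nd pt ch gd \<alpha> "card D ^ L" "M * card D ^ L" "pts 0" "\<lambda>k x y.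
        \<exists>A\<in>Nd k. x \<in> pt k A \<and> y \<in> pt k A"
    proof (unfold_locales, goal_cases)
      case 1
      then show ?case using cell_root by (simp add: Nd_def)
    next
      case 2
      then show ?case using cell_root by (simp add: pt_def)
    next
      case (3 A k)
      then show ?case
        using cell_split[of A "k * L" L] fin unfolding Nd_def pt_def SucL ch_def by auto
    next
      case (4 A k B x)
      then show ?case using cell_unique by (auto simp: Nd_def pt_def)
    next
      case (5 A k)
      then show ?case using cell_subset by (simp add: Nd_def pt_def)
    next
      case 6
      then show ?case unfolding same_eq using tower_same[OF L(3)] .
    next
      case (7 A k B)
      then show ?case using good_above[of "k * L" A L B] by (auto simp: gd_def ch_def add.commute)
    next
      case (8 A k)
      then have A: "A \<in> nodes (k * L)" "g dvd card A"
        using above_refl unfolding Nd_def gd_def good_def by (auto, metis add.right_neutral)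
      have "card A \<noteq> 0" using card_node[OF A(1)] by simp
      then show ?case using A(2) g_pos unfolding \<alpha>_def by (auto elim!: dvdE)
    next
      case (9 A k)
      then show ?case
        using L2[OF L(2), of A "k * L"] unfolding Nd_def gd_def \<alpha>_def ch_def by blast
    next
      case (10 A k)
      then have A: "A \<in> nodes (k * L)" by (simp add: Nd_def)
      have "{C \<in> ch k A. \<not> gd (Suc k) C} \<subseteq> comp (k * L + L) ` bad (k * L) A L"
      proof
        fix C assume "C \<in> {C \<in> ch k A. \<not> gd (Suc k) C}"
        then have C: "C \<in> nodes (k * L + L)" "above L A C" "\<not> good (k * L + L) C"
          by (auto simp: ch_def gd_def add.commute)
        obtain z where z: "z \<in> C" using node_ne[OF C(1)] by blast
        have Cz: "C = comp (k * L + L) z" by (rule node_comp[OF C(1) z])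
        have "z \<in> bad (k * L) A L"
          unfolding bad_def using C z node_pts[OF C(1)] Cz by (auto simp: above_def)
        then show "C \<in> comp (k * L + L) ` bad (k * L) A L" using Cz by blast
      qed
      then have "card {C \<in> ch k A. \<not> gd (Suc k) C} \<le> card (bad (k * L) A L)"
        by (rule surj_card_le[OF finite_bad])
      then show ?case using L1[OF L(1) A] by simp
    next
      \<comment> \<open>Without a good child, all \<open>card A * card D ^ L\<close> points below
        \<open>A\<close> would be bad, more than \<open>few_bad\<close> permits.\<close>
      case (11 A k)
      then have A: "A \<in> nodes (k * L)" by (simp add: Nd_def)
      show ?case
      proof
        assume none: "{C \<in> ch k A. gd (Suc k) C} = {}"
        have "{z \<in> pts (k * L + L). zdiv (n ^ L) z \<in> A} \<subseteq> bad (k * L) A L"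
        proof
          fix z assume z: "z \<in> {z \<in> pts (k * L + L). zdiv (n ^ L) z \<in> A}"
          then have "comp (k * L + L) z \<in> ch k A"
            using above_comp[OF A] by (auto simp: ch_def nodes_def)
          then have "\<not> good (k * L + L) (comp (k * L + L) z)" using none by (auto simp: gd_def add.commute)
          then show "z \<in> bad (k * L) A L" using z by (simp add: bad_def)
        qed
        then have "card {z \<in> pts (k * L + L). zdiv (n ^ L) z \<in> A} \<le> card (bad (k * L) A L)"
          by (rule card_mono[OF finite_bad])
        then have "card A * card D ^ L < card D ^ L"
          using card_pts_above[OF node_pts[OF A], of L] L1[OF L(1) A] by linarith
        then show False using card_node[OF A] by simp
      qed
    next
      case (12 A k)
      then have A: "A \<in> nodes (k * L)" by (simp add: Nd_def)
      have "(\<Sum>C | C \<in> ch k A \<and> gd (Suc k) C. \<alpha> (Suc k) C) \<le> (\<Sum>C\<in>ch k A.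
          \<alpha> (Suc k) C)"
        by (rule sum_mono2) (use fin in auto)
      also have "\<dots> \<le> (\<Sum>C\<in>ch k A. card C)" by (rule sum_mono) (simp add: \<alpha>_def)
      also have "\<dots> = card A * card D ^ L" using sum_card_above[OF A, of L] unfolding above_sets .
      also have "\<dots> \<le> M * card D ^ L" using card_node[OF A] by simp
      finally show ?case .
    next
      case 13
      have "2 ^ 1 \<le> card D ^ 1" using card_D by simp
      also have "card D ^ 1 \<le> card D ^ L" using card_D L by (intro power_increasing) auto
      finally show ?case by simp
    qed
    show ?thesis using coarse_equiv_seqs unfolding same_eq .
  qed
  then show ?thesis by (intro exI[of _ "max 1 (max L1 L2)"]) auto
qed

lemma coded_E: "\<exists>L0\<ge>1. \<forall>L\<ge>L0. coded E (card D ^ L) (real (n ^ L))"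
proof -
  obtain L0 where L0: "L0 \<ge> 1" "\<And>L. L \<ge> L0 \<Longrightarrow>
      \<exists>c f. coarse_equiv c (\<lambda>j. same (j * L)) agree E (seqs (card D ^ L) (card D ^ L)) f"
    using coarse_equiv_E by blast
  have "coded E (card D ^ L) (real (n ^ L))" if L: "L \<ge> L0" for L
  proof -
    obtain c f where f: "coarse_equiv c (\<lambda>j. same (j * L)) agree E (seqs (card D ^ L) (card D ^ L)) f"
      using L0(2)[OF L] by blast
    define K where "K = real CARD('d) * (real B + 1)"
    define b where "b = real (n ^ L)"
    have b: "b \<ge> 1" unfolding b_def using n by simp
    have bp: "b ^ j = real (n ^ (j * L))" for j by (simp add: b_def power_mult mult.commute)
    have K: "K \<ge> 0" by (simp add: K_def)
    \<comment> \<open>\<open>K / b ^ j\<close> bounds the diameter of a cell of level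
      \<open>j * L\<close>, and the shift by \<open>c\<close> levels costs \<open>b ^ c\<close>. The
      summand 1 makes \<open>C\<close> at least \<open>b ^ c\<close>, as the other direction
      needs.\<close>
    define C where "C = (K + 1) * b ^ c"
    have bc: "b ^ c \<ge> 1" using b by simp
    have C: "C \<ge> 1" "C \<ge> K * b ^ c" "C \<ge> b ^ c"
    proof -
      have "1 * 1 \<le> (K + 1) * b ^ c" using K bc by (intro mult_mono) auto
      then show "C \<ge> 1" by (simp add: C_def)
      show "C \<ge> K * b ^ c" "C \<ge> b ^ c" using K bc by (auto simp: C_def distrib_right)
    qed
    have "dist x y \<le> C / b ^ j" if xy: "x \<in> E" "y \<in> E" "agree j (f x) (f y)" for x y j
    proof -
      have "dist x y \<le> K / b ^ (j - c)"
      proof (cases "c \<le> j")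
        case True
        then have "same ((j - c) * L) x y" using f xy unfolding coarse_equiv_def by (metis le_add_diff_inverse2)
        from same_dist[OF this] show ?thesis by (simp only: bp K_def)
      next
        case False
        \<comment> \<open>For \<open>j < c\<close> the truncated difference \<open>j - c\<close> is
          0, and the single cell of level 0 is all of \<open>E\<close>.\<close>
        have "same 0 x y" unfolding same_def using cell_root xy by metis
        from same_dist[OF this] show ?thesis using False by (simp add: K_def)
      qed
      also have "\<dots> \<le> K * b ^ c / b ^ j"
      proof -
        have "b ^ j \<le> b ^ (c + (j - c))" using b by (intro power_increasing) auto
        then have "K * b ^ j \<le> K * (b ^ c * b ^ (j - c))" using K by (intro mult_left_mono) (auto simp:
            power_add)
        then show ?thesis using b by (simp add: field_simps)
      qed
      also have "\<dots> \<le> C / b ^ j" using C(2) b by (intro divide_right_mono) auto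
      finally show ?thesis .
    qed
    moreover have "agree j (f x) (f y)" if xy: "x \<in> E" "y \<in> E" "dist x y < 1 / (C * b ^ j)" for x y j
    proof -
      have "1 / (C * b ^ j) \<le> 1 / b ^ (j + c)"
      proof (rule divide_left_mono)
        show "b ^ (j + c) \<le> C * b ^ j"
          using C(3) b by (simp add: power_add mult.commute[of "b ^ j"] mult_right_mono)
        show "0 < C * b ^ j * b ^ (j + c)" using C(1) b by simp
      qed simp
      then have "dist x y < 1 / real (n ^ ((j + c) * L))" using xy(3) unfolding bp by linarith
      then have "same ((j + c) * L) x y" by (rule same_near[OF xy(1,2)])
      then show ?thesis using f xy unfolding coarse_equiv_def by blast
    qed
    ultimately show ?thesis
      unfolding coded_def b_def[symmetric] using C(1) coarse_equiv_bij[OF f] by blast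
  qed
  then show ?thesis using L0(1) by blast
qed

end

section \<open>Assembly for two fractal cubes\<close>

lemma fractal_cube_coded:
  fixes D :: "(nat ^ 'd) set"
  assumes n: "n \<ge> 2" and D: "digit_set n D" "card D \<ge> 2" and td: "totally_disconnected
      (fractal_cube n D)"
  shows "\<exists>L0\<ge>1. \<forall>L\<ge>L0. coded (fractal_cube n D) (card D ^ L) (real (n ^ L))"
proof -
  have ne: "D \<noteq> {}" using D(2) by auto
  interpret digits n D by unfold_locales (use n D ne in auto)
  obtain B where B: "\<And>k z w i. \<lbrakk>(z, w) \<in> (link k)\<^sup>*; z \<in> pts k\<rbrakk>
      \<Longrightarrow> \<bar>z i - w i\<bar> \<le> int B"
    using link_bounded td unfolding E_def by blast
  interpret bounded_digits n D B by unfold_locales (use B assms(3) in auto)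
  obtain k0 A0 where A0: "interior_node k0 A0" using exists_interior_node by blast
  interpret good_digits n D B k0 A0 by unfold_locales (rule A0)
  show ?thesis using coded_E unfolding E_def .
qed

theorem theorem1p1:
  fixes n n' :: nat
    and D :: "(nat ^ 'd) set" and D' :: "(nat ^ 'e) set"
    and E :: "(real ^ 'd) set" and F :: "(real ^ 'e) set"
  assumes "n \<ge> 2" and "n' \<ge> 2"
    and "digit_set n D" and "digit_set n' D'"
    and "card D \<ge> 2" and "card D' \<ge> 2"
    and "E = fractal_cube n D" and "F = fractal_cube n' D'"
    and "totally_disconnected E" and "totally_disconnected F"
  shows "strictly_Hoelder_equivalent E F \<longleftrightarrow> ln (real (card D)) / ln (real (card D')) \<in> \<rat>"
proof -
  obtain L where L: "L \<ge> 1" "\<And>l. l \<ge> L \<Longrightarrow> coded E (card D ^ l) (real (n ^ l))"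
    using fractal_cube_coded[OF assms(1,3,5)] assms(7,9) by auto
  obtain L' where L': "L' \<ge> 1" "\<And>l. l \<ge> L' \<Longrightarrow> coded F (card D' ^ l) (real (n' ^ l))"
    using fractal_cube_coded[OF assms(2,4,6)] assms(8,10) by auto
  have big: "m ^ l \<ge> 2" if "m \<ge> 2" "l \<ge> 1" for m l :: nat
    using power_increasing[of 1 l m] that by simp
  have base: "real (m ^ l) > 1" if "m \<ge> 2" "l \<ge> 1" for m l :: nat
    using big[OF that] by linarith
  show ?thesis
    unfolding ln_ratio_rational_iff[OF assms(5,6)]
  proof
    assume "strictly_Hoelder_equivalent E F"
    then obtain k l where "k \<ge> 1" "l \<ge> 1" "(card D ^ L) ^ k = (card D' ^ L') ^ l"
      using Hoelder_equivalent_imp_power_relation[OF L(2)[OF order_refl] L'(2)[OF order_refl]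
          base[OF assms(1) L(1)] base[OF assms(2) L'(1)] big[OF assms(5) L(1)] big[OF assms(6) L'(1)]]
      by blast
    then show "\<exists>k l. k \<ge> 1 \<and> l \<ge> 1 \<and> card D ^ k = card D' ^ l"
      using L(1) L'(1) by (intro exI[of _ "L * k"] exI[of _ "L' * l"]) (simp add: power_mult)
  next
    assume "\<exists>k l. k \<ge> 1 \<and> l \<ge> 1 \<and> card D ^ k = card D' ^ l"
    then obtain k l where kl: "k \<ge> 1" "l \<ge> 1" "card D ^ k = card D' ^ l" by blast
    \<comment> \<open>Multiplying both exponents by \<open>m\<close> keeps the equation and lifts
      them over the two thresholds, so that both cubes are coded with one alphabet.\<close>
    define m where "m = L + L'"
    have m: "m \<le> k * m" "m \<le> l * m" using kl by simp_all
    have km: "k * m \<ge> L" "l * m \<ge> L'" "k * m \<ge> 1" "l * m \<ge> 1"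
      using m L(1) L'(1) by (simp_all only: m_def)
    have "card D ^ (k * m) = card D' ^ (l * m)" using kl(3) by (simp add: power_mult)
    then have "coded F (card D ^ (k * m)) (real (n' ^ (l * m)))" using L'(2)[OF km(2)] by simp
    with L(2)[OF km(1)] show "strictly_Hoelder_equivalent E F"
      by (rule coded_imp_Hoelder_equivalent) (intro base assms km)+
  qed
qed

end
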